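(* Let $d \geq 1$, let $1 \leq p, q \leq \infty$ with $1/p + 1/q = 1$, and let $s > d/p$. Then for every positive integer $N$ and every $N$-point set $X_N \subset \mathbb{S}^d$, $$\rho(X_N) \leq c_{s,d} \left[\operatorname{wce}(Q[X_N];\mathbb{W}_p^s(\mathbb{S}^d))\right]^{1/(s + d/q)},$$ where the constant $c_{s,d}$ depends on $s$ and $d$ but not on $p$, $q$ or $N$.
   Context: $\mathbb{S}^d$ is the unit sphere in $\mathbb{R}^{d+1}$, $\sigma_d$ its normalized surface area measure, and $\mathbb{L}_p(\mathbb{S}^d)$ the real $L_p$ space with respect to $\sigma_d$, with norm $\|\cdot\|_p$. Convention: $1/\infty = 0$. Sobolev space: for $f \in \mathbb{L}_1(\mathbb{S}^d)$ let $Y_\ell[f]$ be the projection of $f$ onto the spherical harmonics of exact degree $\ell$ on $\mathbb{S}^d$ (defined by integrating $f$ against the zonal reproducing kernel of that space), and let $\lambda_\ell = \ell(\ell+d-1)$ be the corresponding eigenvalue of the negative Laplace–Beltrami operator $-\Delta_d^*$. For $s \geq 0$, $1 \leq p \leq \infty$, $\mathbb{W}_p^s(\mathbb{S}^d)$ is the set of $f \in \mathbb{L}_p(\mathbb{S}^d)$ for which $(1-\Delta_d^* )^{s/2} f = \sum_{\ell\ge 0} (1+\lambda_\ell)^{s/2} Y_\ell[f]$ is in $\mathbb{L}_p(\mathbb{S}^d)$ (i.e. there is $g\in \mathbb{L}_p(\mathbb{S}^d)$ with $Y_\ell[g] = (1+\lambda_\ell)^{s/2} Y_\ell[f]$ for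 all $\ell$), with norm $\|f\|_{\mathbb{W}_p^s(\mathbb{S}^d)} = \|(1-\Delta_d^* )^{s/2} f\|_p$. For $s > d/p$ this space embeds continuously into $C(\mathbb{S}^d)$, and its elements are identified with their continuous representatives. Worst-case error: for $X_N = \{\mathbf{x}_1,\dots,\mathbf{x}_N\}\subset \mathbb{S}^d$, $Q[X_N](f) = \frac1N \sum_{k=1}^N f(\mathbf{x}_k)$, $I(f) = \int_{\mathbb{S}^d} f\, d\sigma_d$, and for $s>d/p$ $$\operatorname{wce}(Q[X_N]; \mathbb{W}_p^s(\mathbb{S}^d)) = \sup\{ |Q[X_N](f) - I(f)| : f \in \mathbb{W}_p^s(\mathbb{S}^d),\ \|f\|_{\mathbb{W}_p^s(\mathbb{S}^d)} \leq 1\}.$$ Covering radius: $\rho(X_N) = \max_{\mathbf{x} \in \mathbb{S}^d} \min_{1 \leq k \leq N} \arccos(\mathbf{x} \cdot \mathbf{x}_k)$. *)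

theory Defs
  imports "HOL-Analysis.Analysis" "HOL-Probability.Essential_Supremum"
begin

(* Throughout, the sphere is "sphere 0 1" in 'a::euclidean_space, so that its dimension is
   d = DIM('a) - 1.  Functions on the sphere are functions on 'a whose values off the sphere
   are irrelevant. *)

section \<open>Surface measure and Lebesgue spaces\<close>

(* Normalized surface area: the share of A is the share of the unit ball that is filled by the
   cone over A, i.e. the image of the uniform distribution under radial projection.  The centre,
   a null set, is sent to 0 and drops out on restriction to the sphere. *)
definition sphere_measure :: "'a::euclidean_space measure" where
  "sphere_measure =
     restrict_space (distr (uniform_measure lborel (ball 0 1)) borel (\<lambda>x. x /\<^sub>R norm x)) (sphere 0 1)"

(* The power x^r on [0,\<infinity>] for exponents r > 0. *)
definition ennpowr :: "ennreal \<Rightarrow> real \<Rightarrow> ennreal" where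
  "ennpowr x r = (if x = \<infinity> then \<infinity> else ennreal (enn2real x powr r))"

(* Takes the value \<infinity> when the norm is not finite; meant for p in [1,\<infinity>]. *)
definition Lp_norm :: "'b measure \<Rightarrow> ennreal \<Rightarrow> ('b \<Rightarrow> real) \<Rightarrow> ennreal" where
  "Lp_norm M p f =
     (if p = \<infinity> then esssup M (\<lambda>x. ennreal \<bar>f x\<bar>)
      else ennpowr (\<integral>\<^sup>+ x. ennreal (\<bar>f x\<bar> powr enn2real p) \<partial>M) (1 / enn2real p))"

definition Lp_space :: "'b measure \<Rightarrow> ennreal \<Rightarrow> ('b \<Rightarrow> real) set" where
  "Lp_space M p = {f \<in> borel_measurable M. Lp_norm M p f < \<infinity>}"

section \<open>Spherical harmonics\<close>

definition laplacian :: "('a::euclidean_space \<Rightarrow> real) \<Rightarrow> 'a \<Rightarrow> real" where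
  "laplacian f x = (\<Sum>b\<in>Basis. deriv (deriv (\<lambda>t. f (x + t *\<^sub>R b))) 0)"

definition harmonic_homogeneous_polynomials :: "nat \<Rightarrow> ('a::euclidean_space \<Rightarrow> real) set" where
  "harmonic_homogeneous_polynomials l =
     {P. real_polynomial_function P \<and> (\<forall>c x. P (c *\<^sub>R x) = c ^ l * P x) \<and> (\<forall>x. laplacian P x = 0)}"

definition spherical_harmonics :: "nat \<Rightarrow> ('a::euclidean_space \<Rightarrow> real) set" where
  "spherical_harmonics l = (\<lambda>P. restrict P (sphere 0 1)) ` harmonic_homogeneous_polynomials l"

(* The reproducing kernel y \<mapsto> K(x,y) of the spherical harmonics of degree l in the L2 inner
   product, for x on the sphere. *)
definition zonal_kernel :: "nat \<Rightarrow> 'a::euclidean_space \<Rightarrow> 'a \<Rightarrow> real" where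
  "zonal_kernel l x =
     (THE k. k \<in> spherical_harmonics l \<and>
             (\<forall>h\<in>spherical_harmonics l. h x = (\<integral>y. h y * k y \<partial>sphere_measure)))"

definition harmonic_proj :: "nat \<Rightarrow> ('a::euclidean_space \<Rightarrow> real) \<Rightarrow> 'a \<Rightarrow> real" where
  "harmonic_proj l f x = (\<integral>y. f y * zonal_kernel l x y \<partial>sphere_measure)"

definition laplace_beltrami_eigenvalue :: "nat \<Rightarrow> nat \<Rightarrow> real" where
  "laplace_beltrami_eigenvalue d l = real l * (real l + real d - 1)"

section \<open>Sobolev spaces\<close>

(* g represents (1 - \<Delta>)^(s/2) f, where \<Delta> is the Laplace-Beltrami operator. *)
definition is_bessel_derivative ::
    "real \<Rightarrow> ('a::euclidean_space \<Rightarrow> real) \<Rightarrow> ('a \<Rightarrow> real) \<Rightarrow> bool" where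
  "is_bessel_derivative s f g \<longleftrightarrow>
     (\<forall>l. \<forall>x\<in>sphere 0 1. harmonic_proj l g x =
        (1 + laplace_beltrami_eigenvalue (DIM('a) - 1) l) powr (s / 2) * harmonic_proj l f x)"

definition sobolev_space :: "ennreal \<Rightarrow> real \<Rightarrow> ('a::euclidean_space \<Rightarrow> real) set" where
  "sobolev_space p s =
     {f \<in> Lp_space sphere_measure p. \<exists>g\<in>Lp_space sphere_measure p. is_bessel_derivative s f g}"

(* A representative of (1 - \<Delta>)^(s/2) f, for f in the Sobolev space; it is determined up to
   null sets, since an integrable function is determined by its harmonic projections. *)
definition bessel_derivative ::
    "ennreal \<Rightarrow> real \<Rightarrow> ('a::euclidean_space \<Rightarrow> real) \<Rightarrow> 'a \<Rightarrow> real" where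
  "bessel_derivative p s f =
     (SOME g. g \<in> Lp_space sphere_measure p \<and> is_bessel_derivative s f g)"

definition sobolev_norm :: "ennreal \<Rightarrow> real \<Rightarrow> ('a::euclidean_space \<Rightarrow> real) \<Rightarrow> ennreal" where
  "sobolev_norm p s f = Lp_norm sphere_measure p (bessel_derivative p s f)"

section \<open>Cubature and covering\<close>

definition equal_weight_rule :: "'a set \<Rightarrow> ('a \<Rightarrow> real) \<Rightarrow> real" where
  "equal_weight_rule X f = (\<Sum>x\<in>X. f x) / real (card X)"

(* The supremum is taken in [0,\<infinity>], so no finiteness is built in.  For s > d/p every class in
   the Sobolev space has a unique continuous representative, whence the restriction on f. *)
definition wce :: "'a::euclidean_space set \<Rightarrow> ennreal \<Rightarrow> real \<Rightarrow> ennreal" where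
  "wce X p s =
     (SUP f\<in>{f \<in> sobolev_space p s. continuous_on (sphere 0 1) f \<and> sobolev_norm p s f \<le> 1}.
        ennreal \<bar>equal_weight_rule X f - (\<integral>x. f x \<partial>sphere_measure)\<bar>)"

(* For finite nonempty X the supremum is a maximum, by compactness. *)
definition covering_radius :: "'a::euclidean_space set \<Rightarrow> real" where
  "covering_radius X = (SUP x\<in>sphere 0 1. MIN y\<in>X. arccos (x \<bullet> y))"

end

theory Submission
  imports Defs "HOL-Probability.Probability_Measure" "HOL-Computational_Algebra.Polynomial"
begin

text \<open>
Let A = 1 - \<Delta> on the sphere. A covering radius \<rho> means that a cap of angular radius \<rho>/2, around some
point y, contains no node in its interior. A function that is concentrated on this cap is nearly
invisible to the rule Q, so its integral, divided by its Sobolev norm, bounds the worst-case error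
from below. Let \<delta>, of order \<rho>^2, be the height of the cap, c = 1 - \<delta>, and let the function be close
to the truncated power (t - c)_+^K in the variable t = x \<bullet> y. Its integral is of order
\<delta>^(K + d/2). If its Sobolev norm is at most of order \<delta>^(K - s/2 + d/(2p)), then the worst-case error
is at least of order \<delta>^((s + d/q)/2), that is \<rho>^(s + d/q), and the theorem follows.

To work with polynomials only, the truncated power is replaced by a polynomial F that is very close
to it together with its derivatives (polynomial_bump). The error may be chosen as a function of \<delta>, so it is
negligible. Every F(x \<bullet> y) is a finite combination of zonal harmonics (gegenbauer_expansion), hence
A^(s/2) F is a finite sum, and only its norm is at issue. For integers k the function A^k F is
computed by Leibniz' rule. Each factor A costs a factor 1/\<delta>, since 1 - t^2 \<le> 2\<delta> on the cap
(zonal_bessel_bound).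

Fractional powers are interpolated: N (A^b h) \<le> 2 r^(-b) (N h + r N (A h)) for 0 \<le> b < 1 and r > 0
(moment_inequality). The inequality holds for every rotation invariant seminorm N that is at most
the supremum norm, which is why the constant does not depend on p. Its root is that \<Delta> is a limit of
multiples of (averages of rotations) - 1. This gives N f \<le> N (f - e \<Delta>f) for e \<ge> 0 at once
(dissipative), so the resolvents 1 / (1 + r A) are contractions, and binomial series in them yield
the multiplier (r A)^b / (1 + r A).

The Sobolev norm is defined through a chosen representative of A^(s/2) f, and the projections through a
definite description of the reproducing kernel. The kernel is found from an orthonormal basis
(zonal_kernel_eq). Representatives agree almost everywhere because an integrable function without
harmonic projections vanishes (AE_zero_if_harmonic_proj_0): it is orthogonal to all powers
(x \<bullet> z)^k, hence to all exponentials exp(x \<bullet> z), whose span is dense by the Stone-Weierstrass theorem.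
\<close>

section \<open>The surface measure\<close>

lemma space_sphere_measure [simp]: "space sphere_measure = sphere 0 1"
  by (simp add: sphere_measure_def space_restrict_space)

lemma sets_sphere_measure: "sets (sphere_measure :: 'a::euclidean_space measure) = sets (restrict_space borel (sphere 0 1))"
  unfolding sphere_measure_def by (intro sets_restrict_space_cong) simp

lemma emeasure_sphere_measure:
  fixes A :: "'a::euclidean_space set"
  assumes "A \<in> sets borel" "A \<subseteq> sphere 0 1"
  shows "emeasure sphere_measure A =
    emeasure lborel (ball 0 1 \<inter> {x. x /\<^sub>R norm x \<in> A}) / emeasure lborel (ball 0 1 :: 'a set)"
proof -
  have m: "(\<lambda>x::'a. x /\<^sub>R norm x) \<in> uniform_measure lborel (ball 0 1) \<rightarrow>\<^sub>M borel"
    by measurable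
  have "emeasure sphere_measure A = emeasure (uniform_measure lborel (ball 0 1)) {x. x /\<^sub>R norm x \<in> A}"
    unfolding sphere_measure_def using assms m
    by (subst emeasure_restrict_space) (auto simp: emeasure_distr vimage_def)
  also have "\<dots> = emeasure lborel (ball 0 1 \<inter> {x. x /\<^sub>R norm x \<in> A}) / emeasure lborel (ball 0 1 :: 'a set)"
  proof (rule emeasure_uniform_measure)
    show "{x::'a. x /\<^sub>R norm x \<in> A} \<in> sets lborel"
      using measurable_sets[OF m assms(1)] by (simp add: vimage_def)
  qed simp
  finally show ?thesis .
qed

lemma emeasure_unit_ball_pos: "emeasure lborel (ball 0 1 :: 'a::euclidean_space set) \<noteq> 0"
  "emeasure lborel (ball 0 1 :: 'a::euclidean_space set) \<noteq> \<infinity>"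
proof -
  have "emeasure lborel (ball 0 1 :: 'a set) < \<infinity>"
    by (rule emeasure_bounded_finite) simp
  moreover have "measure lborel (ball 0 1 :: 'a set) > 0"
    by (rule content_ball_pos) simp
  ultimately show "emeasure lborel (ball 0 1 :: 'a set) \<noteq> 0"
    "emeasure lborel (ball 0 1 :: 'a set) \<noteq> \<infinity>"
    by (auto simp: measure_def)
qed

interpretation sphere: prob_space "sphere_measure :: 'a::euclidean_space measure"
proof
  have "emeasure (sphere_measure :: 'a measure) (sphere 0 1) =
      emeasure lborel (ball 0 1 \<inter> {x::'a. x /\<^sub>R norm x \<in> sphere 0 1}) / emeasure lborel (ball 0 1 :: 'a set)"
    by (rule emeasure_sphere_measure) auto
  also have "ball 0 1 \<inter> {x::'a. x /\<^sub>R norm x \<in> sphere 0 1} = ball 0 1 - {0}"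
    by auto
  also have "emeasure lborel (ball 0 1 - {0::'a}) = emeasure lborel (ball 0 1 :: 'a set)"
    by (rule emeasure_Diff_null_set) auto
  finally show "emeasure (sphere_measure :: 'a measure) (space sphere_measure) = 1"
    using emeasure_unit_ball_pos[where 'a='a] by (simp add: ennreal_divide_self top.not_eq_extremum)
qed

lemma borel_measurable_sphere_continuous:
  fixes f :: "'a::euclidean_space \<Rightarrow> 'b::topological_space"
  assumes "continuous_on (sphere 0 1) f"
  shows "f \<in> borel_measurable sphere_measure"
  using borel_measurable_continuous_on_restrict[OF assms]
  by (simp add: measurable_cong_sets[OF sets_sphere_measure refl])

lemma continuous_on_sphere_bounded:
  fixes f :: "'a::euclidean_space \<Rightarrow> real"
  assumes "continuous_on (sphere 0 1) f"
  obtains B where "B > 0" "\<And>x. x \<in> sphere 0 1 \<Longrightarrow> \<bar>f x\<bar> \<le> B"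
proof -
  have "bounded (f ` sphere 0 1)"
    using assms by (intro compact_imp_bounded compact_continuous_image) auto
  then obtain B where "B > 0" "\<forall>y\<in>f ` sphere 0 1. norm y \<le> B"
    unfolding bounded_pos by auto
  then show ?thesis using that[of B] by auto
qed

lemma integrable_sphere_continuous:
  fixes f :: "'a::euclidean_space \<Rightarrow> real"
  assumes "continuous_on (sphere 0 1) f"
  shows "integrable sphere_measure f"
proof -
  obtain B where "\<And>x. x \<in> sphere 0 1 \<Longrightarrow> \<bar>f x\<bar> \<le> B"
    using continuous_on_sphere_bounded[OF assms] by blast
  then have "AE x in sphere_measure. norm (f x) \<le> B"
    by (intro AE_I2) simp
  then show ?thesis
    by (rule sphere.integrable_const_bound) (rule borel_measurable_sphere_continuous[OF assms])
qed

lemma integral_sphere_abs_le: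
  fixes f :: "'a::euclidean_space \<Rightarrow> real"
  assumes "integrable sphere_measure f" "\<And>x. x \<in> sphere 0 1 \<Longrightarrow> \<bar>f x\<bar> \<le> B"
  shows "\<bar>\<integral>x. f x \<partial>sphere_measure\<bar> \<le> B"
proof -
  have "\<bar>\<integral>x. f x \<partial>sphere_measure\<bar> \<le> (\<integral>x. \<bar>f x\<bar> \<partial>sphere_measure)"
    by (rule integral_abs_bound)
  also have "\<dots> \<le> (\<integral>x. B \<partial>(sphere_measure :: 'a measure))"
    using assms by (intro integral_mono) auto
  also have "\<dots> = B" using sphere.prob_space[where 'a='a] by simp
  finally show ?thesis .
qed

section \<open>Rotation invariance of the surface measure\<close>

lemma borel_measurable_orthogonal [measurable_dest]:
  fixes T :: "'a::euclidean_space \<Rightarrow> 'a"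
  shows "orthogonal_transformation T \<Longrightarrow> T \<in> borel_measurable borel"
  by (intro borel_measurable_continuous_onI linear_continuous_on)
     (simp add: linear_conv_bounded_linear[symmetric] orthogonal_transformation_linear)

lemma nn_integral_lborel_translate:
  fixes f :: "'a::euclidean_space \<Rightarrow> ennreal"
  assumes [measurable]: "f \<in> borel_measurable borel"
  shows "(\<integral>\<^sup>+ x. f (c + x) \<partial>lborel) = (\<integral>\<^sup>+ x. f x \<partial>lborel)"
proof -
  have "(\<integral>\<^sup>+ x. f x \<partial>lborel) = (\<integral>\<^sup>+ x. f x \<partial>(distr lborel borel ((+) c)))"
    by (simp add: lborel_distr_plus)
  also have "\<dots> = (\<integral>\<^sup>+ x. f (c + x) \<partial>lborel)"
    by (subst nn_integral_distr) auto
  finally show ?thesis by simp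
qed

text \<open>The uniqueness argument for Haar measure: the measure A \<mapsto> |T^(-1)(A)| is again
translation invariant, so two applications of Fubini to the indicator of A(Tx + y) B(y) give
|T^(-1)(A)| |B| = |A| |B|. For B the unit ball no scaling factor is left, since T preserves
balls. No determinants are involved, so every Euclidean space is covered.\<close>

lemma emeasure_lborel_orthogonal_vimage:
  fixes T :: "'a::euclidean_space \<Rightarrow> 'a"
  assumes T: "orthogonal_transformation T" and A [measurable]: "A \<in> sets borel"
  shows "emeasure lborel (T -` A) = emeasure lborel A"
proof -
  let ?U = "inv T"
  define B :: "'a set" where "B = ball 0 1"
  have [measurable]: "B \<in> sets borel" by (simp add: B_def)
  have m [measurable]: "T \<in> borel_measurable borel" by (rule borel_measurable_orthogonal[OF T])
  have TU: "T (?U y) = y" for y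
    using orthogonal_transformation_surj[OF T] by (rule surj_f_inv_f)
  have lin: "linear T" by (rule orthogonal_transformation_linear[OF T])
  have TA [measurable]: "T -` A \<in> sets borel"
    using measurable_sets[OF m A] by simp
  have 1: "emeasure lborel (T -` A) = (\<integral>\<^sup>+ x. indicator A (T x + y) \<partial>lborel)" for y
  proof -
    have "emeasure lborel (T -` A) = (\<integral>\<^sup>+ x. indicator A (T x) \<partial>lborel)"
      using nn_integral_indicator[of "T -` A" lborel] TA by (simp add: indicator_vimage[symmetric] comp_def indicator_def)
    also have "\<dots> = (\<integral>\<^sup>+ x. indicator A (T (?U y + x)) \<partial>lborel)"
      by (rule nn_integral_lborel_translate[symmetric]) measurable
    finally show ?thesis by (simp add: linear_add[OF lin] TU add.commute)
  qed
  have 3: "(\<integral>\<^sup>+ x. indicator B (y - T x) \<partial>lborel) = emeasure lborel B" for y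
  proof -
    have "indicator B (y - T x) = (indicator (ball (?U y) 1) x :: ennreal)" for x
    proof -
      have "norm (y - T x) = norm (?U y - x)"
        using orthogonal_transformation_norm[OF T, of "?U y - x"] by (simp add: linear_diff[OF lin] TU)
      then show ?thesis by (simp add: B_def indicator_def dist_norm norm_minus_commute)
    qed
    then show ?thesis by (simp add: emeasure_ball B_def)
  qed
  have "emeasure lborel (T -` A) * emeasure lborel B
      = (\<integral>\<^sup>+ y. emeasure lborel (T -` A) * indicator B y \<partial>lborel)"
    by (simp add: nn_integral_cmult_indicator)
  also have "\<dots> = (\<integral>\<^sup>+ y. (\<integral>\<^sup>+ x. indicator A (T x + y) * indicator B y \<partial>lborel) \<partial>lborel)"
    by (intro nn_integral_cong) (simp add: 1[symmetric] nn_integral_multc)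
  also have "\<dots> = (\<integral>\<^sup>+ x. (\<integral>\<^sup>+ y. indicator A (T x + y) * indicator B y \<partial>lborel) \<partial>lborel)"
    by (rule lborel_pair.Fubini') measurable
  also have "\<dots> = (\<integral>\<^sup>+ x. (\<integral>\<^sup>+ y. indicator A y * indicator B (y - T x) \<partial>lborel) \<partial>lborel)"
  proof (rule nn_integral_cong)
    fix x
    show "(\<integral>\<^sup>+ y. indicator A (T x + y) * indicator B y \<partial>lborel) =
        (\<integral>\<^sup>+ y. indicator A y * indicator B (y - T x) \<partial>lborel)"
      using nn_integral_lborel_translate[of "\<lambda>y. indicator A y * indicator B (y - T x)" "T x"]
      by simp
  qed
  also have "\<dots> = (\<integral>\<^sup>+ y. (\<integral>\<^sup>+ x. indicator A y * indicator B (y - T x) \<partial>lborel) \<partial>lborel)"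
    by (rule lborel_pair.Fubini') measurable
  also have "\<dots> = (\<integral>\<^sup>+ y. indicator A y * emeasure lborel B \<partial>lborel)"
    by (intro nn_integral_cong) (simp add: 3 nn_integral_cmult)
  also have "\<dots> = emeasure lborel A * emeasure lborel B"
    by (simp add: nn_integral_multc)
  finally show ?thesis
    using emeasure_unit_ball_pos[where 'a='a] unfolding B_def
    by (metis ennreal_mult_divide_eq infinity_ennreal_def mult.commute)
qed

lemma orthogonal_measurable_sphere:
  fixes T :: "real^'n \<Rightarrow> real^'n"
  assumes T: "orthogonal_transformation T"
  shows "T \<in> sphere_measure \<rightarrow>\<^sub>M sphere_measure"
proof -
  have "T \<in> borel_measurable borel"
    by (rule borel_measurable_orthogonal[OF T])
  then have "T \<in> restrict_space borel (sphere 0 1) \<rightarrow>\<^sub>M restrict_space borel (sphere 0 1)"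
    using orthogonal_transformation_norm[OF T]
    by (intro measurable_restrict_space3) auto
  then show ?thesis
    by (simp add: measurable_cong_sets[OF sets_sphere_measure sets_sphere_measure])
qed

lemma sphere_measure_orthogonal_invariant:
  fixes T :: "real^'n \<Rightarrow> real^'n"
  assumes T: "orthogonal_transformation T"
  shows "distr sphere_measure sphere_measure T = sphere_measure"
proof (rule measure_eqI)
  fix A assume "A \<in> sets (distr sphere_measure sphere_measure T :: (real^'n) measure)"
  then have A': "A \<in> sets sphere_measure" by simp
  then have A: "A \<in> sets borel" "A \<subseteq> sphere 0 1"
    by (auto simp: sets_sphere_measure sets_restrict_space_iff)
  have m: "(\<lambda>x::real^'n. x /\<^sub>R norm x) \<in> borel_measurable borel"
    by measurable
  have nT: "norm (T x) = norm x" for x by (rule orthogonal_transformation_norm[OF T])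
  have sub: "T -` A \<subseteq> sphere 0 1" using A(2) nT by auto
  have mT: "T \<in> borel_measurable borel"
    by (rule borel_measurable_orthogonal[OF T])
  have "emeasure (distr sphere_measure sphere_measure T) A = emeasure sphere_measure (T -` A \<inter> sphere 0 1)"
    using A' by (subst emeasure_distr) (auto intro: orthogonal_measurable_sphere[OF T])
  also have "T -` A \<inter> sphere 0 1 = T -` A" using sub by auto
  also have "emeasure sphere_measure (T -` A) =
      emeasure lborel (ball 0 1 \<inter> {x. x /\<^sub>R norm x \<in> T -` A}) / emeasure lborel (ball 0 1 :: (real^'n) set)"
    using sub measurable_sets[OF mT A(1)] by (intro emeasure_sphere_measure) auto
  also have "ball 0 1 \<inter> {x. x /\<^sub>R norm x \<in> T -` A} = T -` (ball 0 1 \<inter> {x. x /\<^sub>R norm x \<in> A})"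
    using nT by (auto simp: orthogonal_transformation_scaleR[OF T])
  also have "emeasure lborel \<dots> = emeasure lborel (ball 0 1 \<inter> {x. x /\<^sub>R norm x \<in> A})"
  proof (rule emeasure_lborel_orthogonal_vimage[OF T])
    have "{x::real^'n. x /\<^sub>R norm x \<in> A} \<in> sets borel"
      using measurable_sets[OF m A(1)] by (simp add: vimage_def)
    then show "ball 0 1 \<inter> {x::real^'n. x /\<^sub>R norm x \<in> A} \<in> sets borel" by auto
  qed
  also have "\<dots> / emeasure lborel (ball 0 1 :: (real^'n) set) = emeasure sphere_measure A"
    using A by (simp add: emeasure_sphere_measure)
  finally show "emeasure (distr sphere_measure sphere_measure T) A = emeasure sphere_measure A" .
qed simp

lemma integral_sphere_orthogonal:
  fixes T :: "real^'n \<Rightarrow> real^'n" and f :: "real^'n \<Rightarrow> real"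
  assumes T: "orthogonal_transformation T" and f: "f \<in> borel_measurable sphere_measure"
  shows "(\<integral>x. f (T x) \<partial>sphere_measure) = (\<integral>x. f x \<partial>sphere_measure)"
  using integral_distr[OF orthogonal_measurable_sphere[OF T] f]
  by (simp add: sphere_measure_orthogonal_invariant[OF T])

section \<open>Measure of spherical caps\<close>

text \<open>The parameter t is the height of the cap; its angular radius is arccos (1 - t).\<close>

definition cap :: "'a::euclidean_space \<Rightarrow> real \<Rightarrow> 'a set" where
  "cap y t = {x \<in> sphere 0 1. x \<bullet> y \<ge> 1 - t}"

lemma cap_borel [measurable]: "cap y t \<in> sets borel"
proof -
  have "cap y t = sphere 0 1 \<inter> {x. 1 - t \<le> x \<bullet> y}"
    by (auto simp: cap_def)
  moreover have "closed {x. 1 - t \<le> x \<bullet> y}"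
    by (intro closed_Collect_le continuous_intros)
  ultimately show ?thesis by (simp add: borel_closed)
qed

lemma cap_sets: "cap y t \<in> sets sphere_measure"
  using cap_borel[of y t] by (auto simp: sets_sphere_measure sets_restrict_space_iff cap_def)

lemma measure_cap_eq:
  fixes y :: "'a::euclidean_space"
  shows "measure sphere_measure (cap y t) =
    measure lborel (ball 0 1 \<inter> {x. x /\<^sub>R norm x \<in> cap y t}) / measure lborel (ball 0 1 :: 'a set)"
proof -
  have "emeasure sphere_measure (cap y t) =
    emeasure lborel (ball 0 1 \<inter> {x. x /\<^sub>R norm x \<in> cap y t}) / emeasure lborel (ball 0 1 :: 'a set)"
    by (rule emeasure_sphere_measure) (auto simp: cap_def cap_borel[unfolded cap_def])
  moreover have "emeasure lborel (ball 0 1 \<inter> {x. x /\<^sub>R norm x \<in> cap y t})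
      = ennreal (measure lborel (ball 0 1 \<inter> {x. x /\<^sub>R norm x \<in> cap y t}))"
    by (rule emeasure_eq_ennreal_measure)
       (use emeasure_bounded_finite[of "ball 0 1 \<inter> {x. x /\<^sub>R norm x \<in> cap y t}"]
          bounded_subset[OF bounded_ball Int_lower1] in \<open>auto simp: less_top\<close>)
  moreover have "emeasure lborel (ball 0 1 :: 'a set) = ennreal (measure lborel (ball 0 1 :: 'a set))"
    using emeasure_unit_ball_pos[where 'a='a] by (intro emeasure_eq_ennreal_measure) auto
  moreover have "measure lborel (ball 0 1 :: 'a set) > 0"
    by (rule content_ball_pos) simp
  ultimately show ?thesis
    by (simp add: measure_def[of sphere_measure] divide_ennreal)
qed

lemma fmeasurable_cone_cap:
  "ball 0 1 \<inter> {x::'a::euclidean_space. x /\<^sub>R norm x \<in> cap y t} \<in> fmeasurable lborel"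
proof (rule fmeasurableI)
  have "{x::'a. x /\<^sub>R norm x \<in> cap y t} \<in> sets lborel"
    by measurable
  then show "ball 0 1 \<inter> {x::'a. x /\<^sub>R norm x \<in> cap y t} \<in> sets lborel" by auto
  show "emeasure lborel (ball 0 1 \<inter> {x::'a. x /\<^sub>R norm x \<in> cap y t}) < \<infinity>"
    by (rule emeasure_bounded_finite) auto
qed

lemma measure_cap_orthogonal:
  fixes T :: "real^'n \<Rightarrow> real^'n"
  assumes T: "orthogonal_transformation T"
  shows "measure sphere_measure (cap (T y) t) = measure sphere_measure (cap y t)"
proof -
  have "measure sphere_measure (cap (T y) t) =
      measure (distr sphere_measure sphere_measure T) (cap (T y) t)"
    by (simp add: sphere_measure_orthogonal_invariant[OF T])
  also have "\<dots> = measure sphere_measure (T -` cap (T y) t \<inter> space sphere_measure)"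
    by (rule measure_distr[OF orthogonal_measurable_sphere[OF T] cap_sets])
  also have "T -` cap (T y) t \<inter> space sphere_measure = cap y t"
    using T by (auto simp: cap_def orthogonal_transformation_def orthogonal_transformation_norm[OF T])
  finally show ?thesis .
qed

lemma measure_cap_axis:
  fixes y :: "real^'n"
  assumes "y \<in> sphere 0 1"
  shows "measure sphere_measure (cap y t) = measure sphere_measure (cap (axis k 1 :: real^'n) t)"
proof -
  obtain T where "orthogonal_transformation T" "T (axis k 1 :: real^'n) = y"
    using orthogonal_transformation_exists[of "axis k 1 :: real^'n" y] assms by (auto simp: norm_axis_1)
  then show ?thesis using measure_cap_orthogonal[of T "axis k 1" t] by simp
qed

lemma content_box_axis:
  fixes k :: "'n::finite"
  assumes "l \<le> u" "a \<ge> 0"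
  shows "measure lborel (cbox (\<chi> i. if i = k then l else - a) (\<chi> i. if i = k then u else a) :: (real^'n) set)
    = (u - l) * (2 * a) ^ (CARD('n) - 1)"
proof -
  have ne: "cbox (\<chi> i. if i = k then l else - a) (\<chi> i. if i = k then u else a) \<noteq> ({} :: (real^'n) set)"
    using assms by (auto simp: interval_ne_empty_cart)
  have "(\<Prod>i\<in>UNIV. (\<chi> i. if i = k then u else a) $ i - (\<chi> i. if i = k then l else - a) $ i) =
     (u - l) * (\<Prod>i\<in>UNIV - {k}. 2 * a)"
    by (subst prod.remove[of _ k]) (auto intro!: prod.cong)
  then show ?thesis
    using content_cbox_cart[OF ne] by (simp add: card_Diff_singleton)
qed

lemma inner_self_split_axis:
  fixes x :: "real^'n"
  shows "x \<bullet> x = (x $ k)\<^sup>2 + (\<Sum>i\<in>UNIV - {k}. (x $ i)\<^sup>2)"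
  by (simp add: inner_vec_def power2_eq_square sum.remove[of _ k])

text \<open>A cap of height t has angular radius of order \<surd>t. The cone over it inside the unit ball lies in a
box of length 2 along the axis and of width 2\<surd>(2t) in the d other directions, because
|x|^2 - (x \<bullet> y)^2 \<le> 1 - (1 - t)^2 \<le> 2t on that cone.\<close>

lemma measure_cap_upper:
  "\<exists>C>0. \<forall>y\<in>sphere 0 1. \<forall>t. 0 < t \<longrightarrow> t \<le> 1 \<longrightarrow>
     measure sphere_measure (cap (y::real^'n) t) \<le> C * sqrt t ^ (CARD('n) - 1)"
proof -
  let ?V = "measure lborel (ball 0 1 :: (real^'n) set)"
  have V: "?V > 0" by (rule content_ball_pos) simp
  let ?C = "2 * (2 * sqrt 2) ^ (CARD('n) - 1) / ?V"
  have "measure sphere_measure (cap y t) \<le> ?C * sqrt t ^ (CARD('n) - 1)"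
    if y: "y \<in> sphere 0 1" and t: "0 < t" "t \<le> 1" for y :: "real^'n" and t
  proof -
    fix k :: 'n
    let ?A = "ball 0 1 \<inter> {x. x /\<^sub>R norm x \<in> cap (axis k 1) t} :: (real^'n) set"
    let ?B = "cbox (\<chi> i. if i = k then -1 else - sqrt (2 * t)) (\<chi> i. if i = k then 1 else sqrt (2 * t)) :: (real^'n) set"
    have "?A \<subseteq> ?B"
    proof
      fix x :: "real^'n" assume "x \<in> ?A"
      then have x: "norm x < 1" "x \<noteq> 0" and c: "inverse (norm x) * (x $ k) \<ge> 1 - t"
        by (auto simp: cap_def inner_axis split: if_splits)
      have c': "x $ k \<ge> (1 - t) * norm x"
        using c x by (simp add: field_simps)
      have nn: "(norm x)\<^sup>2 = x \<bullet> x" by (rule power2_norm_eq_inner)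
      have "((1 - t) * norm x)\<^sup>2 \<le> (x $ k)\<^sup>2"
        using c' t by (intro power_mono) auto
      then have "(\<Sum>i\<in>UNIV - {k}. (x $ i)\<^sup>2) \<le> (norm x)\<^sup>2 * (1 - (1 - t)\<^sup>2)"
        using inner_self_split_axis[of x k] nn
        unfolding power_mult_distrib right_diff_distrib mult.commute[of "(norm x)\<^sup>2"] by linarith
      also have "\<dots> \<le> 1 * (1 - (1 - t)\<^sup>2)"
        using x t by (intro mult_right_mono) (auto simp: power_le_one_iff abs_square_le_1)
      also have "\<dots> \<le> 2 * t" by (simp add: power2_eq_square algebra_simps)
      finally have s: "(\<Sum>i\<in>UNIV - {k}. (x $ i)\<^sup>2) \<le> 2 * t" .
      have "\<bar>x $ i\<bar> \<le> sqrt (2 * t)" if "i \<noteq> k" for i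
      proof -
        have "(x $ i)\<^sup>2 \<le> (\<Sum>i\<in>UNIV - {k}. (x $ i)\<^sup>2)"
          using that by (intro member_le_sum) auto
        then have "(x $ i)\<^sup>2 \<le> 2 * t" using s by simp
        then show ?thesis by (simp add: real_le_rsqrt)
      qed
      moreover have "\<bar>x $ k\<bar> \<le> 1" using component_le_norm_cart[of x k] x by simp
      ultimately show "x \<in> ?B"
        by (auto simp: mem_box_cart abs_le_iff minus_le_iff)
    qed
    then have "measure lborel ?A \<le> measure lborel ?B"
      by (intro measure_mono_fmeasurable) (auto simp: fmeasurable_cone_cap)
    also have "\<dots> = 2 * (2 * sqrt (2 * t)) ^ (CARD('n) - 1)"
      using t by (subst content_box_axis) auto
    also have "\<dots> = 2 * (2 * sqrt 2) ^ (CARD('n) - 1) * sqrt t ^ (CARD('n) - 1)"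
      by (simp add: real_sqrt_mult power_mult_distrib)
    finally show ?thesis
      unfolding measure_cap_axis[OF y, of t k] unfolding measure_cap_eq
      using V by (simp add: divide_right_mono)
  qed
  moreover have "?C > 0" using V by simp
  ultimately show ?thesis by blast
qed

text \<open>The counterpart of the preceding bound: a box around the segment from 1/4 to 1/2 of the axis, of
width of order \<surd>t in the other directions, lies in the cone over the cap.\<close>

lemma measure_cap_lower:
  "\<exists>C>0. \<forall>y\<in>sphere 0 1. \<forall>t. 0 < t \<longrightarrow> t \<le> 1 \<longrightarrow>
     measure sphere_measure (cap (y::real^'n) t) \<ge> C * sqrt t ^ (CARD('n) - 1)"
proof -
  let ?V = "measure lborel (ball 0 1 :: (real^'n) set)"
  let ?n = "real CARD('n)"
  have n: "?n \<ge> 1" using zero_less_card_finite[where 'a='n] by linarith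
  have V: "?V > 0" by (rule content_ball_pos) simp
  let ?C = "(1/4) * (2 * sqrt (1 / (8 * ?n))) ^ (CARD('n) - 1) / ?V"
  have "measure sphere_measure (cap y t) \<ge> ?C * sqrt t ^ (CARD('n) - 1)"
    if y: "y \<in> sphere 0 1" and t: "0 < t" "t \<le> 1" for y :: "real^'n" and t
  proof -
    fix k :: 'n
    \<comment> \<open>chosen such that the coordinates off the axis have a square sum of at most t / 8\<close>
    define a where "a = sqrt (t / (8 * ?n))"
    have a: "a \<ge> 0" "a\<^sup>2 = t / (8 * ?n)" using t n by (auto simp: a_def)
    let ?A = "ball 0 1 \<inter> {x. x /\<^sub>R norm x \<in> cap (axis k 1) t} :: (real^'n) set"
    let ?B = "cbox (\<chi> i. if i = k then 1/4 else - a) (\<chi> i. if i = k then 1/2 else a) :: (real^'n) set"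
    have BA: "?B \<subseteq> ?A"
    proof
      fix x :: "real^'n" assume B: "x \<in> ?B"
      have xk: "1/4 \<le> x $ k" "x $ k \<le> 1/2"
        using B[unfolded mem_box_cart, rule_format, of k] by auto
      have xi: "(x $ i)\<^sup>2 \<le> a\<^sup>2" if "i \<noteq> k" for i
        using B[unfolded mem_box_cart, rule_format, of i] that
        by (intro abs_le_square_iff[THEN iffD1]) (auto simp: abs_le_iff)
      have "(\<Sum>i\<in>UNIV - {k}. (x $ i)\<^sup>2) \<le> (\<Sum>i\<in>UNIV - {k}. a\<^sup>2)"
        using xi by (intro sum_mono) auto
      also have "\<dots> \<le> ?n * a\<^sup>2"
        by (simp add: card_Diff_singleton mult_right_mono)
      also have "\<dots> = t / 8" using a n by simp
      finally have s: "(\<Sum>i\<in>UNIV - {k}. (x $ i)\<^sup>2) \<le> t / 8" .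
      have nn: "(norm x)\<^sup>2 = (x $ k)\<^sup>2 + (\<Sum>i\<in>UNIV - {k}. (x $ i)\<^sup>2)"
        using inner_self_split_axis[of x k] by (simp add: power2_norm_eq_inner)
      have sq: "(x $ k)\<^sup>2 \<le> (1/2)\<^sup>2" using xk by (intro power_mono) auto
      have "(norm x)\<^sup>2 < 1\<^sup>2"
        using s t sq unfolding nn by (simp add: power2_eq_square)
      then have n1: "norm x < 1" by (rule power2_less_imp_less) simp
      have "(norm x)\<^sup>2 \<le> (x $ k + t / 4)\<^sup>2"
      proof -
        have "1/4 * (t / 2) \<le> x $ k * (t / 2)" using xk t by (intro mult_right_mono) auto
        moreover have "(x $ k + t / 4)\<^sup>2 = (x $ k)\<^sup>2 + x $ k * (t / 2) + (t / 4)\<^sup>2"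
          by (simp add: power2_eq_square algebra_simps)
        moreover have "0 \<le> (t / 4)\<^sup>2" by simp
        ultimately show ?thesis using s unfolding nn by linarith
      qed
      then have nx: "norm x \<le> x $ k + t / 4"
        by (rule power2_le_imp_le) (use xk t in auto)
      have n4: "norm x \<ge> 1/4" using component_le_norm_cart[of x k] xk by linarith
      have "(1 - t) * norm x \<le> x $ k"
      proof -
        have "t * (1/4) \<le> t * norm x" using n4 t by (intro mult_left_mono) auto
        then show ?thesis using nx by (simp add: algebra_simps)
      qed
      moreover have "norm x > 0" using n4 by linarith
      ultimately have "(x /\<^sub>R norm x) \<bullet> axis k 1 \<ge> 1 - t"
        by (simp add: inner_axis divide_inverse_commute[symmetric] pos_le_divide_eq)
      moreover have "x \<noteq> 0" using n4 by auto
      ultimately show "x \<in> ?A" using n1 by (simp add: cap_def)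
    qed
    then have "measure lborel ?B \<le> measure lborel ?A"
      by (intro measure_mono_fmeasurable) (auto simp: fmeasurable_cone_cap)
    moreover have "measure lborel ?B = (1/4) * (2 * a) ^ (CARD('n) - 1)"
      using a by (subst content_box_axis) auto
    moreover have "\<dots> = (1/4) * (2 * sqrt (1 / (8 * ?n))) ^ (CARD('n) - 1) * sqrt t ^ (CARD('n) - 1)"
      by (simp add: a_def real_sqrt_mult real_sqrt_divide power_mult_distrib power_divide)
    ultimately have "(1/4) * (2 * sqrt (1 / (8 * ?n))) ^ (CARD('n) - 1) * sqrt t ^ (CARD('n) - 1) \<le> measure lborel ?A"
      by linarith
    from divide_right_mono[OF this, of ?V] show ?thesis
      unfolding measure_cap_axis[OF y, of t k] unfolding measure_cap_eq
      using V by (simp only: times_divide_eq_left times_divide_eq_right)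
  qed
  moreover have "?C > 0" using V n by simp
  ultimately show ?thesis by blast
qed

text \<open>Caps have positive measure, so the surface measure has full support.\<close>

lemma integral_sphere_eq_0_imp:
  fixes f :: "real^'n \<Rightarrow> real"
  assumes f: "continuous_on (sphere 0 1) f" "\<And>x. x \<in> sphere 0 1 \<Longrightarrow> f x \<ge> 0"
    and int: "(\<integral>x. f x \<partial>sphere_measure) = 0" and y: "y \<in> sphere 0 1"
  shows "f y = 0"
proof (rule ccontr)
  assume "f y \<noteq> 0"
  then have fy: "f y > 0" using f(2)[OF y] by simp
  obtain C where C: "C > 0" "\<And>y t. y \<in> sphere 0 1 \<Longrightarrow> 0 < t \<Longrightarrow> t \<le> 1 \<Longrightarrow>
     measure sphere_measure (cap (y::real^'n) t) \<ge> C * sqrt t ^ (CARD('n) - 1)"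
    using measure_cap_lower[where 'n='n] by metis
  obtain r where r: "r > 0" "\<And>x. x \<in> sphere 0 1 \<Longrightarrow> dist x y < r \<Longrightarrow> dist (f x) (f y) < f y / 2"
    using f(1)[unfolded continuous_on_iff, rule_format, OF y, of "f y / 2"] fy by auto
  \<comment> \<open>the cap of this height lies in the ball of radius r around y, as its points have squared distance at most 2t\<close>
  define t where "t = min 1 (r\<^sup>2 / 4)"
  have t: "0 < t" "t \<le> 1" "2 * t < r\<^sup>2" using r(1) by (auto simp: t_def min_def)
  have "f y / 2 * indicator (cap y t) x \<le> f x" if x: "x \<in> sphere 0 1" for x
  proof (cases "x \<in> cap y t")
    case True
    have "x \<bullet> x = 1" "y \<bullet> y = 1" using x y by (simp_all add: norm_eq_1)
    then have "(dist x y)\<^sup>2 = 2 - 2 * (x \<bullet> y)"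
      unfolding dist_norm power2_norm_eq_inner inner_diff inner_commute[of y x] by simp
    moreover have "1 - t \<le> x \<bullet> y" using True unfolding cap_def by blast
    ultimately have "(dist x y)\<^sup>2 < r\<^sup>2" using t(3) by linarith
    then have "dist x y < r" using r(1) by (rule power2_less_imp_less[OF _ less_imp_le])
    from r(2)[OF x this] have "f y / 2 \<le> f x" unfolding dist_real_def by linarith
    then show ?thesis using True by simp
  next
    case False
    then show ?thesis using f(2)[OF x] by simp
  qed
  note le = this
  have "(\<integral>x. f y / 2 * indicator (cap y t) x \<partial>sphere_measure) \<le> (\<integral>x. f x \<partial>sphere_measure)"
  proof (rule integral_mono)
    show "integrable sphere_measure (\<lambda>x. f y / 2 * indicator (cap y t) x)"
      by (intro integrable_mult_right integrable_real_indicator cap_sets) (simp add: less_top[symmetric])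
  qed (use integrable_sphere_continuous[OF f(1)] le in simp_all)
  moreover have "cap y t \<inter> sphere 0 1 = cap y t" by (auto simp: cap_def)
  then have "(\<integral>x. f y / 2 * indicator (cap y t) x \<partial>sphere_measure) = f y / 2 * measure sphere_measure (cap y t)"
    by simp
  moreover have "measure sphere_measure (cap y t) > 0"
    using C(2)[OF y t(1,2)] C(1) t by (smt (verit) mult_pos_pos real_sqrt_gt_zero zero_less_power)
  ultimately show False using int fy
    by (metis divide_pos_pos mult_pos_pos not_less zero_less_numeral)
qed

section \<open>Partial derivatives of polynomial functions\<close>

definition partial :: "'n \<Rightarrow> (real^'n \<Rightarrow> real) \<Rightarrow> real^'n \<Rightarrow> real" where
  "partial i P x = deriv (\<lambda>t. P (x + t *\<^sub>R axis i 1)) 0"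

lemma has_derivative_imp_line_derivative:
  fixes P :: "real^'n \<Rightarrow> real"
  assumes "(P has_derivative (\<lambda>v. \<Sum>i\<in>UNIV. v $ i * g i)) (at (x + t *\<^sub>R axis i 1))"
  shows "((\<lambda>t. P (x + t *\<^sub>R axis i 1)) has_real_derivative g i) (at t)"
proof -
  have "((\<lambda>t. x + t *\<^sub>R axis i 1) has_derivative (\<lambda>h. h *\<^sub>R axis i 1)) (at t)"
    by (auto intro!: derivative_eq_intros)
  from has_derivative_compose[OF this assms]
  have "((\<lambda>t. P (x + t *\<^sub>R axis i 1)) has_derivative (\<lambda>h. \<Sum>k\<in>UNIV. (h *\<^sub>R axis i 1) $ k * g k)) (at t)" .
  moreover have "(\<lambda>h. \<Sum>k\<in>UNIV. (h *\<^sub>R axis i 1) $ k * g k) = (\<lambda>h. g i * h)"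
    by (simp add: axis_def if_distrib if_distribR mult.commute cong: if_cong)
  ultimately show ?thesis by (simp add: has_field_derivative_def)
qed

lemma real_polynomial_gradient_exists:
  fixes P :: "real^'n \<Rightarrow> real"
  assumes "real_polynomial_function P"
  shows "\<exists>g. (\<forall>i. real_polynomial_function (g i)) \<and>
    (\<forall>x. (P has_derivative (\<lambda>v. \<Sum>i\<in>UNIV. v $ i * g i x)) (at x))"
  using assms
proof induction
  case (linear f)
  have "f v = (\<Sum>i\<in>UNIV. v $ i * f (axis i 1))" for v
  proof -
    have "f v = f (\<Sum>i\<in>UNIV. v $ i *\<^sub>R axis i 1)"
      using basis_expansion[of v] by (simp add: scalar_mult_eq_scaleR)
    also have "\<dots> = (\<Sum>i\<in>UNIV. v $ i * f (axis i 1))"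
      using linear by (simp add: bounded_linear.linear linear_sum linear_cmul)
    finally show ?thesis .
  qed
  then have "f = (\<lambda>v. \<Sum>i\<in>UNIV. v $ i * f (axis i 1))" by blast
  then show ?case
    using bounded_linear_imp_has_derivative[OF linear]
    by (intro exI[of _ "\<lambda>i _. f (axis i 1)"]) auto
next
  case (const c)
  show ?case by (intro exI[of _ "\<lambda>_ _. 0"]) auto
next
  case (add f g)
  from add.IH(1) obtain f' where f': "(\<forall>i. real_polynomial_function (f' i)) \<and>
    (\<forall>x. (f has_derivative (\<lambda>v. \<Sum>i\<in>UNIV. v $ i * f' i x)) (at x))" by (rule exE)
  from add.IH(2) obtain g' where g': "(\<forall>i. real_polynomial_function (g' i)) \<and>
    (\<forall>x. (g has_derivative (\<lambda>v. \<Sum>i\<in>UNIV. v $ i * g' i x)) (at x))" by (rule exE)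
  note fg = conjunct1[OF f', rule_format] conjunct1[OF g', rule_format]
    conjunct2[OF f', rule_format] conjunct2[OF g', rule_format]
  have "((\<lambda>x. f x + g x) has_derivative (\<lambda>v. \<Sum>i\<in>UNIV. v $ i * (f' i x + g' i x))) (at x)" for x
    using has_derivative_add[OF fg(3,4)] by (simp add: algebra_simps sum.distrib)
  then show ?case using fg(1,2)
    by (intro exI[of _ "\<lambda>i x. f' i x + g' i x"]) blast
next
  case (mult f g)
  from mult.IH(1) obtain f' where f': "(\<forall>i. real_polynomial_function (f' i)) \<and>
    (\<forall>x. (f has_derivative (\<lambda>v. \<Sum>i\<in>UNIV. v $ i * f' i x)) (at x))" by (rule exE)
  from mult.IH(2) obtain g' where g': "(\<forall>i. real_polynomial_function (g' i)) \<and>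
    (\<forall>x. (g has_derivative (\<lambda>v. \<Sum>i\<in>UNIV. v $ i * g' i x)) (at x))" by (rule exE)
  note fg = conjunct1[OF f', rule_format] conjunct1[OF g', rule_format]
    conjunct2[OF f', rule_format] conjunct2[OF g', rule_format]
  have "((\<lambda>x. f x * g x) has_derivative (\<lambda>v. \<Sum>i\<in>UNIV. v $ i * (f x * g' i x + f' i x * g x))) (at x)" for x
    using has_derivative_mult[OF fg(3,4)]
    by (simp add: algebra_simps sum.distrib sum_distrib_left sum_distrib_right)
  moreover have "real_polynomial_function (\<lambda>x. f x * g' i x + f' i x * g x)" for i
    using fg(1,2) mult.hyps by (intro real_polynomial_function.intros(3,4))
  ultimately show ?case
    by (intro exI[of _ "\<lambda>i x. f x * g' i x + f' i x * g x"]) simp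
qed

lemma real_polynomial_partial:
  fixes P :: "real^'n \<Rightarrow> real"
  assumes "real_polynomial_function P"
  shows real_polynomial_function_partial: "real_polynomial_function (partial i P)"
    and has_derivative_partial: "(P has_derivative (\<lambda>v. \<Sum>i\<in>UNIV. v $ i * partial i P x)) (at x)"
proof -
  from real_polynomial_gradient_exists[OF assms] obtain g where g': "(\<forall>i. real_polynomial_function (g i)) \<and>
    (\<forall>x. (P has_derivative (\<lambda>v. \<Sum>i\<in>UNIV. v $ i * g i x)) (at x))" by (rule exE)
  note g = conjunct1[OF g', rule_format] conjunct2[OF g', rule_format]
  have "partial i P x = g i x" for i x
    unfolding partial_def
    by (rule DERIV_imp_deriv, rule has_derivative_imp_line_derivative) (use g(2)[of x] in simp)
  then have "partial i P = g i" for i by blast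
  then show "real_polynomial_function (partial i P)"
    and "(P has_derivative (\<lambda>v. \<Sum>i\<in>UNIV. v $ i * partial i P x)) (at x)"
    using g by simp_all
qed

lemma line_derivative_partial:
  assumes "real_polynomial_function P"
  shows "((\<lambda>t. P (x + t *\<^sub>R axis i 1)) has_real_derivative partial i P (x + t *\<^sub>R axis i 1)) (at t)"
  by (rule has_derivative_imp_line_derivative) (rule has_derivative_partial[OF assms])

lemma partialI:
  assumes "((\<lambda>t. P (x + t *\<^sub>R axis i 1)) has_real_derivative D) (at 0)"
  shows "partial i P x = D"
  unfolding partial_def by (rule DERIV_imp_deriv[OF assms])

lemma real_polynomial_coordinate: "real_polynomial_function (\<lambda>x::real^'n. x $ i)"
  by (intro real_polynomial_function.intros(1) bounded_linear_vec_nth)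

lemma partial_mult_coordinate:
  assumes P: "real_polynomial_function P"
  shows "partial k (\<lambda>x. x $ i * P x) x = (if k = i then P x else 0) + x $ i * partial k P x"
proof (rule partialI)
  have c: "((\<lambda>t. (x + t *\<^sub>R axis k 1) $ i) has_real_derivative (if k = i then 1 else 0)) (at 0)"
    by (auto intro!: derivative_eq_intros simp: axis_def)
  show "((\<lambda>t. (x + t *\<^sub>R axis k 1) $ i * P (x + t *\<^sub>R axis k 1)) has_real_derivative
      (if k = i then P x else 0) + x $ i * partial k P x) (at 0)"
    using DERIV_mult[OF c line_derivative_partial[OF P]] by (auto simp: algebra_simps)
qed

lemma partial_diff:
  assumes "real_polynomial_function P" "real_polynomial_function Q"
  shows "partial k (\<lambda>x. P x - Q x) x = partial k P x - partial k Q x"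
  by (rule partialI)
     (use DERIV_diff[OF line_derivative_partial[OF assms(1)] line_derivative_partial[OF assms(2)], where x = 0] in simp)

lemma continuous_on_real_polynomial: "real_polynomial_function P \<Longrightarrow> continuous_on S P"
  by (simp add: continuous_on_polymonial_function real_polynomial_function_eq)

section \<open>Rotations\<close>

text \<open>The rotation by the angle \<theta> in the plane of the coordinates i and j. Written as a perturbation
of the identity, it makes sense as a formula for i = j too, but is a rotation only for i \<noteq> j.\<close>

definition rot :: "'n \<Rightarrow> 'n \<Rightarrow> real \<Rightarrow> real^'n \<Rightarrow> real^'n" where
  "rot i j \<theta> x = x + ((cos \<theta> - 1) * x $ i - sin \<theta> * x $ j) *\<^sub>R axis i 1
                   + (sin \<theta> * x $ i + (cos \<theta> - 1) * x $ j) *\<^sub>R axis j 1"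

lemma rot_0 [simp]: "rot i j 0 x = x" by (simp add: rot_def)

lemma orthogonal_rot:
  assumes "i \<noteq> j" shows "orthogonal_transformation (rot i j \<theta>)"
  unfolding orthogonal_transformation_def
proof
  show "linear (rot i j \<theta>)"
    by (rule linearI) (simp_all add: rot_def vec_eq_iff algebra_simps)
  show "\<forall>v w. rot i j \<theta> v \<bullet> rot i j \<theta> w = v \<bullet> w"
  proof (intro allI)
    fix v w :: "real^'a"
    have cc: "cos \<theta> * cos \<theta> = 1 - sin \<theta> * sin \<theta>"
      using sin_cos_squared_add[of \<theta>] by (simp add: power2_eq_square)
    have cc': "cos \<theta> * (cos \<theta> * y) = y - sin \<theta> * (sin \<theta> * y)" for y
      unfolding mult.assoc[symmetric] cc by (simp add: algebra_simps)
    have ax: "axis i (1::real) \<bullet> u = u $ i" "u \<bullet> axis i (1::real) = u $ i" for i u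
      by (simp_all add: inner_axis inner_commute[of "axis _ _"])
    have nth: "axis i (1::real) $ i = 1" "axis j (1::real) $ j = 1" "axis i (1::real) $ j = 0" "axis j (1::real) $ i = 0"
      using assms by (simp_all add: axis_def)
    show "rot i j \<theta> v \<bullet> rot i j \<theta> w = v \<bullet> w"
      unfolding rot_def inner_add_left inner_add_right inner_scaleR_left inner_scaleR_right ax nth
      by (simp add: algebra_simps cc cc' nth)
  qed
qed

lemma rot_inverse:
  assumes "i \<noteq> j" shows "rot j i \<theta> (rot i j \<theta> x) = x"
proof -
  have cc: "cos \<theta> * cos \<theta> = 1 - sin \<theta> * sin \<theta>"
    using sin_cos_squared_add[of \<theta>] by (simp add: power2_eq_square)
  have cc': "cos \<theta> * (cos \<theta> * y) = y - sin \<theta> * (sin \<theta> * y)" for y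
    unfolding mult.assoc[symmetric] cc by (simp add: algebra_simps)
  show ?thesis
  proof (rule vec_eq_iff[THEN iffD2], intro allI)
    fix k show "rot j i \<theta> (rot i j \<theta> x) $ k = x $ k"
      using assms by (auto simp: rot_def axis_def algebra_simps cc cc')
  qed
qed

text \<open>The vector field x_i \<partial>_j - x_j \<partial>_i that generates these rotations. It maps polynomials to
polynomials, so derivatives of any order along a rotation are bounded on the sphere.\<close>

definition rotD :: "'n \<Rightarrow> 'n \<Rightarrow> (real^'n \<Rightarrow> real) \<Rightarrow> real^'n \<Rightarrow> real" where
  "rotD i j P x = x $ i * partial j P x - x $ j * partial i P x"

lemma real_polynomial_rotD:
  "real_polynomial_function P \<Longrightarrow> real_polynomial_function (rotD i j P)"
  unfolding rotD_def
  by (intro real_polynomial_function_diff real_polynomial_function.intros(4) real_polynomial_coordinate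
      real_polynomial_function_partial)

lemma rotation_derivative:
  fixes P :: "real^'n \<Rightarrow> real"
  assumes P: "real_polynomial_function P" and ij: "i \<noteq> j"
  shows "((\<lambda>\<theta>. P (rot i j \<theta> x)) has_real_derivative rotD i j P (rot i j \<theta> x)) (at \<theta>)"
proof -
  let ?y = "rot i j \<theta> x"
  have y: "?y $ i = cos \<theta> * x $ i - sin \<theta> * x $ j" "?y $ j = sin \<theta> * x $ i + cos \<theta> * x $ j"
    using ij by (auto simp: rot_def axis_def algebra_simps)
  have "((\<lambda>\<theta>. rot i j \<theta> x) has_derivative (\<lambda>h. h *\<^sub>R (?y $ i *\<^sub>R axis j 1 - ?y $ j *\<^sub>R axis i 1))) (at \<theta>)"
    unfolding y unfolding rot_def
    by (auto intro!: derivative_eq_intros simp: algebra_simps)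
  from has_derivative_compose[OF this has_derivative_partial[OF P]]
  have "((\<lambda>\<theta>. P (rot i j \<theta> x)) has_derivative
     (\<lambda>h. \<Sum>k\<in>UNIV. (h *\<^sub>R (?y $ i *\<^sub>R axis j 1 - ?y $ j *\<^sub>R axis i 1)) $ k * partial k P ?y)) (at \<theta>)" .
  moreover have "(\<lambda>h. \<Sum>k\<in>UNIV. (h *\<^sub>R (?y $ i *\<^sub>R axis j 1 - ?y $ j *\<^sub>R axis i 1)) $ k * partial k P ?y)
     = (\<lambda>h. rotD i j P ?y * h)"
  proof
    fix h
    have "(\<Sum>k\<in>UNIV. (h *\<^sub>R (?y $ i *\<^sub>R axis j 1 - ?y $ j *\<^sub>R axis i 1)) $ k * partial k P ?y)
       = (\<Sum>k\<in>UNIV. (if k = j then h * ?y $ i * partial k P ?y else 0)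
            - (if k = i then h * ?y $ j * partial k P ?y else 0))"
      by (intro sum.cong) (auto simp: axis_def algebra_simps)
    also have "\<dots> = rotD i j P ?y * h"
      by (simp add: sum_subtractf rotD_def algebra_simps)
    finally show "(\<Sum>k\<in>UNIV. (h *\<^sub>R (?y $ i *\<^sub>R axis j 1 - ?y $ j *\<^sub>R axis i 1)) $ k * partial k P ?y)
      = rotD i j P ?y * h" .
  qed
  ultimately show ?thesis by (simp add: has_field_derivative_def)
qed

text \<open>Third order Taylor expansion in the angle; the remainder is a value of the third iterate of the
generator at a point of the sphere, hence bounded uniformly in x.\<close>

lemma rotation_taylor:
  fixes P :: "real^'n \<Rightarrow> real"
  assumes P: "real_polynomial_function P" and ij: "i \<noteq> j"
  shows "\<exists>B>0. \<forall>x\<in>sphere 0 1. \<forall>h>0.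
    \<bar>P (rot i j h x) - P x - h * rotD i j P x - h\<^sup>2 / 2 * rotD i j (rotD i j P) x\<bar> \<le> B * h ^ 3"
proof -
  let ?D = "rotD i j"
  have p: "real_polynomial_function (?D P)" "real_polynomial_function (?D (?D P))"
    "real_polynomial_function (?D (?D (?D P)))"
    using P by (auto intro: real_polynomial_rotD)
  obtain B where B: "B > 0" "\<And>x. x \<in> sphere 0 1 \<Longrightarrow> \<bar>?D (?D (?D P)) x\<bar> \<le> B"
    using continuous_on_sphere_bounded[OF continuous_on_real_polynomial[OF p(3)]] by blast
  have "\<bar>P (rot i j h x) - P x - h * ?D P x - h\<^sup>2 / 2 * ?D (?D P) x\<bar> \<le> B * h ^ 3"
    if x: "x \<in> sphere 0 1" and h: "h > 0" for x h
  proof -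
    let ?F = "\<lambda>m \<theta>. (?D ^^ m) P (rot i j \<theta> x)"
    have D: "real_polynomial_function ((?D ^^ m) P)" for m
      by (induction m) (auto intro: P real_polynomial_rotD)
    have "\<forall>m t. m < 3 \<and> 0 \<le> t \<and> t \<le> h \<longrightarrow> DERIV (?F m) t :> ?F (Suc m) t"
      using rotation_derivative[OF D ij] by simp
    then obtain t where t: "0 < t" "t < h"
      "P (rot i j h x) = (\<Sum>m<3. ?F m 0 / fact m * h ^ m) + ?F 3 t / fact 3 * h ^ 3"
      using Maclaurin[of h 3 ?F "\<lambda>\<theta>. P (rot i j \<theta> x)", OF h] by fastforce
    have s3: "(\<Sum>m<3. a m) = a 0 + a 1 + a 2" for a :: "nat \<Rightarrow> real"
      by (simp add: eval_nat_numeral)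
    have D3: "(?D ^^ 3) P = ?D (?D (?D P))" "(?D ^^ 2) P = ?D (?D P)" "(?D ^^ 1) P = ?D P" "(?D ^^ 0) P = P"
      by (simp_all add: eval_nat_numeral)
    have e: "P (rot i j h x) - P x - h * ?D P x - h\<^sup>2 / 2 * ?D (?D P) x
        = ?D (?D (?D P)) (rot i j t x) / 6 * h ^ 3"
      unfolding t(3) s3 D3 rot_0 by (simp add: fact_numeral)
    have "rot i j t x \<in> sphere 0 1"
      using x orthogonal_transformation_norm[OF orthogonal_rot[OF ij]] by simp
    then have "\<bar>?D (?D (?D P)) (rot i j t x) / 6\<bar> \<le> B"
      using B(2)[of "rot i j t x"] B(1) by simp
    then show ?thesis
      unfolding e abs_mult power_abs[symmetric] using h by (intro mult_mono) auto
  qed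
  then show ?thesis using B(1) by (intro exI[of _ B] conjI ballI allI impI)
qed

section \<open>The spherical Laplacian\<close>

definition offdiag :: "('n \<times> 'n) set" where "offdiag = {(i, j). i \<noteq> j}"

lemma finite_offdiag [simp]: "finite (offdiag :: ('n::finite \<times> 'n) set)"
  by (rule finite_subset[of _ UNIV]) auto

lemma sum_offdiag_swap:
  fixes F :: "'n::finite \<Rightarrow> 'n \<Rightarrow> 'b::comm_monoid_add"
  shows "(\<Sum>(i, j)\<in>offdiag. F j i) = (\<Sum>(i, j)\<in>offdiag. F i j)"
  by (rule sum.reindex_bij_witness[of _ prod.swap prod.swap]) (auto simp: offdiag_def)

lemma sum_offdiag:
  fixes F :: "'n::finite \<Rightarrow> 'n \<Rightarrow> real"
  shows "(\<Sum>(i, j)\<in>offdiag. F i j) = (\<Sum>i\<in>UNIV. \<Sum>j\<in>UNIV. F i j) - (\<Sum>i\<in>UNIV. F i i)"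
proof -
  have U: "(UNIV :: ('n \<times> 'n) set) = offdiag \<union> (\<lambda>i. (i, i)) ` UNIV"
    by (auto simp: offdiag_def)
  have "(\<Sum>i\<in>UNIV. \<Sum>j\<in>UNIV. F i j) = (\<Sum>(i, j)\<in>UNIV. F i j)"
    by (simp add: sum.cartesian_product)
  also have "\<dots> = (\<Sum>(i, j)\<in>offdiag. F i j) + (\<Sum>(i, j)\<in>(\<lambda>i. (i, i)) ` UNIV. F i j)"
    unfolding U by (rule sum.union_disjoint) (auto simp: offdiag_def)
  also have "(\<Sum>(i, j)\<in>(\<lambda>i. (i, i)) ` UNIV. F i j) = (\<Sum>i\<in>UNIV. F i i)"
    by (subst sum.reindex) (auto simp: inj_on_def)
  finally show ?thesis by simp
qed

text \<open>Ordered pairs of coordinates are used, so that each rotation occurs together with its inverse and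
the first order terms cancel.\<close>

definition rot_quotient :: "real \<Rightarrow> (real^'n \<Rightarrow> real) \<Rightarrow> real^'n \<Rightarrow> real" where
  "rot_quotient h f x = (\<Sum>(i, j)\<in>offdiag. f (rot i j h x) - f x) / h\<^sup>2"

text \<open>The Laplace-Beltrami operator is the sum of the squares of the rotation fields over all coordinate
planes, which makes it the uniform limit of the second order difference quotients above. Taking
this limit as the definition has three advantages: it is linear, it only sees values on the sphere,
and both symmetry and dissipativity hold already before the limit.\<close>

definition has_sphere_laplacian :: "(real^'n \<Rightarrow> real) \<Rightarrow> (real^'n \<Rightarrow> real) \<Rightarrow> bool" where
  "has_sphere_laplacian f g \<longleftrightarrow> uniform_limit (sphere 0 1) (\<lambda>h. rot_quotient h f) g (at_right 0)"

lemma has_sphere_laplacian_add: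
  assumes "has_sphere_laplacian f f'" "has_sphere_laplacian g g'"
  shows "has_sphere_laplacian (\<lambda>x. f x + g x) (\<lambda>x. f' x + g' x)"
proof -
  have "rot_quotient h (\<lambda>x. f x + g x) = (\<lambda>x. rot_quotient h f x + rot_quotient h g x)" for h
    by (auto simp: rot_quotient_def add_divide_distrib[symmetric] sum.distrib[symmetric] intro!: ext sum.cong)
  then show ?thesis
    using uniform_limit_add[OF assms[unfolded has_sphere_laplacian_def]] by (simp add: has_sphere_laplacian_def)
qed

lemma has_sphere_laplacian_cmult:
  assumes "has_sphere_laplacian f f'"
  shows "has_sphere_laplacian (\<lambda>x. c * f x) (\<lambda>x. c * f' x)"
proof -
  have "rot_quotient h (\<lambda>x. c * f x) = (\<lambda>x. c * rot_quotient h f x)" for h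
    by (auto simp: rot_quotient_def sum_distrib_left right_diff_distrib intro!: ext sum.cong)
  then show ?thesis
    using bounded_linear.uniform_limit[OF bounded_linear_mult_right[of c] assms[unfolded has_sphere_laplacian_def]]
    by (simp add: has_sphere_laplacian_def)
qed

lemma has_sphere_laplacian_zero: "has_sphere_laplacian (\<lambda>x. 0) (\<lambda>x. 0)"
proof -
  have "rot_quotient h (\<lambda>x::real^'a. 0) = (\<lambda>x. 0)" for h
    by (simp add: rot_quotient_def fun_eq_iff)
  then show ?thesis by (simp add: has_sphere_laplacian_def uniform_limit_const)
qed

lemma has_sphere_laplacian_sum:
  assumes "\<And>i. i \<in> A \<Longrightarrow> has_sphere_laplacian (f i) (f' i)"
  shows "has_sphere_laplacian (\<lambda>x. \<Sum>i\<in>A. f i x) (\<lambda>x. \<Sum>i\<in>A. f' i x)"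
  using assms
  by (induction A rule: infinite_finite_induct)
     (auto intro: has_sphere_laplacian_zero has_sphere_laplacian_add)

lemma has_sphere_laplacian_cong:
  assumes "has_sphere_laplacian f f'" "\<And>x. x \<in> sphere 0 1 \<Longrightarrow> f x = g x"
    "\<And>x. x \<in> sphere 0 1 \<Longrightarrow> f' x = g' x"
  shows "has_sphere_laplacian g g'"
proof -
  have "rot_quotient h f x = rot_quotient h g x" if "x \<in> sphere 0 1" for h x
  proof -
    have "rot i j h x \<in> sphere 0 1" if "i \<noteq> j" for i j
      using orthogonal_transformation_norm[OF orthogonal_rot[OF that], of h x] \<open>x \<in> sphere 0 1\<close> by simp
    then show ?thesis
      unfolding rot_quotient_def using assms(2) that
      by (intro arg_cong2[where f="(/)"] sum.cong) (auto simp: offdiag_def)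
  qed
  then show ?thesis
    using assms(1,3) unfolding has_sphere_laplacian_def
    by (subst uniform_limit_cong'[where g = "\<lambda>h. rot_quotient h f" and i = f']) auto
qed

lemma has_sphere_laplacian_rotD:
  fixes P :: "real^'n \<Rightarrow> real"
  assumes P: "real_polynomial_function P"
  shows "has_sphere_laplacian P (\<lambda>x. (\<Sum>(i, j)\<in>offdiag. rotD i j (rotD i j P) x) / 2)"
proof -
  have "\<exists>B. \<forall>i j. i \<noteq> j \<longrightarrow> B i j > 0 \<and> (\<forall>x\<in>sphere 0 1. \<forall>h>0.
    \<bar>P (rot i j h x) - P x - h * rotD i j P x - h\<^sup>2 / 2 * rotD i j (rotD i j P) x\<bar> \<le> B i j * h ^ 3)"
    using rotation_taylor[OF P] by metis
  then obtain B where B: "\<And>i j. i \<noteq> j \<Longrightarrow> B i j > 0"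
    "\<And>i j x h. i \<noteq> j \<Longrightarrow> x \<in> sphere 0 1 \<Longrightarrow> h > 0 \<Longrightarrow>
    \<bar>P (rot i j h x) - P x - h * rotD i j P x - h\<^sup>2 / 2 * rotD i j (rotD i j P) x\<bar> \<le> B i j * h ^ 3"
    by blast
  define C where "C = (\<Sum>(i, j)\<in>offdiag. B i j)"
  have C: "C \<ge> 0" unfolding C_def by (rule sum_nonneg) (auto simp: offdiag_def intro: less_imp_le B(1))
  let ?g = "\<lambda>x. (\<Sum>(i, j)\<in>offdiag. rotD i j (rotD i j P) x) / 2"
  have zero: "(\<Sum>(i, j)\<in>offdiag. rotD i j P x) = 0" for x
  proof -
    have "(\<Sum>(i, j)\<in>offdiag. rotD i j P x) = (\<Sum>(i, j)\<in>offdiag. rotD j i P x)"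
      by (rule sum_offdiag_swap[symmetric])
    also have "\<dots> = - (\<Sum>(i, j)\<in>offdiag. rotD i j P x)"
      by (subst sum_negf[symmetric]) (auto simp: rotD_def intro!: sum.cong)
    finally show ?thesis by simp
  qed
  have bound: "\<bar>rot_quotient h P x - ?g x\<bar> \<le> C * h" if x: "x \<in> sphere 0 1" and h: "h > 0" for x h
  proof -
    have "(\<Sum>(i, j)\<in>offdiag. P (rot i j h x) - P x) - h\<^sup>2 * ?g x
      = (\<Sum>(i, j)\<in>offdiag. P (rot i j h x) - P x) - h * (\<Sum>(i, j)\<in>offdiag. rotD i j P x) - h\<^sup>2 * ?g x"
      by (simp add: zero)
    also have "\<dots> = (\<Sum>(i, j)\<in>offdiag. P (rot i j h x) - P x - h * rotD i j P x - h\<^sup>2 / 2 * rotD i j (rotD i j P) x)"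
      by (simp add: split_def sum_subtractf sum_distrib_left sum_divide_distrib)
    also have "\<bar>\<dots>\<bar> \<le> (\<Sum>(i, j)\<in>offdiag. B i j * h ^ 3)"
      by (rule order_trans[OF sum_abs], rule sum_mono) (use B(2) x h in \<open>auto simp: offdiag_def\<close>)
    also have "\<dots> = C * h ^ 3"
      by (simp add: C_def sum_distrib_right split_def)
    finally have 1: "\<bar>(\<Sum>(i, j)\<in>offdiag. P (rot i j h x) - P x) - h\<^sup>2 * ?g x\<bar> \<le> C * h ^ 3" .
    have "rot_quotient h P x - ?g x = ((\<Sum>(i, j)\<in>offdiag. P (rot i j h x) - P x) - h\<^sup>2 * ?g x) / h\<^sup>2"
      using h by (simp add: rot_quotient_def diff_divide_distrib)
    then have "\<bar>rot_quotient h P x - ?g x\<bar> = \<bar>(\<Sum>(i, j)\<in>offdiag. P (rot i j h x) - P x) - h\<^sup>2 * ?g x\<bar> / h\<^sup>2"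
      by (simp add: abs_divide)
    also have "\<dots> \<le> C * h ^ 3 / h\<^sup>2" using 1 by (rule divide_right_mono) simp
    also have "\<dots> = C * h" using h by (simp add: power3_eq_cube power2_eq_square)
    finally show ?thesis .
  qed
  show ?thesis
    unfolding has_sphere_laplacian_def
  proof (rule uniform_limitI)
    fix e :: real assume e: "e > 0"
    have "eventually (\<lambda>h. 0 < h \<and> h < e / (C + 1)) (at_right 0)"
      using e C by (auto simp: eventually_at_right[of 0 "e / (C + 1)"] intro!: exI[of _ "e / (C + 1)"] eventually_conj)
    then show "\<forall>\<^sub>F h in at_right 0. \<forall>x\<in>sphere 0 1. dist (rot_quotient h P x) (?g x) < e"
    proof eventually_elim
      case (elim h)
      then have "C * h < e" using C e by (simp add: pos_less_divide_eq algebra_simps)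
      then show ?case using bound elim unfolding dist_real_def by fastforce
    qed
  qed
qed

text \<open>The radial form of the sum of squares: |x|^2 times the Euclidean Laplacian, minus n - 1 times
the Euler operator, minus the Hessian evaluated at (x, x). On harmonic homogeneous polynomials the
first term vanishes and the Euler identity evaluates the other two.\<close>

lemma sum_rotD_rotD:
  fixes P :: "real^'n \<Rightarrow> real"
  assumes P: "real_polynomial_function P"
  shows "(\<Sum>(i, j)\<in>offdiag. rotD i j (rotD i j P) x) / 2 =
    (x \<bullet> x) * (\<Sum>i\<in>UNIV. partial i (partial i P) x) - (real CARD('n) - 1) * (\<Sum>i\<in>UNIV. x $ i * partial i P x)
    - (\<Sum>i\<in>UNIV. \<Sum>j\<in>UNIV. x $ i * x $ j * partial j (partial i P) x)"
proof -
  note p = real_polynomial_function_partial[OF P]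
  let ?F = "\<lambda>i j. (x $ i)\<^sup>2 * partial j (partial j P) x - x $ i * partial i P x
      - x $ i * x $ j * partial j (partial i P) x - x $ j * partial j P x - x $ j * x $ i * partial i (partial j P) x
      + (x $ j)\<^sup>2 * partial i (partial i P) x"
  have pr: "partial k (rotD i j P) x = (if k = i then partial j P x else 0) + x $ i * partial k (partial j P) x
     - ((if k = j then partial i P x else 0) + x $ j * partial k (partial i P) x)" for i j k
    unfolding rotD_def
    by (subst partial_diff)
       (auto intro!: real_polynomial_function.intros(4) real_polynomial_coordinate p simp: partial_mult_coordinate[OF p])
  have "(\<Sum>(i, j)\<in>offdiag. rotD i j (rotD i j P) x) = (\<Sum>(i, j)\<in>offdiag. ?F i j)"
    by (intro sum.cong refl)
       (auto simp: offdiag_def rotD_def[of _ _ "rotD _ _ P"] pr algebra_simps power2_eq_square)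
  also have "\<dots> = (\<Sum>i\<in>UNIV. \<Sum>j\<in>UNIV. ?F i j) - (\<Sum>i\<in>UNIV. ?F i i)"
    by (rule sum_offdiag)
  also have "(\<Sum>i\<in>UNIV. ?F i i) = - 2 * (\<Sum>i\<in>UNIV. x $ i * partial i P x)"
    unfolding sum_distrib_left by (intro sum.cong refl) (simp add: power2_eq_square algebra_simps)
  also have "(\<Sum>i\<in>UNIV. \<Sum>j\<in>UNIV. ?F i j) =
      2 * ((x \<bullet> x) * (\<Sum>i\<in>UNIV. partial i (partial i P) x))
      - 2 * real CARD('n) * (\<Sum>i\<in>UNIV. x $ i * partial i P x)
      - 2 * (\<Sum>i\<in>UNIV. \<Sum>j\<in>UNIV. x $ i * x $ j * partial j (partial i P) x)"
  proof -
    let ?L = "\<Sum>i\<in>UNIV. partial i (partial i P) x"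
    have 1: "(\<Sum>i\<in>UNIV. \<Sum>j\<in>UNIV. (x $ i)\<^sup>2 * partial j (partial j P) x) = (x \<bullet> x) * ?L"
      by (simp add: sum_distrib_left[symmetric] sum_distrib_right[symmetric] inner_vec_def power2_eq_square)
    have 2: "(\<Sum>i\<in>UNIV. \<Sum>j\<in>UNIV. (x $ j)\<^sup>2 * partial i (partial i P) x) = (x \<bullet> x) * ?L"
      by (subst sum.swap) (rule 1)
    have 3: "(\<Sum>i\<in>UNIV. \<Sum>j\<in>(UNIV :: 'n set). x $ i * partial i P x) = real CARD('n) * (\<Sum>i\<in>UNIV. x $ i * partial i P x)"
      by (simp add: sum_distrib_left)
    have 4: "(\<Sum>i\<in>(UNIV :: 'n set). \<Sum>j\<in>UNIV. x $ j * partial j P x) = real CARD('n) * (\<Sum>i\<in>UNIV. x $ i * partial i P x)"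
      by simp
    have 5: "(\<Sum>i\<in>UNIV. \<Sum>j\<in>UNIV. x $ j * x $ i * partial i (partial j P) x) =
        (\<Sum>i\<in>UNIV. \<Sum>j\<in>UNIV. x $ i * x $ j * partial j (partial i P) x)"
      by (rule sum.swap)
    show ?thesis
      unfolding sum.distrib sum_subtractf 1 2 3 4 5 by simp
  qed
  finally show ?thesis by (simp add: algebra_simps add_divide_distrib diff_divide_distrib)
qed

lemma integral_rot_quotient_symmetric:
  fixes f g :: "real^'n \<Rightarrow> real"
  assumes f: "continuous_on (sphere 0 1) f" and g: "continuous_on (sphere 0 1) g"
  shows "(\<integral>x. rot_quotient h f x * g x \<partial>sphere_measure) = (\<integral>x. f x * rot_quotient h g x \<partial>sphere_measure)"
proof -
  have cr: "continuous_on (sphere 0 1) (\<lambda>x. u (rot i j h x))" if u: "continuous_on (sphere 0 1) u" and "i \<noteq> j"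
    for u :: "real^'n \<Rightarrow> real" and i j
  proof (rule continuous_on_compose2[OF u])
    show "continuous_on (sphere 0 1) (rot i j h)"
      using orthogonal_transformation_linear[OF orthogonal_rot[OF \<open>i \<noteq> j\<close>]] by (intro linear_continuous_on)
         (simp add: linear_conv_bounded_linear)
    show "rot i j h ` sphere 0 1 \<subseteq> sphere 0 1"
      using orthogonal_transformation_norm[OF orthogonal_rot[OF \<open>i \<noteq> j\<close>]] by auto
  qed
  have swap: "(\<integral>x. f (rot i j h x) * g x \<partial>sphere_measure) = (\<integral>x. f x * g (rot j i h x) \<partial>sphere_measure)"
    if "i \<noteq> j" for i j
  proof -
    have m: "(\<lambda>x. f x * g (rot j i h x)) \<in> borel_measurable sphere_measure"
      using that by (intro borel_measurable_sphere_continuous continuous_intros f cr g) auto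
    show ?thesis
      using integral_sphere_orthogonal[OF orthogonal_rot[OF that, of h] m] by (simp add: rot_inverse[OF that])
  qed
  have int: "integrable sphere_measure (\<lambda>x. (f (rot i j h x) - f x) * g x)"
    "integrable sphere_measure (\<lambda>x. f x * (g (rot i j h x) - g x))" if "i \<noteq> j" for i j
    using that by (auto intro!: integrable_sphere_continuous continuous_intros f g cr)
  have int': "integrable sphere_measure (\<lambda>x. f (rot i j h x) * g x)"
     "integrable sphere_measure (\<lambda>x. f x * g x)"
     "integrable sphere_measure (\<lambda>x. f x * g (rot i j h x))" if "i \<noteq> j" for i j
    using that by (auto intro!: integrable_sphere_continuous continuous_intros f g cr)
  have "(\<integral>x. rot_quotient h f x * g x \<partial>sphere_measure)
    = (\<integral>x. (\<Sum>(i, j)\<in>offdiag. (f (rot i j h x) - f x) * g x) \<partial>sphere_measure) / h\<^sup>2"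
    unfolding rot_quotient_def by (simp add: sum_distrib_right split_def)
  also have "(\<integral>x. (\<Sum>(i, j)\<in>offdiag. (f (rot i j h x) - f x) * g x) \<partial>sphere_measure)
    = (\<Sum>(i, j)\<in>offdiag. \<integral>x. (f (rot i j h x) - f x) * g x \<partial>sphere_measure)"
    unfolding split_def by (rule Bochner_Integration.integral_sum) (use int in \<open>auto simp: offdiag_def\<close>)
  also have "\<dots> = (\<Sum>(i, j)\<in>offdiag. \<integral>x. f x * (g (rot j i h x) - g x) \<partial>sphere_measure)"
    by (intro sum.cong refl)
       (use int' swap in \<open>auto simp: offdiag_def left_diff_distrib right_diff_distrib\<close>)
  also have "\<dots> = (\<Sum>(i, j)\<in>offdiag. \<integral>x. f x * (g (rot i j h x) - g x) \<partial>sphere_measure)"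
    by (rule sum_offdiag_swap)
  also have "\<dots> = (\<integral>x. (\<Sum>(i, j)\<in>offdiag. f x * (g (rot i j h x) - g x)) \<partial>sphere_measure)"
    unfolding split_def by (rule Bochner_Integration.integral_sum[symmetric]) (use int in \<open>auto simp: offdiag_def\<close>)
  also have "\<dots> / h\<^sup>2 = (\<integral>x. f x * rot_quotient h g x \<partial>sphere_measure)"
    unfolding rot_quotient_def by (simp add: sum_distrib_left split_def)
  finally show ?thesis .
qed

lemma tendsto_integral_sphere:
  fixes F :: "real \<Rightarrow> real^'n \<Rightarrow> real"
  assumes F: "\<And>h. continuous_on (sphere 0 1) (F h)" and g: "continuous_on (sphere 0 1) g"
    and k: "continuous_on (sphere 0 1) k"
    and lim: "uniform_limit (sphere 0 1) F g L"
  shows "((\<lambda>h. \<integral>x. F h x * k x \<partial>sphere_measure) \<longlongrightarrow> (\<integral>x. g x * k x \<partial>sphere_measure)) L"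
proof (rule tendstoI)
  fix e :: real assume e: "e > 0"
  obtain B where B: "B > 0" "\<And>x. x \<in> sphere 0 1 \<Longrightarrow> \<bar>k x\<bar> \<le> B"
    using continuous_on_sphere_bounded[OF k] by blast
  from uniform_limitD[OF lim, of "e / (2 * B)"] e B
  have "\<forall>\<^sub>F h in L. \<forall>x\<in>sphere 0 1. dist (F h x) (g x) < e / (2 * B)" by simp
  then show "\<forall>\<^sub>F h in L. dist (\<integral>x. F h x * k x \<partial>sphere_measure) (\<integral>x. g x * k x \<partial>sphere_measure) < e"
  proof eventually_elim
    case (elim h)
    have i: "integrable sphere_measure (\<lambda>x. F h x * k x)" "integrable sphere_measure (\<lambda>x. g x * k x)"
      by (intro integrable_sphere_continuous continuous_intros F g k)+
    have "\<bar>\<integral>x. F h x * k x - g x * k x \<partial>sphere_measure\<bar> \<le> e / 2"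
    proof (rule integral_sphere_abs_le)
      fix x :: "real^'n" assume x: "x \<in> sphere 0 1"
      have "\<bar>F h x * k x - g x * k x\<bar> = \<bar>F h x - g x\<bar> * \<bar>k x\<bar>"
        by (simp add: left_diff_distrib[symmetric] abs_mult)
      also have "\<dots> \<le> e / (2 * B) * B"
        using elim x B by (intro mult_mono) (auto simp: dist_real_def intro!: less_imp_le)
      finally show "\<bar>F h x * k x - g x * k x\<bar> \<le> e / 2" using B(1) by simp
    qed (use i in auto)
    then show ?case using i e by (simp add: dist_real_def)
  qed
qed

lemma continuous_on_rot:
  fixes f :: "real^'n \<Rightarrow> real" and T :: "real^'n \<Rightarrow> real^'n"
  assumes f: "continuous_on (sphere 0 1) f" and T: "orthogonal_transformation T"
  shows "continuous_on (sphere 0 1) (\<lambda>x. f (T x))"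
proof (rule continuous_on_compose2[OF f])
  show "continuous_on (sphere 0 1) T"
    by (rule linear_continuous_on[OF linear_conv_bounded_linear[THEN iffD1, OF orthogonal_transformation_linear[OF T]]])
  show "T ` sphere 0 1 \<subseteq> sphere 0 1"
    using orthogonal_transformation_norm[OF T] by auto
qed

lemma continuous_on_rot_quotient:
  fixes f :: "real^'n \<Rightarrow> real"
  assumes f: "continuous_on (sphere 0 1) f"
  shows "continuous_on (sphere 0 1) (rot_quotient h f)"
proof (cases "h = 0")
  case True then show ?thesis by (simp add: rot_quotient_def[abs_def])
next
  case False
  have cr: "continuous_on (sphere 0 1) (\<lambda>x. f (rot (fst p) (snd p) h x))" if "p \<in> offdiag" for p
    by (rule continuous_on_rot[OF f orthogonal_rot]) (use that in \<open>auto simp: offdiag_def\<close>)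
  show ?thesis unfolding rot_quotient_def[abs_def] split_def
    by (intro continuous_on_divide continuous_on_sum continuous_on_diff continuous_on_const cr f) (use False in auto)
qed

text \<open>The adjoint of a rotation is its inverse, so every difference quotient is symmetric.\<close>

lemma sphere_laplacian_symmetric:
  fixes f g :: "real^'n \<Rightarrow> real"
  assumes f: "has_sphere_laplacian f f'" "continuous_on (sphere 0 1) f" "continuous_on (sphere 0 1) f'"
    and g: "has_sphere_laplacian g g'" "continuous_on (sphere 0 1) g" "continuous_on (sphere 0 1) g'"
  shows "(\<integral>x. f' x * g x \<partial>sphere_measure) = (\<integral>x. f x * g' x \<partial>sphere_measure)"
proof (rule tendsto_unique[of "at_right 0"])
  show "at_right (0::real) \<noteq> bot" by simp
  show "((\<lambda>h. \<integral>x. rot_quotient h f x * g x \<partial>sphere_measure) \<longlongrightarrow> (\<integral>x. f' x * g x \<partial>sphere_measure)) (at_right 0)"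
    using f g unfolding has_sphere_laplacian_def
    by (intro tendsto_integral_sphere continuous_on_rot_quotient)
  have "((\<lambda>h. \<integral>x. rot_quotient h g x * f x \<partial>sphere_measure) \<longlongrightarrow> (\<integral>x. g' x * f x \<partial>sphere_measure)) (at_right 0)"
    using f g unfolding has_sphere_laplacian_def
    by (intro tendsto_integral_sphere continuous_on_rot_quotient)
  then show "((\<lambda>h. \<integral>x. rot_quotient h f x * g x \<partial>sphere_measure) \<longlongrightarrow> (\<integral>x. f x * g' x \<partial>sphere_measure)) (at_right 0)"
    unfolding integral_rot_quotient_symmetric[OF f(2) g(2)] by (simp add: mult.commute)
qed

section \<open>Spherical harmonics as eigenfunctions\<close>

text \<open>Homogeneity is stated with a real exponent and positive factors only, so that the partial
derivatives, of degree k - 1, satisfy the same hypothesis.\<close>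

lemma euler_identity:
  fixes P :: "real^'n \<Rightarrow> real"
  assumes P: "real_polynomial_function P" and hom: "\<And>c x. c > 0 \<Longrightarrow> P (c *\<^sub>R x) = c powr k * P x"
  shows "(\<Sum>i\<in>UNIV. x $ i * partial i P x) = k * P x"
proof -
  have d: "((\<lambda>c. c *\<^sub>R x) has_derivative (\<lambda>h. h *\<^sub>R x)) (at 1)"
    by (auto intro!: derivative_eq_intros)
  have "((\<lambda>c. P (c *\<^sub>R x)) has_derivative (\<lambda>h. \<Sum>i\<in>UNIV. (h *\<^sub>R x) $ i * partial i P (1 *\<^sub>R x))) (at 1)"
    by (rule has_derivative_compose[OF d has_derivative_partial[OF P]])
  moreover have "(\<lambda>h. \<Sum>i\<in>UNIV. (h *\<^sub>R x) $ i * partial i P (1 *\<^sub>R x)) = (*) (\<Sum>i\<in>UNIV. x $ i * partial i P x)"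
    by (simp add: fun_eq_iff sum_distrib_left sum_distrib_right mult_ac)
  ultimately have 1: "((\<lambda>c. P (c *\<^sub>R x)) has_real_derivative (\<Sum>i\<in>UNIV. x $ i * partial i P x)) (at 1)"
    by (simp add: has_field_derivative_def)
  have "((\<lambda>c. c powr k * P x) has_real_derivative k * P x) (at 1)"
    by (auto intro!: derivative_eq_intros)
  then have "((\<lambda>c. P (c *\<^sub>R x)) has_real_derivative k * P x) (at 1)"
  proof (rule DERIV_cong_ev[THEN iffD2, OF refl _ refl, rotated])
    show "\<forall>\<^sub>F c in nhds 1. P (c *\<^sub>R x) = c powr k * P x"
      using eventually_nhds_in_open[of "{0<..}" "1::real"] by (auto elim!: eventually_mono simp: hom)
  qed
  with 1 show ?thesis by (rule DERIV_unique)
qed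

lemma partial_homogeneous:
  fixes P :: "real^'n \<Rightarrow> real"
  assumes P: "real_polynomial_function P" and hom: "\<And>c x. c > 0 \<Longrightarrow> P (c *\<^sub>R x) = c powr k * P x" and c: "c > 0"
  shows "partial i P (c *\<^sub>R x) = c powr (k - 1) * partial i P x"
proof (rule partialI)
  have c0: "c \<noteq> 0" using c by linarith
  have d: "((\<lambda>t. t / c) has_real_derivative 1 / c) (at 0)"
    using c0 by (auto intro!: derivative_eq_intros)
  have "((\<lambda>t. P (x + (t / c) *\<^sub>R axis i 1)) has_real_derivative partial i P (x + (0 / c) *\<^sub>R axis i 1) * (1 / c)) (at 0)"
    by (rule DERIV_chain2[OF line_derivative_partial[OF P] d])
  from DERIV_cmult[OF this, of "c powr k"]
  have "((\<lambda>t. c powr k * P (x + (t / c) *\<^sub>R axis i 1)) has_real_derivative c powr (k - 1) * partial i P x) (at 0)"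
    using c c0 by (simp add: powr_diff)
  moreover have "c powr k * P (x + (t / c) *\<^sub>R axis i 1) = P (c *\<^sub>R x + t *\<^sub>R axis i 1)" for t
    using hom[OF c, of "x + (t / c) *\<^sub>R axis i 1"] c0 by (simp add: scaleR_add_right)
  ultimately show "((\<lambda>t. P (c *\<^sub>R x + t *\<^sub>R axis i 1)) has_real_derivative c powr (k - 1) * partial i P x) (at 0)"
    by simp
qed

lemma laplacian_eq_partial:
  fixes P :: "real^'n \<Rightarrow> real"
  assumes P: "real_polynomial_function P"
  shows "laplacian P x = (\<Sum>i\<in>UNIV. partial i (partial i P) x)"
proof -
  have B: "(Basis :: (real^'n) set) = (\<lambda>i. axis i 1) ` UNIV"
    by (auto simp: Basis_vec_def)
  have "inj (\<lambda>i. axis i 1 :: real^'n)"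
    by (auto simp: inj_on_def axis_eq_axis)
  then have "laplacian P x = (\<Sum>i\<in>UNIV. deriv (deriv (\<lambda>t. P (x + t *\<^sub>R axis i 1))) 0)"
    unfolding laplacian_def B by (subst sum.reindex) auto
  also have "\<dots> = (\<Sum>i\<in>UNIV. partial i (partial i P) x)"
  proof (rule sum.cong[OF refl])
    fix i
    have "deriv (\<lambda>t. P (x + t *\<^sub>R axis i 1)) = (\<lambda>t. partial i P (x + t *\<^sub>R axis i 1))"
      using DERIV_imp_deriv[OF line_derivative_partial[OF P]] by blast
    then show "deriv (deriv (\<lambda>t. P (x + t *\<^sub>R axis i 1))) 0 = partial i (partial i P) x"
      by (simp add: partial_def[of i "partial i P"])
  qed
  finally show ?thesis .
qed

lemma harmonic_homogeneousD:
  fixes P :: "'a::euclidean_space \<Rightarrow> real"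
  assumes "P \<in> harmonic_homogeneous_polynomials l"
  shows "real_polynomial_function P" "\<And>c x. c > 0 \<Longrightarrow> P (c *\<^sub>R x) = c powr real l * P x" "laplacian P x = 0"
  using assms by (auto simp: harmonic_homogeneous_polynomials_def powr_realpow)

text \<open>With \<Sum> x_i \<partial>_i P = l P and the second order term l(l - 1) P, the radial form of the spherical Laplacian
gives -(n - 1) l P - l(l - 1) P = -l(l + n - 2) P, where n - 2 = d - 1.\<close>

lemma harmonic_has_sphere_laplacian:
  fixes P :: "real^'n \<Rightarrow> real"
  assumes P: "P \<in> harmonic_homogeneous_polynomials l"
  shows "has_sphere_laplacian P (\<lambda>x. - laplace_beltrami_eigenvalue (CARD('n) - 1) l * P x)"
proof (rule has_sphere_laplacian_cong[OF has_sphere_laplacian_rotD])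
  show rp: "real_polynomial_function P" by (rule harmonic_homogeneousD[OF P])
  fix x :: "real^'n" assume "x \<in> sphere 0 1"
  then have xx: "x \<bullet> x = 1" by (simp add: norm_eq_1)
  have 1: "(\<Sum>i\<in>UNIV. x $ i * partial i P x) = real l * P x"
    by (rule euler_identity[OF rp harmonic_homogeneousD(2)[OF P]])
  have 2: "(\<Sum>j\<in>UNIV. x $ j * partial j (partial i P) x) = (real l - 1) * partial i P x" for i
    by (rule euler_identity[OF real_polynomial_function_partial[OF rp]
          partial_homogeneous[OF rp harmonic_homogeneousD(2)[OF P]]])
  have 3: "(\<Sum>i\<in>UNIV. \<Sum>j\<in>UNIV. x $ i * x $ j * partial j (partial i P) x) = (real l - 1) * (real l * P x)"
    unfolding 1[symmetric] mult.assoc sum_distrib_left[symmetric] 2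
    by (simp add: sum_distrib_left mult_ac)
  have n: "real (CARD('n) - 1) = real CARD('n) - 1"
    by (simp add: of_nat_diff Suc_leI)
  show "(\<Sum>(i, j)\<in>offdiag. rotD i j (rotD i j P) x) / 2 = - laplace_beltrami_eigenvalue (CARD('n) - 1) l * P x"
    unfolding sum_rotD_rotD[OF rp] laplacian_eq_partial[OF rp, symmetric] harmonic_homogeneousD(3)[OF P] 1 3
      laplace_beltrami_eigenvalue_def n
    by (simp add: algebra_simps)
qed simp

section \<open>Zonal polynomials\<close>

definition zonal :: "real poly \<Rightarrow> real^'n \<Rightarrow> real^'n \<Rightarrow> real" where
  "zonal F y x = poly F (x \<bullet> y)"

lemma real_polynomial_zonal: "real_polynomial_function (zonal F y)"
proof -
  have l: "real_polynomial_function (\<lambda>x. x \<bullet> y)"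
    by (intro real_polynomial_function.intros(1) bounded_linear_inner_left)
  show ?thesis
  proof (induction F)
    case 0 show ?case using real_polynomial_function.intros(2)[of 0] by (simp add: zonal_def[abs_def])
  next
    case (pCons a F)
    then show ?case
      using real_polynomial_function.intros(3)[OF real_polynomial_function.intros(2)[of a]
          real_polynomial_function.intros(4)[OF l, of "zonal F y"]]
      by (simp add: zonal_def[abs_def])
  qed
qed

lemma partial_cmult_zonal: "partial i (\<lambda>x. a * zonal F y x) x = a * (y $ i * zonal (pderiv F) y x)"
proof (rule partialI)
  have d: "((\<lambda>t. (x + t *\<^sub>R axis i 1) \<bullet> y) has_real_derivative y $ i) (at 0)"
    by (auto intro!: derivative_eq_intros simp: inner_add_left inner_axis inner_commute[of "axis _ _"])
  show "((\<lambda>t. a * zonal F y (x + t *\<^sub>R axis i 1)) has_real_derivative a * (y $ i * zonal (pderiv F) y x)) (at 0)"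
    unfolding zonal_def
    by (intro DERIV_cmult) (use DERIV_chain2[OF poly_DERIV d] in \<open>simp add: mult.commute\<close>)
qed

lemma partial_zonal: "partial i (zonal F y) = (\<lambda>x. y $ i * zonal (pderiv F) y x)"
  using partial_cmult_zonal[of i 1 F y] by (simp add: fun_eq_iff)

text \<open>On functions F(t) of t = x \<bullet> y the spherical Laplacian is (1 - t^2) F'' - d t F'.\<close>

definition zonal_laplacian :: "nat \<Rightarrow> real poly \<Rightarrow> real poly" where
  "zonal_laplacian d F = [:1, 0, -1:] * pderiv (pderiv F) - smult (real d) ([:0, 1:] * pderiv F)"

lemma zonal_has_sphere_laplacian:
  fixes y :: "real^'n"
  assumes y: "y \<in> sphere 0 1"
  shows "has_sphere_laplacian (zonal F y) (zonal (zonal_laplacian (CARD('n) - 1) F) y)"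
proof (rule has_sphere_laplacian_cong[OF has_sphere_laplacian_rotD])
  show rp: "real_polynomial_function (zonal F y)" by (rule real_polynomial_zonal)
  fix x :: "real^'n" assume "x \<in> sphere 0 1"
  then have xx: "x \<bullet> x = 1" by (simp add: norm_eq_1)
  have yy: "y \<bullet> y = 1" using y by (simp add: norm_eq_1)
  have p2: "partial j (partial i (zonal F y)) x = y $ i * (y $ j * zonal (pderiv (pderiv F)) y x)" for i j
    by (simp add: partial_zonal[of i] partial_cmult_zonal)
  have 1: "(\<Sum>i\<in>UNIV. partial i (partial i (zonal F y)) x) = zonal (pderiv (pderiv F)) y x"
    using yy by (simp add: p2 mult.assoc[symmetric] sum_distrib_right[symmetric] inner_vec_def)
  have 2: "(\<Sum>i\<in>UNIV. x $ i * partial i (zonal F y) x) = (x \<bullet> y) * zonal (pderiv F) y x"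
    by (simp add: partial_zonal mult.assoc[symmetric] sum_distrib_right[symmetric] inner_vec_def)
  have 3: "(\<Sum>i\<in>UNIV. \<Sum>j\<in>UNIV. x $ i * x $ j * partial j (partial i (zonal F y)) x)
      = (x \<bullet> y) * (x \<bullet> y) * zonal (pderiv (pderiv F)) y x"
  proof -
    have "(\<Sum>i\<in>UNIV. \<Sum>j\<in>UNIV. x $ i * x $ j * partial j (partial i (zonal F y)) x)
      = (\<Sum>i\<in>UNIV. \<Sum>j\<in>UNIV. ((x $ i * y $ i) * (x $ j * y $ j)) * zonal (pderiv (pderiv F)) y x)"
      by (intro sum.cong refl) (simp add: p2 mult_ac)
    also have "\<dots> = (x \<bullet> y) * (x \<bullet> y) * zonal (pderiv (pderiv F)) y x"
      by (simp add: sum_distrib_right[symmetric] sum_product[symmetric] inner_vec_def)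
    finally show ?thesis .
  qed
  have n: "real (CARD('n) - 1) = real CARD('n) - 1"
    by (simp add: of_nat_diff Suc_leI)
  show "(\<Sum>(i, j)\<in>offdiag. rotD i j (rotD i j (zonal F y)) x) / 2 = zonal (zonal_laplacian (CARD('n) - 1) F) y x"
    unfolding sum_rotD_rotD[OF rp] 1 2 3 xx
    by (simp add: zonal_def zonal_laplacian_def n algebra_simps)
qed simp

section \<open>Rotation invariant seminorms\<close>

text \<open>All Lp norms with p in [1,\<infinity>] are treated at once through these four properties. No constant
obtained from them can depend on p.\<close>

locale sphere_seminorm =
  fixes N :: "(real^'n \<Rightarrow> real) \<Rightarrow> real"
  assumes add: "continuous_on (sphere 0 1) f \<Longrightarrow> continuous_on (sphere 0 1) g \<Longrightarrow>
      N (\<lambda>x. f x + g x) \<le> N f + N g"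
    and scale: "continuous_on (sphere 0 1) f \<Longrightarrow> N (\<lambda>x. c * f x) \<le> \<bar>c\<bar> * N f"
    and sup: "continuous_on (sphere 0 1) f \<Longrightarrow> (\<And>x. x \<in> sphere 0 1 \<Longrightarrow> \<bar>f x\<bar> \<le> b) \<Longrightarrow> N f \<le> b"
    and rotate: "continuous_on (sphere 0 1) f \<Longrightarrow> orthogonal_transformation T \<Longrightarrow> N (\<lambda>x. f (T x)) \<le> N f"
begin

lemma near:
  assumes f: "continuous_on (sphere 0 1) f" and g: "continuous_on (sphere 0 1) g"
    and b: "\<And>x. x \<in> sphere 0 1 \<Longrightarrow> \<bar>f x - g x\<bar> \<le> b"
  shows "N f \<le> N g + b"
proof -
  have c: "continuous_on (sphere 0 1) (\<lambda>x. f x - g x)" by (intro continuous_intros f g)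
  have "N f = N (\<lambda>x. g x + (f x - g x))" by simp
  also have "\<dots> \<le> N g + N (\<lambda>x. f x - g x)" by (rule add[OF g c])
  also have "N (\<lambda>x. f x - g x) \<le> b" by (rule sup[OF c b])
  finally show ?thesis by simp
qed

lemma cong:
  assumes "continuous_on (sphere 0 1) f" "continuous_on (sphere 0 1) g" "\<And>x. x \<in> sphere 0 1 \<Longrightarrow> f x = g x"
  shows "N f = N g"
  using near[of f g 0] near[of g f 0] assms by force

lemma sum_le:
  assumes "\<And>i. i \<in> A \<Longrightarrow> continuous_on (sphere 0 1) (f i)"
  shows "N (\<lambda>x. \<Sum>i\<in>A. f i x) \<le> (\<Sum>i\<in>A. N (f i))"
  using assms
proof (induction A rule: infinite_finite_induct)
  case (insert a A)
  have "N (\<lambda>x. f a x + (\<Sum>i\<in>A. f i x)) \<le> N (f a) + N (\<lambda>x. \<Sum>i\<in>A. f i x)"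
    using insert.prems by (intro add continuous_intros) auto
  then show ?case using insert by simp
qed (use sup[of "\<lambda>_. 0" 0] in auto)

text \<open>With m ordered pairs, k = e / h^2 and q the difference quotient of f,
(1 + k m) f = (f - e q) + k \<Sum> (rotations of f). Each rotation of f has at most the norm of f, so
(1 + k m) N f \<le> N (f - e q) + k m N f, and the terms with k cancel. Letting h tend to 0 replaces q
by g.\<close>

lemma dissipative:
  assumes f: "has_sphere_laplacian f g" "continuous_on (sphere 0 1) f" and g: "continuous_on (sphere 0 1) g"
    and e: "e \<ge> 0"
  shows "N f \<le> N (\<lambda>x. f x - e * g x)"
proof (rule field_le_epsilon)
  fix r :: real assume r: "r > 0"
  have "\<forall>\<^sub>F h in at_right 0. \<forall>x\<in>sphere 0 1. dist (rot_quotient h f x) (g x) < r / (e + 1)"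
    using f(1) r e unfolding has_sphere_laplacian_def by (intro uniform_limitD) auto
  moreover have "\<forall>\<^sub>F h::real in at_right 0. h > 0"
    by (rule eventually_at_right_less)
  ultimately have "\<forall>\<^sub>F h in at_right 0. h > 0 \<and> (\<forall>x\<in>sphere 0 1. dist (rot_quotient h f x) (g x) < r / (e + 1))"
    by eventually_elim auto
  from eventually_happens'[OF _ this] obtain h where h: "h > 0"
    "\<And>x. x \<in> sphere 0 1 \<Longrightarrow> dist (rot_quotient h f x) (g x) < r / (e + 1)" by auto
  let ?k = "e / h\<^sup>2" and ?m = "real (card (offdiag :: ('n \<times> 'n) set))"
  let ?q = "\<lambda>x. f x - e * rot_quotient h f x"
  have k: "?k \<ge> 0" using e by simp
  have cq: "continuous_on (sphere 0 1) ?q"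
    by (intro continuous_intros f continuous_on_rot_quotient)
  have cr: "continuous_on (sphere 0 1) (\<lambda>x. case p of (i, j) \<Rightarrow> f (rot i j h x))" if "p \<in> offdiag" for p
    using that continuous_on_rot[OF f(2) orthogonal_rot] by (auto simp: offdiag_def)
  have cs: "continuous_on (sphere 0 1) (\<lambda>x. \<Sum>p\<in>offdiag. case p of (i, j) \<Rightarrow> f (rot i j h x))"
    by (rule continuous_on_sum) (rule cr)
  have id: "(1 + ?k * ?m) * f x = ?q x + ?k * (\<Sum>(i, j)\<in>offdiag. f (rot i j h x))" for x
    by (simp add: rot_quotient_def sum_subtractf split_def algebra_simps diff_divide_distrib)
  have "N (\<lambda>x. \<Sum>p\<in>offdiag. case p of (i, j) \<Rightarrow> f (rot i j h x))
      \<le> (\<Sum>p\<in>offdiag. N (\<lambda>x. case p of (i, j) \<Rightarrow> f (rot i j h x)))"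
    by (rule sum_le) (rule cr)
  also have "\<dots> \<le> (\<Sum>p\<in>(offdiag :: ('n \<times> 'n) set). N f)"
    by (rule sum_mono) (use rotate[OF f(2) orthogonal_rot] in \<open>auto simp: offdiag_def\<close>)
  also have "\<dots> = ?m * N f" by simp
  finally have s: "N (\<lambda>x. \<Sum>p\<in>offdiag. case p of (i, j) \<Rightarrow> f (rot i j h x)) \<le> ?m * N f" .
  have pos: "1 + ?k * ?m > 0" using k by (intro add_pos_nonneg mult_nonneg_nonneg) auto
  have "N f = N (\<lambda>x. (1 / (1 + ?k * ?m)) * ((1 + ?k * ?m) * f x))"
    using pos by (intro arg_cong[of _ _ N]) (simp add: fun_eq_iff)
  also have "\<dots> \<le> \<bar>1 / (1 + ?k * ?m)\<bar> * N (\<lambda>x. (1 + ?k * ?m) * f x)"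
    by (rule scale) (intro continuous_intros f)
  finally have "(1 + ?k * ?m) * N f \<le> N (\<lambda>x. (1 + ?k * ?m) * f x)"
    using pos by (simp add: pos_le_divide_eq mult.commute)
  also have "\<dots> \<le> N ?q + N (\<lambda>x. ?k * (\<Sum>(i, j)\<in>offdiag. f (rot i j h x)))"
    unfolding id by (rule add[OF cq]) (intro continuous_intros cs)
  also have "N (\<lambda>x. ?k * (\<Sum>(i, j)\<in>offdiag. f (rot i j h x))) \<le> \<bar>?k\<bar> * N (\<lambda>x. \<Sum>(i, j)\<in>offdiag. f (rot i j h x))"
    by (rule scale[OF cs])
  also have "\<dots> \<le> ?k * (?m * N f)"
    unfolding abs_of_nonneg[OF k] by (rule mult_left_mono[OF s k])
  finally have "N f \<le> N ?q" by (simp add: algebra_simps)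
  also have "N ?q \<le> N (\<lambda>x. f x - e * g x) + r"
  proof (rule near[OF cq])
    show "continuous_on (sphere 0 1) (\<lambda>x. f x - e * g x)" by (intro continuous_intros f g)
    fix x :: "real^'n" assume x: "x \<in> sphere 0 1"
    have "?q x - (f x - e * g x) = e * (g x - rot_quotient h f x)" by (simp add: algebra_simps)
    then have "\<bar>?q x - (f x - e * g x)\<bar> = e * \<bar>rot_quotient h f x - g x\<bar>"
      using e by (simp add: abs_mult abs_minus_commute)
    also have "\<dots> \<le> e * (r / (e + 1))"
      using h(2)[OF x] e by (intro mult_left_mono) (auto simp: dist_real_def)
    also have "\<dots> \<le> r" using e r by (simp add: field_simps)
    finally show "\<bar>?q x - (f x - e * g x)\<bar> \<le> r" .
  qed
  finally show "N f \<le> N (\<lambda>x. f x - e * g x) + r" by simp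
qed

end

section \<open>Spectral multipliers\<close>

lemma pochhammer_nonneg_real: "(a::real) \<ge> 0 \<Longrightarrow> pochhammer a k \<ge> 0"
  by (induction k) (auto simp: pochhammer_Suc)

lemma pochhammer_nonpos_real:
  assumes "0 \<le> (b::real)" "b < 1" shows "pochhammer (- b) (Suc k) \<le> 0"
proof -
  have "pochhammer (1 - b) k \<ge> 0" using assms by (intro pochhammer_nonneg_real) simp
  then show ?thesis using assms
    by (simp add: pochhammer_rec mult_nonneg_nonneg)
qed

lemma minus_one_power_gbinomial:
  "(-1) ^ k * (a gchoose k) = pochhammer (- a) k / fact k" for a :: real
  by (simp add: gbinomial_pochhammer power_mult_distrib[symmetric] flip: mult.assoc)

text \<open>For 0 \<le> b < 1 all coefficients of (1 - z)^b but the first are nonpositive, while their partial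
sums equal (-1)^m (b - 1 gchoose m) \<ge> 0. So the absolute values of the nonpositive ones add up to
at most 1.\<close>

lemma sum_abs_binomial_le:
  assumes b: "0 \<le> (b::real)" "b < 1"
  shows "(\<Sum>k<K. \<bar>(-1) ^ k * (b gchoose k)\<bar>) \<le> 2"
proof (cases K)
  case (Suc m)
  let ?w = "\<lambda>k. (-1) ^ k * (b gchoose k)"
  have neg: "?w (Suc k) \<le> 0" for k
    unfolding minus_one_power_gbinomial using pochhammer_nonpos_real[OF b, of k]
    by (simp add: divide_nonpos_pos)
  have "(\<Sum>k\<le>m. ?w k) = (-1) ^ m * (b - 1 gchoose m)"
    using gbinomial_sum_lower_neg[of b m] by (simp add: mult.commute)
  also have "\<dots> \<ge> 0"
    unfolding minus_one_power_gbinomial using b by (intro divide_nonneg_pos pochhammer_nonneg_real) auto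
  finally have "0 \<le> (\<Sum>k\<le>m. ?w k)" .
  then have "0 \<le> 1 + (\<Sum>k<m. ?w (Suc k))"
    by (simp add: sum.atMost_shift)
  moreover have "(\<Sum>k\<le>m. \<bar>?w k\<bar>) = 1 - (\<Sum>k<m. ?w (Suc k))"
  proof -
    have "(\<Sum>k\<le>m. \<bar>?w k\<bar>) = 1 + (\<Sum>k<m. \<bar>?w (Suc k)\<bar>)"
      by (simp add: sum.atMost_shift)
    also have "(\<Sum>k<m. \<bar>?w (Suc k)\<bar>) = (\<Sum>k<m. - ?w (Suc k))"
      by (intro sum.cong refl abs_of_nonpos neg)
    finally show ?thesis by (simp add: sum_negf)
  qed
  ultimately show ?thesis by (simp add: Suc lessThan_Suc_atMost)
qed simp

text \<open>Finite sums of eigenfunctions. Functions of the operator A = 1 - \<Delta> act on them as multipliers of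
the coefficients, so nothing has to be said about domains or convergence of expansions.\<close>

locale sphere_spectral = sphere_seminorm N for N :: "(real^'n \<Rightarrow> real) \<Rightarrow> real" +
  fixes e :: "nat \<Rightarrow> real^'n \<Rightarrow> real" and lam :: "nat \<Rightarrow> real" and L :: nat
  assumes e_continuous: "continuous_on (sphere 0 1) (e l)"
    and e_eigen: "has_sphere_laplacian (e l) (\<lambda>x. - lam l * e l x)"
    and lam_nonneg: "lam l \<ge> 0"
begin

definition synth :: "(nat \<Rightarrow> real) \<Rightarrow> real^'n \<Rightarrow> real" where
  "synth a x = (\<Sum>l\<le>L. a l * e l x)"

definition mult_bound :: "(nat \<Rightarrow> real) \<Rightarrow> real \<Rightarrow> bool" where
  "mult_bound \<phi> c \<longleftrightarrow> (\<forall>a. N (synth (\<lambda>l. \<phi> l * a l)) \<le> c * N (synth a))"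

lemma mult_boundD: "mult_bound \<phi> c \<Longrightarrow> N (synth (\<lambda>l. \<phi> l * a l)) \<le> c * N (synth a)"
  by (simp add: mult_bound_def)

lemma continuous_on_synth: "continuous_on (sphere 0 1) (synth a)"
  unfolding synth_def[abs_def] by (intro continuous_intros e_continuous)

lemma N_nonneg: assumes f: "continuous_on (sphere 0 1) f" shows "N f \<ge> 0"
proof -
  have "N (\<lambda>x. 0 + 0) \<le> N (\<lambda>x. 0) + N (\<lambda>x. 0)" by (rule add) auto
  then have "0 \<le> N (\<lambda>x. 0)" by simp
  also have "\<dots> = N (\<lambda>x. f x + (-1) * f x)" by simp
  also have "\<dots> \<le> N f + N (\<lambda>x. (-1) * f x)" by (intro add f continuous_intros)
  also have "N (\<lambda>x. (-1) * f x) \<le> \<bar>-1\<bar> * N f" by (rule scale[OF f])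
  finally show ?thesis by simp
qed

lemma synth_eigen: "has_sphere_laplacian (synth a) (synth (\<lambda>l. - lam l * a l))"
proof -
  have "has_sphere_laplacian (synth a) (\<lambda>x. \<Sum>l\<le>L. a l * (- lam l * e l x))"
    unfolding synth_def[abs_def]
    by (intro has_sphere_laplacian_sum has_sphere_laplacian_cmult e_eigen)
  then show ?thesis by (simp add: synth_def[abs_def] mult_ac)
qed

text \<open>Dissipativity with parameter r / (1 + r) bounds the resolvent 1 / (1 + r A): indeed
1 + r A = (1 + r) (1 - (r / (1 + r)) \<Delta>).\<close>

lemma mult_bound_resolvent:
  assumes "r \<ge> 0"
  shows "mult_bound (\<lambda>l. 1 / (1 + r * (1 + lam l))) 1"
  unfolding mult_bound_def
proof
  fix a
  let ?b = "\<lambda>l. 1 / (1 + r * (1 + lam l)) * a l"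
  let ?r = "r / (1 + r)"
  have r: "?r \<ge> 0" using assms by simp
  have d: "1 + r * (1 + lam l) \<noteq> 0" for l
    using assms lam_nonneg[of l] by (smt (verit) mult_nonneg_nonneg)
  have "N (synth ?b) \<le> N (\<lambda>x. synth ?b x - ?r * synth (\<lambda>l. - lam l * ?b l) x)"
    by (rule dissipative[OF synth_eigen continuous_on_synth continuous_on_synth r])
  also have "(\<lambda>x. synth ?b x - ?r * synth (\<lambda>l. - lam l * ?b l) x) = (\<lambda>x. (1 / (1 + r)) * synth a x)"
  proof
    fix x
    have c: "?b l - ?r * (- lam l * ?b l) = (1 / (1 + r)) * a l" for l
    proof -
      have "(1 + r) * (b - ?r * (- m * b)) = (1 + r * (1 + m)) * b" for b m
        using assms by (simp add: field_simps)
      then have "(1 + r) * (?b l - ?r * (- lam l * ?b l)) = (1 + r * (1 + lam l)) * ?b l" .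
      also have "\<dots> = a l" using d[of l] by simp
      finally show ?thesis using assms by (simp add: field_simps)
    qed
    have "synth ?b x - ?r * synth (\<lambda>l. - lam l * ?b l) x = (\<Sum>l\<le>L. (?b l - ?r * (- lam l * ?b l)) * e l x)"
      unfolding synth_def sum_distrib_left sum_subtractf[symmetric]
      by (intro sum.cong refl) (simp only: left_diff_distrib mult.assoc)
    also have "\<dots> = (1 / (1 + r)) * synth a x"
      unfolding c synth_def sum_distrib_left by (simp only: mult.assoc)
    finally show "synth ?b x - ?r * synth (\<lambda>l. - lam l * ?b l) x = (1 / (1 + r)) * synth a x" .
  qed
  also have "N \<dots> \<le> \<bar>1 / (1 + r)\<bar> * N (synth a)" by (rule scale[OF continuous_on_synth])
  also have "\<dots> \<le> 1 * N (synth a)"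
    using assms by (intro mult_right_mono N_nonneg continuous_on_synth) auto
  finally show "N (synth ?b) \<le> 1 * N (synth a)" .
qed

lemma mult_bound_mult:
  assumes "mult_bound \<phi> c" "mult_bound \<psi> d" "c \<ge> 0"
  shows "mult_bound (\<lambda>l. \<phi> l * \<psi> l) (c * d)"
  unfolding mult_bound_def
proof
  fix a
  have "N (synth (\<lambda>l. \<phi> l * (\<psi> l * a l))) \<le> c * N (synth (\<lambda>l. \<psi> l * a l))"
    by (rule mult_boundD[OF assms(1)])
  also have "\<dots> \<le> c * (d * N (synth a))"
    by (intro mult_left_mono mult_boundD assms)
  finally show "N (synth (\<lambda>l. \<phi> l * \<psi> l * a l)) \<le> c * d * N (synth a)"
    by (simp add: mult.assoc)
qed

lemma mult_bound_power: "mult_bound \<phi> 1 \<Longrightarrow> mult_bound (\<lambda>l. \<phi> l ^ k) 1"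
proof (induction k)
  case (Suc k) then show ?case using mult_bound_mult[of \<phi> 1 "\<lambda>l. \<phi> l ^ k" 1] by simp
qed (simp add: mult_bound_def)

lemma mult_bound_sum:
  fixes K :: nat
  assumes "\<And>k. mult_bound (\<phi> k) 1"
  shows "mult_bound (\<lambda>l. \<Sum>k<K. w k * \<phi> k l) (\<Sum>k<K. \<bar>w k\<bar>)"
  unfolding mult_bound_def
proof
  fix a
  have eq: "synth (\<lambda>l. (\<Sum>k<K. w k * \<phi> k l) * a l) = (\<lambda>x. \<Sum>k<K. w k * synth (\<lambda>l. \<phi> k l * a l) x)"
  proof
    fix x
    have "synth (\<lambda>l. (\<Sum>k<K. w k * \<phi> k l) * a l) x = (\<Sum>l\<le>L. \<Sum>k<K. w k * (\<phi> k l * a l * e l x))"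
      unfolding synth_def sum_distrib_right by (simp only: mult.assoc)
    also have "\<dots> = (\<Sum>k<K. \<Sum>l\<le>L. w k * (\<phi> k l * a l * e l x))" by (rule sum.swap)
    finally show "synth (\<lambda>l. (\<Sum>k<K. w k * \<phi> k l) * a l) x = (\<Sum>k<K. w k * synth (\<lambda>l. \<phi> k l * a l) x)"
      by (simp only: synth_def sum_distrib_left)
  qed
  have "N (synth (\<lambda>l. (\<Sum>k<K. w k * \<phi> k l) * a l)) \<le> (\<Sum>k<K. N (\<lambda>x. w k * synth (\<lambda>l. \<phi> k l * a l) x))"
    unfolding eq by (rule sum_le) (intro continuous_intros continuous_on_synth)
  also have "\<dots> \<le> (\<Sum>k<K. \<bar>w k\<bar> * N (synth a))"
  proof (rule sum_mono)
    fix k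
    have "N (\<lambda>x. w k * synth (\<lambda>l. \<phi> k l * a l) x) \<le> \<bar>w k\<bar> * N (synth (\<lambda>l. \<phi> k l * a l))"
      by (rule scale[OF continuous_on_synth])
    also have "\<dots> \<le> \<bar>w k\<bar> * N (synth a)"
      using mult_boundD[OF assms, of k a] by (intro mult_left_mono) auto
    finally show "N (\<lambda>x. w k * synth (\<lambda>l. \<phi> k l * a l) x) \<le> \<bar>w k\<bar> * N (synth a)" .
  qed
  finally show "N (synth (\<lambda>l. (\<Sum>k<K. w k * \<phi> k l) * a l)) \<le> (\<Sum>k<K. \<bar>w k\<bar>) * N (synth a)"
    by (simp add: sum_distrib_right)
qed

text \<open>Only the finitely many values \<phi> 0, \<dots>, \<phi> L matter, so pointwise convergence of multipliers implies
uniform convergence of the functions on the sphere.\<close>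

lemma mult_bound_limit:
  assumes F: "F \<noteq> bot" and lim: "\<And>l. ((\<lambda>n. \<phi> n l) \<longlongrightarrow> \<psi> l) F"
    and bound: "\<forall>\<^sub>F n in F. mult_bound (\<phi> n) c"
  shows "mult_bound \<psi> c"
  unfolding mult_bound_def
proof
  fix a
  have "\<exists>B. \<forall>l. B l > 0 \<and> (\<forall>x\<in>sphere 0 1. \<bar>e l x\<bar> \<le> B l)"
    using continuous_on_sphere_bounded[OF e_continuous] by (intro choice) metis
  then obtain B where B: "\<And>l x. x \<in> sphere 0 1 \<Longrightarrow> \<bar>e l x\<bar> \<le> B l" by blast
  let ?d = "\<lambda>n. \<Sum>l\<le>L. \<bar>\<psi> l - \<phi> n l\<bar> * \<bar>a l\<bar> * B l"
  have "((\<lambda>n. c * N (synth a) + ?d n) \<longlongrightarrow> c * N (synth a) + (\<Sum>l\<le>L. \<bar>\<psi> l - \<psi> l\<bar> * \<bar>a l\<bar> * B l)) F"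
    by (intro tendsto_intros lim)
  moreover have "\<forall>\<^sub>F n in F. N (synth (\<lambda>l. \<psi> l * a l)) \<le> c * N (synth a) + ?d n"
    using bound
  proof eventually_elim
    case (elim n)
    have "N (synth (\<lambda>l. \<psi> l * a l)) \<le> N (synth (\<lambda>l. \<phi> n l * a l)) + ?d n"
    proof (rule near[OF continuous_on_synth continuous_on_synth])
      fix x :: "real^'n" assume x: "x \<in> sphere 0 1"
      have "synth (\<lambda>l. \<psi> l * a l) x - synth (\<lambda>l. \<phi> n l * a l) x = (\<Sum>l\<le>L. (\<psi> l - \<phi> n l) * a l * e l x)"
        by (simp add: synth_def sum_subtractf left_diff_distrib)
      also have "\<bar>\<dots>\<bar> \<le> (\<Sum>l\<le>L. \<bar>(\<psi> l - \<phi> n l) * a l * e l x\<bar>)" by (rule sum_abs)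
      also have "\<dots> \<le> ?d n"
        by (rule sum_mono) (auto simp: abs_mult intro!: mult_left_mono B[OF x])
      finally show "\<bar>synth (\<lambda>l. \<psi> l * a l) x - synth (\<lambda>l. \<phi> n l * a l) x\<bar> \<le> ?d n" .
    qed
    also have "N (synth (\<lambda>l. \<phi> n l * a l)) \<le> c * N (synth a)" by (rule mult_boundD[OF elim])
    finally show ?case by simp
  qed
  ultimately show "N (synth (\<lambda>l. \<psi> l * a l)) \<le> c * N (synth a)"
    using tendsto_lowerbound[OF _ _ F] by fastforce
qed

lemma mult_bound_mono:
  assumes "mult_bound \<phi> c" "c \<le> d" shows "mult_bound \<phi> d"
  unfolding mult_bound_def
  using order_trans[OF mult_boundD[OF assms(1)] mult_right_mono[OF assms(2) N_nonneg[OF continuous_on_synth]]]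
  by blast

lemma mult_bound_series:
  assumes \<phi>: "mult_bound \<phi> 1" and s: "\<And>l. (\<lambda>k. w k * \<phi> l ^ k) sums \<psi> l"
    and C: "\<And>K. (\<Sum>k<K. \<bar>w k\<bar>) \<le> C"
  shows "mult_bound \<psi> C"
proof (rule mult_bound_limit[where F = sequentially])
  show "(\<lambda>K. \<Sum>k<K. w k * \<phi> l ^ k) \<longlonglongrightarrow> \<psi> l" for l
    using s[of l] by (simp add: sums_def)
  show "\<forall>\<^sub>F K in sequentially. mult_bound (\<lambda>l. \<Sum>k<K. w k * \<phi> l ^ k) C"
    by (intro always_eventually allI mult_bound_mono[OF mult_bound_sum[of "\<lambda>k l. \<phi> l ^ k"] C]
        mult_bound_power \<phi>)
qed simp

text \<open>The binomial series of (1 - z)^b, whose coefficients have absolute values of sum at most 2.\<close>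

lemma mult_bound_power_one_minus:
  assumes b: "0 \<le> b" "b < 1" and \<phi>: "mult_bound \<phi> 1" "\<And>l. 0 \<le> \<phi> l" "\<And>l. \<phi> l < 1"
  shows "mult_bound (\<lambda>l. (1 - \<phi> l) powr b) 2"
proof (rule mult_bound_series[OF \<phi>(1)])
  show "(\<lambda>k. ((-1) ^ k * (b gchoose k)) * \<phi> l ^ k) sums (1 - \<phi> l) powr b" for l
    using gen_binomial_real[of "- \<phi> l" b] \<phi>(2,3)[of l]
    by (simp add: power_minus[of "\<phi> l"] mult_ac)
qed (rule sum_abs_binomial_le[OF b])

text \<open>Fractional powers of the resolvent are contractions. Write S = 1 / (1 + h A) and k = h / r. Then
k^g (1 - (1 - k) S)^(-g) is a power series in the contraction S with nonnegative coefficients of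
sum k^g k^(-g) = 1, and as a function of A it equals ((1 + h A) / (1 + r A))^g. Let h tend to 0.\<close>

lemma mult_bound_negative_power:
  assumes g: "g \<ge> 0" and r: "r > 0"
  shows "mult_bound (\<lambda>l. (1 + r * (1 + lam l)) powr (- g)) 1"
proof (rule mult_bound_limit[where F = "at_right 0"])
  let ?\<phi> = "\<lambda>h l. ((1 + h * (1 + lam l)) / (1 + r * (1 + lam l))) powr g"
  have pos: "1 + h * (1 + lam l) > 0" if "h \<ge> 0" for h l
    using that lam_nonneg[of l] by (smt (verit) mult_nonneg_nonneg)
  show "((\<lambda>h. ?\<phi> h l) \<longlongrightarrow> (1 + r * (1 + lam l)) powr (- g)) (at_right 0)" for l
  proof -
    have "((\<lambda>h. ?\<phi> h l) \<longlongrightarrow> ((1 + 0 * (1 + lam l)) / (1 + r * (1 + lam l))) powr g) (at_right 0)"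
      using pos[of r l] r by (intro tendsto_intros) auto
    then show ?thesis using pos[of r l] r by (simp add: powr_minus powr_divide inverse_eq_divide)
  qed
  have "mult_bound (?\<phi> h) 1" if h: "0 < h" "h < r" for h
  proof -
    define k where "k = h / r"
    have k: "0 < k" "k < 1" using h by (auto simp: k_def)
    let ?S = "\<lambda>l. 1 / (1 + h * (1 + lam l))"
    have S: "0 < ?S l" "?S l \<le> 1" for l
      using pos[of h l] h lam_nonneg[of l] by auto
    let ?w = "\<lambda>j. k powr g * (((-1) ^ j * (- g gchoose j)) * (1 - k) ^ j)"
    have wn: "?w j \<ge> 0" for j
      unfolding minus_one_power_gbinomial using g k pochhammer_nonneg_real[of g j] by simp
    have ser: "(\<lambda>j. ((-1) ^ j * (- g gchoose j)) * z ^ j) sums (1 - z) powr (- g)" if "0 \<le> z" "z < 1" for z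
      using gen_binomial_real[of "- z" "- g"] that by (simp add: power_minus[of z] mult_ac)
    show ?thesis
    proof (rule mult_bound_series[where \<phi> = ?S and w = ?w])
      show "mult_bound ?S 1" using h by (intro mult_bound_resolvent) simp
      fix l
      let ?z = "(1 - k) * ?S l"
      have z: "0 \<le> ?z" "?z < 1" using k S[of l] mult_strict_right_mono[of "1 - k" 1 "?S l"] by auto
      have "(\<lambda>j. k powr g * (((-1) ^ j * (- g gchoose j)) * ?z ^ j)) sums (k powr g * (1 - ?z) powr (- g))"
        by (rule sums_mult[OF ser[OF z]])
      moreover have "k powr g * (((-1) ^ j * (- g gchoose j)) * ?z ^ j) = ?w j * ?S l ^ j" for j
        unfolding power_mult_distrib by (simp only: mult_ac)
      moreover have "k powr g * (1 - ?z) powr (- g) = ?\<phi> h l"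
      proof -
        have "1 - ?z = k * ((1 + r * (1 + lam l)) / (1 + h * (1 + lam l)))"
        proof -
          have "h = k * r" using h by (simp add: k_def)
          then have "1 + h * (1 + lam l) - (1 - k) = k * (1 + r * (1 + lam l))"
            by (simp add: algebra_simps)
          then show ?thesis using pos[of h l] h by (simp add: field_simps)
        qed
        moreover have "(k * X) powr (- g) = k powr (- g) * X powr (- g)" if "X \<ge> 0" for X
          using k that by (simp add: powr_mult)
        ultimately have "(1 - ?z) powr (- g) = k powr (- g) * ((1 + r * (1 + lam l)) / (1 + h * (1 + lam l))) powr (- g)"
          using pos[of h l] pos[of r l] h by (simp only: divide_nonneg_nonneg less_imp_le)
        also have "((1 + r * (1 + lam l)) / (1 + h * (1 + lam l))) powr (- g) = ?\<phi> h l"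
          using pos[of h l] pos[of r l] h by (simp add: powr_minus powr_divide inverse_eq_divide)
        finally show ?thesis using k by (simp add: powr_minus field_simps)
      qed
      ultimately show "(\<lambda>j. ?w j * ?S l ^ j) sums ?\<phi> h l" by (simp only:)
    next
      fix K
      have s: "?w sums (k powr g * k powr (- g))"
        using sums_mult[OF ser[of "1 - k"], of "k powr g"] k by simp
      have "(\<Sum>j<K. \<bar>?w j\<bar>) = (\<Sum>j<K. ?w j)" using wn by (intro sum.cong refl abs_of_nonneg)
      also have "\<dots> \<le> suminf ?w" using s wn by (intro sum_le_suminf) (auto simp: sums_iff)
      also have "\<dots> = 1" using s k by (simp add: sums_iff powr_minus)
      finally show "(\<Sum>j<K. \<bar>?w j\<bar>) \<le> 1" .
    qed
  qed
  moreover have "\<forall>\<^sub>F h in at_right 0. h < r \<and> 0 < h"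
    using r by (auto intro!: eventually_conj order_tendstoD(2)[OF tendsto_ident_at] simp: eventually_at_right_less)
  ultimately show "\<forall>\<^sub>F h in at_right 0. mult_bound (?\<phi> h) 1"
    by (auto elim!: eventually_mono)
qed simp

text \<open>Interpolation between h and A h. With the resolvent R = 1 / (1 + r A),
(r A)^b R = (1 - R)^b R^(1 - b), where the first factor is bounded by 2 and the second by 1; apply
this to (1 + r A) h.\<close>

lemma moment_inequality:
  assumes b: "0 \<le> b" "b < 1" and r: "r > 0"
  shows "N (synth (\<lambda>l. (1 + lam l) powr b * a l)) \<le>
    2 * r powr (- b) * (N (synth a) + r * N (synth (\<lambda>l. (1 + lam l) * a l)))"
proof -
  let ?A = "\<lambda>l. 1 + lam l"
  let ?R = "\<lambda>l. 1 / (1 + r * ?A l)"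
  have A: "?A l > 0" for l using lam_nonneg[of l] by simp
  have d: "1 + r * ?A l > 1" for l using A[of l] r by simp
  have "mult_bound (\<lambda>l. (1 - ?R l) powr b * (1 + r * ?A l) powr (- (1 - b))) (2 * 1)"
  proof (intro mult_bound_mult mult_bound_power_one_minus[OF b] mult_bound_negative_power mult_bound_resolvent)
    show "0 \<le> ?R l" "?R l < 1" for l using d[of l] by auto
  qed (use b r in auto)
  moreover have "(1 - ?R l) powr b * (1 + r * ?A l) powr (- (1 - b)) = r powr b * (?A l powr b / (1 + r * ?A l))" for l
  proof -
    have "1 - ?R l = r * ?A l / (1 + r * ?A l)" using d[of l] by (simp add: field_simps)
    then have "(1 - ?R l) powr b = r powr b * ?A l powr b / (1 + r * ?A l) powr b"
      using d[of l] A[of l] r by (simp add: powr_divide powr_mult)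
    moreover have "(1 + r * ?A l) powr (- (1 - b)) = (1 + r * ?A l) powr b / (1 + r * ?A l)"
      using d[of l] powr_add[of "1 + r * ?A l" b "-1"] by (simp add: powr_minus divide_inverse)
    ultimately show ?thesis using d[of l] by simp
  qed
  ultimately have mb: "mult_bound (\<lambda>l. r powr b * (?A l powr b / (1 + r * ?A l))) 2" by simp
  have eq: "synth (\<lambda>l. ?A l powr b * a l) = (\<lambda>x. r powr (- b) * synth (\<lambda>l. r powr b * (?A l powr b / (1 + r * ?A l)) * ((1 + r * ?A l) * a l)) x)"
  proof
    fix x
    have "?A l powr b * a l = r powr (- b) * (r powr b * (?A l powr b / (1 + r * ?A l)) * ((1 + r * ?A l) * a l))" for l
      using d[of l] r by (simp add: powr_minus)
    then show "synth (\<lambda>l. ?A l powr b * a l) x = r powr (- b) * synth (\<lambda>l. r powr b * (?A l powr b / (1 + r * ?A l)) * ((1 + r * ?A l) * a l)) x"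
      by (simp only: synth_def sum_distrib_left mult.assoc)
  qed
  have "N (synth (\<lambda>l. ?A l powr b * a l)) \<le> \<bar>r powr (- b)\<bar> * N (synth (\<lambda>l. r powr b * (?A l powr b / (1 + r * ?A l)) * ((1 + r * ?A l) * a l)))"
    unfolding eq by (rule scale[OF continuous_on_synth])
  also have "\<dots> \<le> r powr (- b) * (2 * N (synth (\<lambda>l. (1 + r * ?A l) * a l)))"
    unfolding abs_of_nonneg[OF powr_ge_zero] by (rule mult_left_mono[OF mult_boundD[OF mb] powr_ge_zero])
  also have "N (synth (\<lambda>l. (1 + r * ?A l) * a l)) \<le> N (synth a) + r * N (synth (\<lambda>l. ?A l * a l))"
  proof -
    have "synth (\<lambda>l. (1 + r * ?A l) * a l) = (\<lambda>x. synth a x + r * synth (\<lambda>l. ?A l * a l) x)"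
      unfolding synth_def[abs_def] sum_distrib_left sum.distrib[symmetric]
      by (intro ext sum.cong refl) (simp add: algebra_simps)
    moreover have "N (\<lambda>x. synth a x + r * synth (\<lambda>l. ?A l * a l) x) \<le> N (synth a) + N (\<lambda>x. r * synth (\<lambda>l. ?A l * a l) x)"
      by (intro add continuous_intros continuous_on_synth)
    moreover have "N (\<lambda>x. r * synth (\<lambda>l. ?A l * a l) x) \<le> \<bar>r\<bar> * N (synth (\<lambda>l. ?A l * a l))"
      by (rule scale[OF continuous_on_synth])
    ultimately show ?thesis using r by simp
  qed
  finally have "N (synth (\<lambda>l. ?A l powr b * a l))
      \<le> r powr (- b) * (2 * (N (synth a) + r * N (synth (\<lambda>l. ?A l * a l))))"
    by (simp add: mult_left_mono)
  then show ?thesis by (simp only: mult_ac)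
qed

end

section \<open>Zonal harmonics\<close>

text \<open>The recursion is the one that makes the Laplacian of the polynomial below vanish: the term with
index j + 1 cancels what the second derivatives of (x \<bullet> y)^(l - 2j) contribute. The polynomials are
Gegenbauer polynomials (Chebyshev polynomials for n = 2), normalised to leading coefficient 1.\<close>

fun gegenbauer_coeff :: "nat \<Rightarrow> nat \<Rightarrow> nat \<Rightarrow> real" where
  "gegenbauer_coeff n l 0 = 1"
| "gegenbauer_coeff n l (Suc j) = - gegenbauer_coeff n l j * (real l - 2 * real j) * (real l - 2 * real j - 1)
     / (2 * (real j + 1) * (real n + 2 * real l - 2 * real j - 4))"

definition solid_zonal :: "nat \<Rightarrow> real^'n \<Rightarrow> real^'n \<Rightarrow> real" where
  "solid_zonal l y x = (\<Sum>j\<le>l div 2. gegenbauer_coeff CARD('n) l j * ((x \<bullet> x) ^ j * (x \<bullet> y) ^ (l - 2 * j)))"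

definition gegenbauer_poly :: "nat \<Rightarrow> nat \<Rightarrow> real poly" where
  "gegenbauer_poly n l = (\<Sum>j\<le>l div 2. monom (gegenbauer_coeff n l j) (l - 2 * j))"

lemma solid_zonal_on_sphere:
  fixes y :: "real^'n"
  shows "x \<in> sphere 0 1 \<Longrightarrow> solid_zonal l y x = zonal (gegenbauer_poly CARD('n) l) y x"
  by (simp add: solid_zonal_def zonal_def gegenbauer_poly_def poly_sum poly_monom norm_eq_1)

lemma real_polynomial_square: "real_polynomial_function (\<lambda>x::real^'n. x \<bullet> x)"
proof -
  have "real_polynomial_function (\<lambda>x::real^'n. \<Sum>i\<in>UNIV. x $ i * x $ i)"
    by (intro real_polynomial_function_sum real_polynomial_function.intros(4) real_polynomial_coordinate) auto
  then show ?thesis by (simp add: inner_vec_def)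
qed

lemma real_polynomial_inner: "real_polynomial_function (\<lambda>x::real^'n. x \<bullet> y)"
  by (intro real_polynomial_function.intros(1) bounded_linear_inner_left)

lemma real_polynomial_solid_zonal: "real_polynomial_function (solid_zonal l y)"
  unfolding solid_zonal_def[abs_def]
  by (intro real_polynomial_function_sum real_polynomial_function.intros(2,4) real_polynomial_function_power
      real_polynomial_square real_polynomial_inner) auto

lemma solid_zonal_homogeneous: "solid_zonal l y (c *\<^sub>R x) = c ^ l * solid_zonal l y x"
proof -
  have "(c * (c * (x \<bullet> x))) ^ j * (c * (x \<bullet> y)) ^ (l - 2 * j) = c ^ l * ((x \<bullet> x) ^ j * (x \<bullet> y) ^ (l - 2 * j))"
    if "j \<le> l div 2" for j
  proof -
    have "c ^ l = (c * c) ^ j * c ^ (l - 2 * j)"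
      using that by (simp add: power2_eq_square[symmetric] power_mult[symmetric] power_add[symmetric])
    then show ?thesis by (simp only: mult.assoc[symmetric] power_mult_distrib) (simp add: mult_ac)
  qed
  then show ?thesis
    unfolding solid_zonal_def sum_distrib_left by (intro sum.cong refl) (simp add: mult.left_commute)
qed

lemma second_derivative_square_inner_power:
  fixes x y :: "real^'n"
  shows "deriv (deriv (\<lambda>t. ((x + t *\<^sub>R axis i 1) \<bullet> (x + t *\<^sub>R axis i 1)) ^ j * ((x + t *\<^sub>R axis i 1) \<bullet> y) ^ m)) 0
    = 2 * real j * (x \<bullet> x) ^ (j - 1) * (x \<bullet> y) ^ m
      + 4 * real j * real (j - 1) * (x $ i)\<^sup>2 * (x \<bullet> x) ^ (j - 2) * (x \<bullet> y) ^ m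
      + 4 * real j * real m * x $ i * y $ i * (x \<bullet> x) ^ (j - 1) * (x \<bullet> y) ^ (m - 1)
      + real m * real (m - 1) * (y $ i)\<^sup>2 * (x \<bullet> x) ^ j * (x \<bullet> y) ^ (m - 2)"
proof -
  let ?a = "\<lambda>t. (x + t *\<^sub>R axis i 1) \<bullet> (x + t *\<^sub>R axis i 1)" and ?b = "\<lambda>t. (x + t *\<^sub>R axis i 1) \<bullet> y"
  have ax: "axis i (1::real) \<bullet> u = u $ i" "u \<bullet> axis i (1::real) = u $ i" for u
    by (simp_all add: inner_axis inner_commute[of "axis _ _"])
  have a: "(?a has_real_derivative 2 * (x $ i + t)) (at t)" for t
    by (auto intro!: derivative_eq_intros simp: ax inner_add_left inner_add_right)
  have b: "(?b has_real_derivative y $ i) (at t)" for t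
    by (auto intro!: derivative_eq_intros simp: ax inner_add_left)
  have pa: "((\<lambda>t. ?a t ^ k) has_real_derivative real k * ?a t ^ (k - 1) * (2 * (x $ i + t))) (at t)" for t k
    using DERIV_power[OF a, of k t] by (simp add: mult_ac)
  have pb: "((\<lambda>t. ?b t ^ k) has_real_derivative real k * ?b t ^ (k - 1) * y $ i) (at t)" for t k
    using DERIV_power[OF b, of k t] by (simp add: mult_ac)
  have d1: "deriv (\<lambda>t. ?a t ^ j * ?b t ^ m) = (\<lambda>t. real j * ?a t ^ (j - 1) * (2 * (x $ i + t)) * ?b t ^ m
      + real m * ?b t ^ (m - 1) * y $ i * ?a t ^ j)"
    by (intro ext DERIV_imp_deriv DERIV_mult pa pb)
  have c: "((\<lambda>t. 2 * (x $ i + t)) has_real_derivative 2) (at t)" for t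
    by (auto intro!: derivative_eq_intros)
  have "((\<lambda>t. real j * ?a t ^ (j - 1) * (2 * (x $ i + t)) * ?b t ^ m + real m * ?b t ^ (m - 1) * y $ i * ?a t ^ j)
    has_real_derivative
     ((real j * (real (j - 1) * ?a 0 ^ (j - 1 - 1) * (2 * (x $ i + 0)))) * (2 * (x $ i + 0)) + 2 * (real j * ?a 0 ^ (j - 1))) * ?b 0 ^ m
     + (real m * ?b 0 ^ (m - 1) * y $ i) * (real j * ?a 0 ^ (j - 1) * (2 * (x $ i + 0)))
     + ((real m * (real (m - 1) * ?b 0 ^ (m - 1 - 1) * y $ i)) * y $ i * ?a 0 ^ j
        + (real j * ?a 0 ^ (j - 1) * (2 * (x $ i + 0))) * (real m * ?b 0 ^ (m - 1) * y $ i))) (at 0)"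
    by (intro DERIV_add DERIV_mult DERIV_cmult DERIV_cmult_right pa pb c)
  then have "deriv (\<lambda>t. real j * ?a t ^ (j - 1) * (2 * (x $ i + t)) * ?b t ^ m + real m * ?b t ^ (m - 1) * y $ i * ?a t ^ j) 0 =
     ((real j * (real (j - 1) * ?a 0 ^ (j - 1 - 1) * (2 * (x $ i + 0)))) * (2 * (x $ i + 0)) + 2 * (real j * ?a 0 ^ (j - 1))) * ?b 0 ^ m
     + (real m * ?b 0 ^ (m - 1) * y $ i) * (real j * ?a 0 ^ (j - 1) * (2 * (x $ i + 0)))
     + ((real m * (real (m - 1) * ?b 0 ^ (m - 1 - 1) * y $ i)) * y $ i * ?a 0 ^ j
        + (real j * ?a 0 ^ (j - 1) * (2 * (x $ i + 0))) * (real m * ?b 0 ^ (m - 1) * y $ i))"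
    by (rule DERIV_imp_deriv)
  then show ?thesis unfolding d1 by (simp add: algebra_simps power2_eq_square diff_diff_add numeral_2_eq_2)
qed

lemma laplacian_square_inner_power:
  fixes x y :: "real^'n"
  assumes y: "y \<in> sphere 0 1"
  shows "laplacian (\<lambda>x. (x \<bullet> x) ^ j * (x \<bullet> y) ^ m) x =
     2 * real j * (real CARD('n) + 2 * real j - 2 + 2 * real m) * ((x \<bullet> x) ^ (j - 1) * (x \<bullet> y) ^ m)
     + real m * (real m - 1) * ((x \<bullet> x) ^ j * (x \<bullet> y) ^ (m - 2))"
proof -
  have yy: "(\<Sum>i\<in>UNIV. (y $ i)\<^sup>2) = 1" using y by (simp add: norm_eq_1 inner_vec_def power2_eq_square)
  have xx: "(\<Sum>i\<in>UNIV. (x $ i)\<^sup>2) = x \<bullet> x" by (simp add: inner_vec_def power2_eq_square)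
  have xy: "(\<Sum>i\<in>UNIV. x $ i * y $ i) = x \<bullet> y" by (simp add: inner_vec_def)
  have B: "(Basis :: (real^'n) set) = (\<lambda>i. axis i 1) ` UNIV"
    by (auto simp: Basis_vec_def)
  have "inj (\<lambda>i. axis i 1 :: real^'n)"
    by (auto simp: inj_on_def axis_eq_axis)
  then have "laplacian (\<lambda>x. (x \<bullet> x) ^ j * (x \<bullet> y) ^ m) x = (\<Sum>i\<in>UNIV.
      2 * real j * (x \<bullet> x) ^ (j - 1) * (x \<bullet> y) ^ m
      + 4 * real j * real (j - 1) * (x $ i)\<^sup>2 * (x \<bullet> x) ^ (j - 2) * (x \<bullet> y) ^ m
      + 4 * real j * real m * x $ i * y $ i * (x \<bullet> x) ^ (j - 1) * (x \<bullet> y) ^ (m - 1)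
      + real m * real (m - 1) * (y $ i)\<^sup>2 * (x \<bullet> x) ^ j * (x \<bullet> y) ^ (m - 2))"
    unfolding laplacian_def B by (subst sum.reindex) (auto simp: second_derivative_square_inner_power)
  also have "\<dots> = real CARD('n) * (2 * real j * (x \<bullet> x) ^ (j - 1) * (x \<bullet> y) ^ m)
      + 4 * real j * real (j - 1) * (\<Sum>i\<in>UNIV. (x $ i)\<^sup>2) * (x \<bullet> x) ^ (j - 2) * (x \<bullet> y) ^ m
      + 4 * real j * real m * (\<Sum>i\<in>UNIV. x $ i * y $ i) * (x \<bullet> x) ^ (j - 1) * (x \<bullet> y) ^ (m - 1)
      + real m * real (m - 1) * (\<Sum>i\<in>UNIV. (y $ i)\<^sup>2) * (x \<bullet> x) ^ j * (x \<bullet> y) ^ (m - 2)"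
    unfolding sum.distrib sum_distrib_left sum_distrib_right by (simp add: mult.assoc)
  also have "\<dots> = 2 * real j * (real CARD('n) + 2 * real j - 2 + 2 * real m) * ((x \<bullet> x) ^ (j - 1) * (x \<bullet> y) ^ m)
     + real m * (real m - 1) * ((x \<bullet> x) ^ j * (x \<bullet> y) ^ (m - 2))"
  proof -
    have 1: "real j * real (j - 1) * (x \<bullet> x) * (x \<bullet> x) ^ (j - 2) = real j * (real j - 1) * (x \<bullet> x) ^ (j - 1)"
    proof (cases "j \<ge> 2")
      case True
      then obtain k where "j = Suc (Suc k)" by (metis add_2_eq_Suc le_Suc_ex)
      then show ?thesis by simp
    next
      case False
      then have "j = 0 \<or> j = 1" by auto
      then show ?thesis by auto
    qed
    have 2: "real m * (x \<bullet> y) * (x \<bullet> y) ^ (m - 1) = real m * (x \<bullet> y) ^ m"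
      by (cases m) auto
    have 3: "real m * real (m - 1) = real m * (real m - 1)"
      by (cases m) auto
    have "4 * real j * real (j - 1) * (x \<bullet> x) * (x \<bullet> x) ^ (j - 2) * (x \<bullet> y) ^ m
        = 4 * (real j * real (j - 1) * (x \<bullet> x) * (x \<bullet> x) ^ (j - 2)) * (x \<bullet> y) ^ m"
      by (simp only: mult.assoc)
    moreover have "4 * real j * real m * (x \<bullet> y) * (x \<bullet> x) ^ (j - 1) * (x \<bullet> y) ^ (m - 1)
        = 4 * real j * (x \<bullet> x) ^ (j - 1) * (real m * (x \<bullet> y) * (x \<bullet> y) ^ (m - 1))"
      by (simp only: mult_ac)
    ultimately show ?thesis
      unfolding xx xy yy by (simp only: 1 2 3) (simp add: algebra_simps)
  qed
  finally show ?thesis .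
qed

lemma laplacian_sum_cmult:
  fixes f :: "nat \<Rightarrow> real^'n \<Rightarrow> real"
  assumes "\<And>j. real_polynomial_function (f j)" and A: "finite A"
  shows "laplacian (\<lambda>x. \<Sum>j\<in>A. c j * f j x) x = (\<Sum>j\<in>A. c j * laplacian (f j) x)"
proof -
  have *: "((\<lambda>t. \<Sum>j\<in>A. c j * g j (x + t *\<^sub>R axis i 1)) has_real_derivative
      (\<Sum>j\<in>A. c j * partial i (g j) (x + t *\<^sub>R axis i 1))) (at t)"
    if "\<And>j. real_polynomial_function (g j)" for g :: "nat \<Rightarrow> real^'n \<Rightarrow> real" and i t x
    by (intro DERIV_sum DERIV_cmult line_derivative_partial that)
  have p: "partial i (\<lambda>x. \<Sum>j\<in>A. c j * g j x) = (\<lambda>x. \<Sum>j\<in>A. c j * partial i (g j) x)"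
    if g: "\<And>j. real_polynomial_function (g j)" for g :: "nat \<Rightarrow> real^'n \<Rightarrow> real" and i
    using *[OF g, where t = 0] by (intro ext partialI) simp
  have P: "real_polynomial_function (\<lambda>x. \<Sum>j\<in>A. c j * f j x)"
    using A assms by (intro real_polynomial_function_sum real_polynomial_function.intros(2,4)) auto
  show ?thesis
    unfolding laplacian_eq_partial[OF P] laplacian_eq_partial[OF assms(1)]
      p[OF assms(1)] p[OF real_polynomial_function_partial[OF assms(1)]] sum_distrib_left
    by (rule sum.swap)
qed

lemma laplacian_solid_zonal:
  fixes x y :: "real^'n"
  assumes y: "y \<in> sphere 0 1" and n: "CARD('n) \<ge> 2"
  shows "laplacian (solid_zonal l y) x = 0"
proof -
  let ?c = "gegenbauer_coeff CARD('n) l" and ?n = "real CARD('n)"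
  let ?h = "\<lambda>j. l - 2 * j"
  let ?A = "\<lambda>j. ?c j * (2 * real j * (?n + 2 * real j - 2 + 2 * real (?h j)) * ((x \<bullet> x) ^ (j - 1) * (x \<bullet> y) ^ (?h j)))"
  let ?B = "\<lambda>j. ?c j * (real (?h j) * (real (?h j) - 1) * ((x \<bullet> x) ^ j * (x \<bullet> y) ^ (?h j - 2)))"
  have rp: "real_polynomial_function (\<lambda>x. (x \<bullet> x) ^ j * (x \<bullet> y) ^ (?h j))" for j
    by (intro real_polynomial_function.intros(4) real_polynomial_function_power real_polynomial_square real_polynomial_inner)
  have "laplacian (solid_zonal l y) x = (\<Sum>j\<le>l div 2. ?A j + ?B j)"
    unfolding solid_zonal_def[abs_def]
    by (subst laplacian_sum_cmult[OF rp]) (simp_all add: laplacian_square_inner_power[OF y] distrib_left)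
  also have "\<dots> = (\<Sum>j\<le>l div 2. ?A j) + (\<Sum>j\<le>l div 2. ?B j)" by (rule sum.distrib)
  also have "(\<Sum>j\<le>l div 2. ?A j) = (\<Sum>j<l div 2. ?A (Suc j))"
    by (subst sum.atMost_shift) simp
  also have "(\<Sum>j\<le>l div 2. ?B j) = (\<Sum>j<l div 2. ?B j)"
  proof -
    have "?B (l div 2) = 0"
    proof -
      have "?h (l div 2) = 0 \<or> ?h (l div 2) = 1" by presburger
      then show ?thesis by auto
    qed
    then show ?thesis by (simp add: sum.lessThan_Suc lessThan_Suc_atMost[symmetric])
  qed
  also have "(\<Sum>j<l div 2. ?A (Suc j)) + (\<Sum>j<l div 2. ?B j) = (\<Sum>j<l div 2. ?A (Suc j) + ?B j)"
    by (rule sum.distrib[symmetric])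
  also have "\<dots> = 0"
  proof (rule sum.neutral, rule ballI)
    fix j assume "j \<in> {..<l div 2}"
    then have j: "2 * j + 2 \<le> l" by auto
    then obtain k where l: "l = 2 * j + 2 + k" by (metis le_Suc_ex)
    have e: "?h j = k + 2" "?h (Suc j) = k" using l by auto
    have "?n + 2 * real l - 2 * real j - 4 = ?n + 2 * real j + 2 * real k" by (simp add: l)
    then have pos: "?n + 2 * real l - 2 * real j - 4 > 0" using n by simp
    have rl: "real l - 2 * real j = real k + 2" "real l - 2 * real j - 1 = real k + 1"
      "?n + 2 * real l - 2 * real j - 4 = ?n + 2 * real j + 2 * real k" by (simp_all add: l)
    have "?c (Suc j) * (2 * (real j + 1) * (?n + 2 * real j + 2 * real k)) = - ?c j * ((real k + 2) * (real k + 1))"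
      using pos unfolding gegenbauer_coeff.simps(2) rl by simp
    moreover have "?A (Suc j) = ?c (Suc j) * (2 * (real j + 1) * (?n + 2 * real j + 2 * real k)) * ((x \<bullet> x) ^ j * (x \<bullet> y) ^ k)"
    proof -
      have "?n + 2 * real (Suc j) - 2 + 2 * real k = ?n + 2 * real j + 2 * real k" "real (Suc j) = real j + 1"
        by simp_all
      then show ?thesis unfolding e by (simp only: diff_Suc_1 mult.assoc)
    qed
    moreover have "?B j = ?c j * ((real k + 2) * (real k + 1)) * ((x \<bullet> x) ^ j * (x \<bullet> y) ^ k)"
    proof -
      have "real (k + 2) - 1 = real k + 1" "real (k + 2) = real k + 2" by simp_all
      then show ?thesis unfolding e by (simp only: add_diff_cancel_right' mult.assoc)
    qed
    ultimately show "?A (Suc j) + ?B j = 0" by (simp only: minus_mult_left[symmetric] add.left_inverse mult_minus_left)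
  qed
  finally show ?thesis .
qed

lemma solid_zonal_harmonic:
  fixes y :: "real^'n"
  assumes "y \<in> sphere 0 1" "CARD('n) \<ge> 2"
  shows "solid_zonal l y \<in> harmonic_homogeneous_polynomials l"
  using assms unfolding harmonic_homogeneous_polynomials_def
  by (simp add: real_polynomial_solid_zonal solid_zonal_homogeneous laplacian_solid_zonal)

lemma gegenbauer_poly_leading: "coeff (gegenbauer_poly n l) l = 1" "degree (gegenbauer_poly n l) \<le> l"
proof -
  have "coeff (gegenbauer_poly n l) l = (\<Sum>j\<le>l div 2. if j = 0 then 1 else 0)"
    unfolding gegenbauer_poly_def coeff_sum by (intro sum.cong) auto
  then show "coeff (gegenbauer_poly n l) l = 1" by simp
  show "degree (gegenbauer_poly n l) \<le> l"
    unfolding gegenbauer_poly_def by (intro degree_sum_le) (auto intro: order_trans[OF degree_monom_le])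
qed

text \<open>The l-th polynomial has degree l and leading coefficient 1, so top coefficients can be removed one
after the other.\<close>

lemma gegenbauer_expansion:
  assumes "degree F \<le> k"
  shows "\<exists>a. F = (\<Sum>l\<le>k. smult (a l) (gegenbauer_poly n l))"
  using assms
proof (induction k arbitrary: F)
  case 0
  then obtain c where F: "F = [:c:]" using degree_eq_zeroE by blast
  have "gegenbauer_poly n 0 = 1" by (simp add: gegenbauer_poly_def monom_0)
  then show ?case using F by (intro exI[of _ "\<lambda>_. c"]) simp
next
  case (Suc k)
  let ?G = "gegenbauer_poly n (Suc k)"
  let ?H = "F - smult (coeff F (Suc k)) ?G"
  have "degree ?H \<le> Suc k"
    using Suc.prems gegenbauer_poly_leading(2)[of n "Suc k"]
    by (intro degree_diff_le order_trans[OF degree_smult_le]) auto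
  moreover have "coeff ?H (Suc k) = 0" by (simp add: gegenbauer_poly_leading)
  ultimately have "degree ?H \<le> k"
    by (metis coeff_eq_0 degree_le le_Suc_eq leading_coeff_0_iff degree_0 le0)
  from Suc.IH[OF this] obtain a where a: "?H = (\<Sum>l\<le>k. smult (a l) (gegenbauer_poly n l))" by blast
  let ?b = "a(Suc k := coeff F (Suc k))"
  have "F = ?H + smult (coeff F (Suc k)) ?G" by simp
  also have "\<dots> = (\<Sum>l\<le>Suc k. smult (?b l) (gegenbauer_poly n l))"
    unfolding a by (simp cong: sum.cong_simp)
  finally show ?case by blast
qed

section \<open>Spherical harmonics of one degree form a finite-dimensional space\<close>

text \<open>The Euler identity expresses P through its partial derivatives, which are homogeneous of one degree
less. Iteration yields products of l coordinates, indexed by words rather than by monomials; only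
the finiteness of the spanning family is of interest.\<close>

lemma homogeneous_polynomial_words:
  fixes P :: "real^'n \<Rightarrow> real"
  assumes "real_polynomial_function P" "\<And>c x. c > 0 \<Longrightarrow> P (c *\<^sub>R x) = c powr real l * P x"
  shows "\<exists>a. \<forall>x. P x = (\<Sum>w | length w = l. a w * prod_list (map (\<lambda>i. x $ i) w))"
  using assms
proof (induction l arbitrary: P)
  case 0
  have "P x = P 0" for x
  proof (rule tendsto_unique[of "at_right (0::real)"])
    have "isCont P (0 *\<^sub>R x)"
      using continuous_on_real_polynomial[OF 0(1), of UNIV] by (simp add: continuous_on_eq_continuous_at)
    then have "((\<lambda>c. P (c *\<^sub>R x)) \<longlongrightarrow> P (0 *\<^sub>R x)) (at_right 0)"
      by (rule isCont_tendsto_compose) (intro tendsto_intros)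
    moreover have "\<forall>\<^sub>F c in at_right 0. P (c *\<^sub>R x) = P x"
      using eventually_at_right_less[of 0] by eventually_elim (use 0(2) in simp)
    ultimately have "((\<lambda>c::real. P x) \<longlongrightarrow> P (0 *\<^sub>R x)) (at_right 0)"
      by (rule Lim_transform_eventually)
    then show "((\<lambda>c::real. P x) \<longlongrightarrow> P 0) (at_right 0)" by simp
  qed auto
  then show ?case by (intro exI[of _ "\<lambda>_. P 0"]) simp
next
  case (Suc l)
  have "\<exists>a. \<forall>x. partial i P x = (\<Sum>w | length w = l. a w * prod_list (map (\<lambda>i. x $ i) w))" for i
  proof (rule Suc.IH[OF real_polynomial_function_partial[OF Suc.prems(1)]])
    fix c :: real and x :: "real^'n" assume "c > 0"
    from partial_homogeneous[OF Suc.prems this, of i x]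
    show "partial i P (c *\<^sub>R x) = c powr real l * partial i P x" by simp
  qed
  then obtain a where a: "\<And>i x. partial i P x = (\<Sum>w | length w = l. a i w * prod_list (map (\<lambda>i. x $ i) w))"
    by metis
  let ?b = "\<lambda>w. a (hd w) (tl w) / real (Suc l)"
  have "P x = (\<Sum>w | length w = Suc l. ?b w * prod_list (map (\<lambda>i. x $ i) w))" for x
  proof -
    have W: "{w :: 'n list. length w = Suc l} = (\<lambda>(i, w). i # w) ` (UNIV \<times> {w. length w = l})"
      by (auto simp: length_Suc_conv image_iff)
    have "(\<Sum>w | length w = Suc l. ?b w * prod_list (map (\<lambda>i. x $ i) w))
        = (\<Sum>(i, w)\<in>UNIV \<times> {w. length w = l}. x $ i * (a i w * prod_list (map (\<lambda>i. x $ i) w)) / real (Suc l))"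
      unfolding W by (subst sum.reindex) (auto simp: inj_on_def split_def mult_ac intro!: sum.cong)
    also have "\<dots> = (\<Sum>i\<in>UNIV. x $ i * partial i P x) / real (Suc l)"
      by (simp add: a sum.cartesian_product[symmetric] sum_distrib_left sum_divide_distrib)
    also have "\<dots> = P x"
      using euler_identity[OF Suc.prems, of x] by (simp add: field_simps)
    finally show ?thesis by simp
  qed
  then show ?case by (intro exI[of _ ?b]) blast
qed

definition ip :: "('a::euclidean_space \<Rightarrow> real) \<Rightarrow> ('a \<Rightarrow> real) \<Rightarrow> real" where
  "ip f g = (\<integral>x. f x * g x \<partial>sphere_measure)"

definition orthonormal_functions :: "('a::euclidean_space \<Rightarrow> real) set \<Rightarrow> bool" where
  "orthonormal_functions E \<longleftrightarrow> (\<forall>e\<in>E. continuous_on (sphere 0 1) e) \<and> (\<forall>e\<in>E. \<forall>f\<in>E. ip e f = (if e = f then 1 else 0))"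

lemma ip_cong: "(\<And>x. x \<in> sphere 0 1 \<Longrightarrow> f x * g x = f' x * g' x) \<Longrightarrow> ip f g = ip f' g'"
  unfolding ip_def by (rule Bochner_Integration.integral_cong) auto

lemma ip_commute: "ip f g = ip g f"
  unfolding ip_def by (simp add: mult.commute)

lemma ip_sum_left:
  assumes "finite E" "\<And>e. e \<in> E \<Longrightarrow> continuous_on (sphere 0 1) (f e)" "continuous_on (sphere 0 1) g"
  shows "ip (\<lambda>x. \<Sum>e\<in>E. c e * f e x) g = (\<Sum>e\<in>E. c e * ip (f e) g)"
proof -
  have "ip (\<lambda>x. \<Sum>e\<in>E. c e * f e x) g = (\<integral>x. (\<Sum>e\<in>E. c e * (f e x * g x)) \<partial>sphere_measure)"
    unfolding ip_def by (simp add: sum_distrib_right mult.assoc)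
  also have "\<dots> = (\<Sum>e\<in>E. c e * ip (f e) g)"
    unfolding ip_def using assms
    by (subst Bochner_Integration.integral_sum) (auto intro!: integrable_sphere_continuous continuous_intros)
  finally show ?thesis .
qed

lemma ip_add_cmult_left:
  assumes "continuous_on (sphere 0 1) u" "continuous_on (sphere 0 1) v" "continuous_on (sphere 0 1) g"
  shows "ip (\<lambda>x. u x + c * v x) g = ip u g + c * ip v g"
proof -
  have "integrable sphere_measure (\<lambda>x. u x * g x)" "integrable sphere_measure (\<lambda>x. c * (v x * g x))"
    using assms by (auto intro!: integrable_sphere_continuous continuous_intros)
  from Bochner_Integration.integral_add[OF this] show ?thesis
    unfolding ip_def by (simp add: distrib_right mult.assoc)
qed

lemma orthonormal_coefficient:
  assumes E: "finite E" "orthonormal_functions E" and v: "\<And>x. x \<in> sphere 0 1 \<Longrightarrow> v x = (\<Sum>e\<in>E. c e * e x)"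
    and f: "f \<in> E"
  shows "c f = ip v f"
proof -
  have "ip v f = ip (\<lambda>x. \<Sum>e\<in>E. c e * e x) f" by (rule ip_cong) (simp add: v)
  also have "\<dots> = (\<Sum>e\<in>E. c e * ip e f)"
    using E f by (intro ip_sum_left) (auto simp: orthonormal_functions_def)
  also have "\<dots> = (\<Sum>e\<in>E. if e = f then c e else 0)"
    using E f by (intro sum.cong) (auto simp: orthonormal_functions_def)
  also have "\<dots> = c f" using E f by simp
  finally show ?thesis by simp
qed

lemma ip_self_eq_0:
  fixes v :: "real^'n \<Rightarrow> real"
  assumes "continuous_on (sphere 0 1) v" "ip v v = 0" "x \<in> sphere 0 1"
  shows "v x = 0"
  using integral_sphere_eq_0_imp[of "\<lambda>x. v x * v x" x] assms
  by (auto simp: ip_def intro!: continuous_intros)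

text \<open>Gram-Schmidt, by induction on the spanning family: either the last generator is superfluous, or one
normalised vector extends an orthonormal basis of the subspace spanned by the others.\<close>

lemma orthonormal_basis_exists:
  fixes V :: "(real^'n \<Rightarrow> real) set" and m :: "'w \<Rightarrow> real^'n \<Rightarrow> real"
  assumes "finite W" and m: "\<And>w. continuous_on (sphere 0 1) (m w)"
    and V: "\<And>u v c. u \<in> V \<Longrightarrow> v \<in> V \<Longrightarrow> (\<lambda>x. u x + c * v x) \<in> V"
      "\<And>v. v \<in> V \<Longrightarrow> \<exists>a. \<forall>x\<in>sphere 0 1. v x = (\<Sum>w\<in>W. a w * m w x)"
  shows "\<exists>E. finite E \<and> E \<subseteq> V \<and> orthonormal_functions E \<and>
    (\<forall>v\<in>V. \<exists>c. \<forall>x\<in>sphere 0 1. v x = (\<Sum>e\<in>E. c e * e x))"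
  using assms(1) V
proof (induction W arbitrary: V)
  case empty
  then show ?case by (intro exI[of _ "{}"]) (auto simp: orthonormal_functions_def)
next
  case (insert w W)
  note Vc = insert.prems(1) and Vs = insert.prems(2)
  define V' where "V' = {v \<in> V. \<exists>a. \<forall>x\<in>sphere 0 1. v x = (\<Sum>w\<in>W. a w * m w x)}"
  have V'c: "(\<lambda>x. u x + c * v x) \<in> V'" if uv: "u \<in> V'" "v \<in> V'" for u v c
  proof -
    obtain a where a: "\<And>x. x \<in> sphere 0 1 \<Longrightarrow> u x = (\<Sum>w\<in>W. a w * m w x)"
      using uv(1) unfolding V'_def by blast
    obtain b where b: "\<And>x. x \<in> sphere 0 1 \<Longrightarrow> v x = (\<Sum>w\<in>W. b w * m w x)"
      using uv(2) unfolding V'_def by blast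
    have "u x + c * v x = (\<Sum>w\<in>W. (a w + c * b w) * m w x)" if "x \<in> sphere 0 1" for x
      using a[OF that] b[OF that] by (simp add: sum.distrib sum_distrib_left distrib_right mult.assoc)
    moreover have "(\<lambda>x. u x + c * v x) \<in> V" using uv Vc unfolding V'_def by blast
    ultimately show ?thesis
      unfolding V'_def by (intro CollectI conjI exI[of _ "\<lambda>w. a w + c * b w"] ballI)
  qed
  have vc: "continuous_on (sphere 0 1) v" if "v \<in> V" for v
  proof -
    from Vs[OF that] obtain a where "\<forall>x\<in>sphere 0 1. v x = (\<Sum>w\<in>insert w W. a w * m w x)"
      by blast
    moreover have "continuous_on (sphere 0 1) (\<lambda>x. \<Sum>w\<in>insert w W. a w * m w x)"
      by (intro continuous_intros m)
    ultimately show ?thesis by (subst continuous_on_cong[OF refl]) auto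
  qed
  have "\<exists>E. finite E \<and> E \<subseteq> V' \<and> orthonormal_functions E \<and>
    (\<forall>v\<in>V'. \<exists>c. \<forall>x\<in>sphere 0 1. v x = (\<Sum>e\<in>E. c e * e x))"
    by (rule insert.IH[OF V'c]) (auto simp: V'_def)
  then obtain E where E: "finite E" "E \<subseteq> V'" "orthonormal_functions E"
    "\<And>v. v \<in> V' \<Longrightarrow> \<exists>c. \<forall>x\<in>sphere 0 1. v x = (\<Sum>e\<in>E. c e * e x)" by blast
  have V'V: "V' \<subseteq> V" by (auto simp: V'_def)
  show ?case
  proof (cases "V \<subseteq> V'")
    case True
    then show ?thesis using E V'V by (intro exI[of _ E]) auto
  next
    case False
    then obtain v0 where v0: "v0 \<in> V" "v0 \<notin> V'" by blast
    have Vsum: "(\<lambda>x. v x + (\<Sum>e\<in>F. c e * e x)) \<in> V" if "finite F" "F \<subseteq> V" "v \<in> V" for F c v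
      using that
    proof (induction F)
      case (insert e F)
      have "(\<lambda>x. (v x + (\<Sum>e\<in>F. c e * e x)) + c e * e x) \<in> V"
        using insert by (intro Vc) auto
      then show ?case using insert.hyps by (simp add: add_ac)
    qed simp
    have V'sum: "(\<lambda>x. v x + (\<Sum>e\<in>F. c e * e x)) \<in> V'" if "finite F" "F \<subseteq> V'" "v \<in> V'" for F c v
      using that
    proof (induction F)
      case (insert e F)
      have "(\<lambda>x. (v x + (\<Sum>e\<in>F. c e * e x)) + c e * e x) \<in> V'"
        using insert by (intro V'c) auto
      then show ?case using insert.hyps by (simp add: add_ac)
    qed simp
    have zero: "(\<lambda>x. 0) \<in> V"
      using Vc[OF v0(1) v0(1), of "-1"] by simp
    define v1 where "v1 = (\<lambda>x. v0 x + (\<Sum>e\<in>E. - ip v0 e * e x))"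
    have v1: "v1 \<in> V" unfolding v1_def using E V'V v0 by (intro Vsum) auto
    have v1': "v1 \<notin> V'"
    proof
      assume "v1 \<in> V'"
      then have "(\<lambda>x. v1 x + (\<Sum>e\<in>E. ip v0 e * e x)) \<in> V'" using E by (intro V'sum) auto
      then show False using v0 by (simp add: v1_def sum_negf)
    qed
    have v1E: "ip v1 f = 0" if "f \<in> E" for f
    proof -
      have fc: "continuous_on (sphere 0 1) f" using that E by (auto simp: orthonormal_functions_def)
      have ec: "continuous_on (sphere 0 1) e" if "e \<in> E" for e using that E by (auto simp: orthonormal_functions_def)
      have "ip v1 f = ip (\<lambda>x. v0 x + 1 * (\<Sum>e\<in>E. - ip v0 e * e x)) f" by (simp add: v1_def)
      also have "\<dots> = ip v0 f + 1 * ip (\<lambda>x. \<Sum>e\<in>E. - ip v0 e * e x) f"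
        by (intro ip_add_cmult_left fc vc v0 continuous_intros ec)
      also have "ip (\<lambda>x. \<Sum>e\<in>E. - ip v0 e * e x) f = (\<Sum>e\<in>E. - ip v0 e * ip e f)"
        by (intro ip_sum_left E ec fc)
      also have "\<dots> = (\<Sum>e\<in>E. if e = f then - ip v0 e else 0)"
        using E that by (intro sum.cong) (auto simp: orthonormal_functions_def)
      also have "\<dots> = - ip v0 f" using E that by simp
      finally show ?thesis by simp
    qed
    have n: "ip v1 v1 > 0"
    proof -
      have "ip v1 v1 \<ge> 0" unfolding ip_def by simp
      moreover have "ip v1 v1 \<noteq> 0"
      proof
        assume "ip v1 v1 = 0"
        then have "v1 x = 0" if "x \<in> sphere 0 1" for x
          using ip_self_eq_0[OF vc[OF v1]] that by blast
        then have "v1 \<in> V'" using v1 by (auto simp: V'_def intro!: exI[of _ "\<lambda>_. 0"])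
        then show False using v1' by blast
      qed
      ultimately show ?thesis by simp
    qed
    define s where "s = 1 / sqrt (ip v1 v1)"
    have s: "s \<noteq> 0" "s * s * ip v1 v1 = 1" using n by (auto simp: s_def field_simps)
    define v2 where "v2 = (\<lambda>x. 0 + s * v1 x)"
    have v2: "v2 \<in> V" unfolding v2_def by (rule Vc[OF zero v1])
    have ipv2: "ip v2 f = s * ip v1 f" if "continuous_on (sphere 0 1) f" for f
      unfolding v2_def by (subst ip_add_cmult_left[OF _ vc[OF v1] that]) (auto simp: ip_def)
    have v22: "ip v2 v2 = 1"
      using ipv2[OF vc[OF v2]] ipv2[OF vc[OF v1]] s by (simp add: ip_commute[of v1 v2])
    have v2E: "ip v2 e = 0" if "e \<in> E" for e
      using ipv2[OF vc, of e] v1E[OF that] that E V'V by auto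
    have v2': "v2 \<notin> V'"
    proof
      assume a: "v2 \<in> V'"
      have z: "(\<lambda>x. 0) \<in> V'" using V'c[OF a a, of "-1"] by simp
      have "(\<lambda>x. 0 + (1 / s) * v2 x) \<in> V'" by (rule V'c[OF z a])
      then show False using v1' s by (simp add: v2_def)
    qed
    then have v2nE: "v2 \<notin> E" using E by auto
    have Ev2: "ip e v2 = 0" if "e \<in> E" for e
      unfolding ip_commute[of e v2] by (rule v2E[OF that])
    have on: "orthonormal_functions (insert v2 E)"
      using E(3) v22 v2E Ev2 vc[OF v2] v2nE by (auto simp: orthonormal_functions_def)
    have rep: "\<exists>c. \<forall>x\<in>sphere 0 1. v x = (\<Sum>e\<in>insert v2 E. c e * e x)" if v: "v \<in> V" for v
    proof -
      obtain a where a: "\<And>x. x \<in> sphere 0 1 \<Longrightarrow> v x = a w * m w x + (\<Sum>w\<in>W. a w * m w x)"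
        using Vs[OF v] insert.hyps by auto
      obtain b where b: "\<And>x. x \<in> sphere 0 1 \<Longrightarrow> v2 x = b w * m w x + (\<Sum>w\<in>W. b w * m w x)"
        using Vs[OF v2] insert.hyps by auto
      have bw: "b w \<noteq> 0"
      proof
        assume "b w = 0"
        then have "v2 x = (\<Sum>w\<in>W. b w * m w x)" if "x \<in> sphere 0 1" for x
          using b[OF that] by simp
        then have "v2 \<in> V'" using v2 unfolding V'_def by blast
        then show False using v2' by blast
      qed
      let ?t = "a w / b w"
      have "(\<lambda>x. v x + (- ?t) * v2 x) \<in> V" by (rule Vc[OF v v2])
      moreover have "v x + (- ?t) * v2 x = (\<Sum>w\<in>W. (a w - ?t * b w) * m w x)" if "x \<in> sphere 0 1" for x
        using a[OF that] b[OF that] bw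
        by (simp add: sum_subtractf left_diff_distrib sum_distrib_left distrib_left mult.assoc sum_negf)
      ultimately have "(\<lambda>x. v x + (- ?t) * v2 x) \<in> V'"
        unfolding V'_def by (intro CollectI conjI exI[of _ "\<lambda>w. a w - ?t * b w"] ballI)
      from E(4)[OF this] obtain c where c: "\<And>x. x \<in> sphere 0 1 \<Longrightarrow> v x + (- ?t) * v2 x = (\<Sum>e\<in>E. c e * e x)" by blast
      have "v x = (\<Sum>e\<in>insert v2 E. (c(v2 := ?t)) e * e x)" if "x \<in> sphere 0 1" for x
      proof -
        have "(\<Sum>e\<in>E. (c(v2 := ?t)) e * e x) = (\<Sum>e\<in>E. c e * e x)"
          using v2nE by (intro sum.cong) auto
        then show ?thesis using c[OF that] v2nE E(1) by simp
      qed
      then show ?thesis by blast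
    qed
    show ?thesis
      using E(1,2) V'V v2 on rep by (intro exI[of _ "insert v2 E"]) auto
  qed
qed

lemma partial_add_cmult:
  assumes "real_polynomial_function P" "real_polynomial_function Q"
  shows "partial k (\<lambda>x. P x + c * Q x) = (\<lambda>x. partial k P x + c * partial k Q x)"
  by (intro ext partialI)
     (use DERIV_add[OF line_derivative_partial[OF assms(1)] DERIV_cmult[OF line_derivative_partial[OF assms(2)]], where x = 0] in simp)

lemma harmonic_add_cmult:
  fixes u v :: "real^'n \<Rightarrow> real"
  assumes u: "u \<in> harmonic_homogeneous_polynomials l" and v: "v \<in> harmonic_homogeneous_polynomials l"
  shows "(\<lambda>x. u x + c * v x) \<in> harmonic_homogeneous_polynomials l"
proof -
  have p: "real_polynomial_function u" "real_polynomial_function v"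
    using assms by (auto simp: harmonic_homogeneous_polynomials_def)
  have P: "real_polynomial_function (\<lambda>x. u x + c * v x)"
    using p by (intro real_polynomial_function.intros(2,3,4))
  have "laplacian (\<lambda>x. u x + c * v x) x = laplacian u x + c * laplacian v x" for x
    unfolding laplacian_eq_partial[OF P] laplacian_eq_partial[OF p(1)] laplacian_eq_partial[OF p(2)]
      partial_add_cmult[OF p] partial_add_cmult[OF real_polynomial_function_partial[OF p(1)] real_polynomial_function_partial[OF p(2)]]
    by (simp add: sum.distrib sum_distrib_left)
  then show ?thesis using assms P
    by (auto simp: harmonic_homogeneous_polynomials_def algebra_simps)
qed

lemma harmonic_zero: "(\<lambda>x::real^'n. 0) \<in> harmonic_homogeneous_polynomials l"
proof -
  have "real_polynomial_function (\<lambda>x::real^'n. 0)" by (rule real_polynomial_function.intros(2))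
  moreover have "laplacian (\<lambda>x::real^'n. 0) x = 0" for x
    by (simp add: laplacian_def)
  ultimately show ?thesis by (simp add: harmonic_homogeneous_polynomials_def)
qed

lemma harmonic_sum:
  fixes f :: "'b \<Rightarrow> real^'n \<Rightarrow> real"
  assumes "finite A" "\<And>i. i \<in> A \<Longrightarrow> f i \<in> harmonic_homogeneous_polynomials l"
  shows "(\<lambda>x. \<Sum>i\<in>A. c i * f i x) \<in> harmonic_homogeneous_polynomials l"
  using assms
proof (induction A)
  case empty then show ?case using harmonic_zero by simp
next
  case (insert i A)
  have "(\<lambda>x. (\<Sum>i\<in>A. c i * f i x) + c i * f i x) \<in> harmonic_homogeneous_polynomials l"
    using insert by (intro harmonic_add_cmult) auto
  then show ?case using insert.hyps by (simp add: add_ac)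
qed

lemma harmonic_continuous:
  fixes P :: "real^'n \<Rightarrow> real"
  shows "P \<in> harmonic_homogeneous_polynomials l \<Longrightarrow> continuous_on S P"
  by (intro continuous_on_real_polynomial harmonic_homogeneousD)

lemma harmonic_basis_exists:
  "\<exists>E. finite E \<and> E \<subseteq> harmonic_homogeneous_polynomials l \<and> orthonormal_functions E \<and>
    (\<forall>v\<in>harmonic_homogeneous_polynomials l. \<forall>x\<in>sphere 0 1. v x = (\<Sum>e\<in>E. ip v e * e (x::real^'n)))"
proof -
  let ?m = "\<lambda>w (x::real^'n). prod_list (map (\<lambda>i. x $ i) w)"
  have m: "continuous_on (sphere 0 1) (?m w)" for w
    by (induction w) (auto intro!: continuous_intros)
  have fin: "finite {w :: 'n list. length w = l}"
    using finite_lists_length_eq[of "UNIV :: 'n set" l] by simp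
  have sp: "\<exists>a. \<forall>x\<in>sphere 0 1. v x = (\<Sum>w\<in>{w. length w = l}. a w * ?m w x)"
    if "v \<in> harmonic_homogeneous_polynomials l" for v :: "real^'n \<Rightarrow> real"
    using homogeneous_polynomial_words[OF harmonic_homogeneousD(1,2)[OF that]] by blast
  from orthonormal_basis_exists[where V = "harmonic_homogeneous_polynomials l" and W = "{w :: 'n list. length w = l}" and m = ?m, OF fin m harmonic_add_cmult sp]
  obtain E where E: "finite E" "E \<subseteq> harmonic_homogeneous_polynomials l" "orthonormal_functions E"
    "\<And>v::real^'n \<Rightarrow> real. v \<in> harmonic_homogeneous_polynomials l \<Longrightarrow> \<exists>c. \<forall>x\<in>sphere 0 1. v x = (\<Sum>e\<in>E. c e * e x)"
    by blast
  have "v x = (\<Sum>e\<in>E. ip v e * e x)" if v: "v \<in> harmonic_homogeneous_polynomials l" and x: "x \<in> sphere 0 1" for v :: "real^'n \<Rightarrow> real" and x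
  proof -
    obtain c where c: "\<And>x. x \<in> sphere 0 1 \<Longrightarrow> v x = (\<Sum>e\<in>E. c e * e x)" using E(4)[OF v] by blast
    have "v x = (\<Sum>e\<in>E. c e * e x)" by (rule c[OF x])
    also have "\<dots> = (\<Sum>e\<in>E. ip v e * e x)"
      by (intro sum.cong refl arg_cong2[where f="(*)"] orthonormal_coefficient[OF E(1,3) c])
    finally show ?thesis .
  qed
  then show ?thesis using E(1,2,3) by blast
qed

section \<open>The zonal kernel and harmonic projections\<close>

text \<open>For an orthonormal basis E of the harmonics of degree l, the kernel \<Sum> e(x) e(y) reproduces, and two
reproducing kernels differ by a harmonic that is orthogonal to itself. Thus the definite
description of the kernel denotes this function.\<close>

lemma zonal_kernel_eq:
  fixes x :: "real^'n"
  assumes E: "finite E" "E \<subseteq> harmonic_homogeneous_polynomials l" "orthonormal_functions E"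
    and rep: "\<And>v x. v \<in> harmonic_homogeneous_polynomials l \<Longrightarrow> x \<in> sphere 0 1 \<Longrightarrow> v x = (\<Sum>e\<in>E. ip v e * e (x::real^'n))"
    and x: "x \<in> sphere 0 1"
  shows "zonal_kernel l x = restrict (\<lambda>y. \<Sum>e\<in>E. e x * e y) (sphere 0 1)"
proof -
  let ?H = "harmonic_homogeneous_polynomials l :: (real^'n \<Rightarrow> real) set"
  define K where "K = (\<lambda>y. \<Sum>e\<in>E. e x * e y)"
  have K: "K \<in> ?H" unfolding K_def using E by (intro harmonic_sum) auto
  have ec: "continuous_on (sphere 0 1) e" if "e \<in> E" for e
    using that E by (auto simp: orthonormal_functions_def)
  have repr: "v x = ip v K" if v: "v \<in> ?H" for v
  proof -
    have "ip K v = (\<Sum>e\<in>E. e x * ip e v)"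
      unfolding K_def by (rule ip_sum_left[OF E(1) ec harmonic_continuous[OF v]])
    also have "\<dots> = (\<Sum>e\<in>E. ip v e * e x)"
      by (intro sum.cong refl) (simp add: ip_commute[of v] mult.commute)
    also have "\<dots> = v x" by (rule rep[OF v x, symmetric])
    finally show ?thesis by (simp add: ip_commute[of v])
  qed
  have res: "(\<integral>y. restrict P (sphere 0 1) y * restrict Q (sphere 0 1) y \<partial>sphere_measure) = ip P Q"
    for P Q :: "real^'n \<Rightarrow> real"
    unfolding ip_def by (rule Bochner_Integration.integral_cong) auto
  show ?thesis
    unfolding zonal_kernel_def K_def[symmetric]
  proof (rule the_equality)
    show "restrict K (sphere 0 1) \<in> spherical_harmonics l \<and>
        (\<forall>h\<in>spherical_harmonics l. h x = (\<integral>y. h y * restrict K (sphere 0 1) y \<partial>sphere_measure))"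
    proof
      show "restrict K (sphere 0 1) \<in> spherical_harmonics l"
        using K unfolding spherical_harmonics_def by blast
      show "\<forall>h\<in>spherical_harmonics l. h x = (\<integral>y. h y * restrict K (sphere 0 1) y \<partial>sphere_measure)"
      proof
        fix h :: "real^'n \<Rightarrow> real" assume "h \<in> spherical_harmonics l"
        then obtain P where P: "P \<in> ?H" "h = restrict P (sphere 0 1)" unfolding spherical_harmonics_def by blast
        have "h x = ip P K" using repr[OF P(1)] x unfolding P(2) by simp
        then show "h x = (\<integral>y. h y * restrict K (sphere 0 1) y \<partial>sphere_measure)"
          unfolding P(2) res .
      qed
    qed
  next
    fix k assume k: "k \<in> spherical_harmonics l \<and>
        (\<forall>h\<in>spherical_harmonics l. h x = (\<integral>y. h y * k y \<partial>sphere_measure))"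
    then obtain Q where Q: "Q \<in> ?H" "k = restrict Q (sphere 0 1)"
      by (auto simp: spherical_harmonics_def)
    let ?D = "\<lambda>y. Q y + (- 1) * K y"
    have D: "?D \<in> ?H" by (rule harmonic_add_cmult[OF Q(1) K])
    have "ip ?D Q = ?D x"
    proof -
      have "restrict ?D (sphere 0 1) \<in> spherical_harmonics l" using D by (auto simp: spherical_harmonics_def)
      with k have "restrict ?D (sphere 0 1) x = (\<integral>y. restrict ?D (sphere 0 1) y * k y \<partial>sphere_measure)" by blast
      then show ?thesis using x unfolding Q(2) res by simp
    qed
    also have "\<dots> = ip ?D K" by (rule repr[OF D])
    finally have "ip Q ?D + (-1) * ip K ?D = 0"
      unfolding ip_commute[of Q ?D] ip_commute[of K ?D] by linarith
    then have "ip ?D ?D = 0"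
      by (subst ip_add_cmult_left[OF harmonic_continuous[OF Q(1)] harmonic_continuous[OF K] harmonic_continuous[OF D]])
    then have "?D y = 0" if "y \<in> sphere 0 1" for y
      using ip_self_eq_0[OF harmonic_continuous[OF D]] that by blast
    then show "k = restrict K (sphere 0 1)" unfolding Q(2) by (intro restrict_ext) simp
  qed
qed

lemma integrable_mult_sphere_continuous:
  fixes f g :: "real^'n \<Rightarrow> real"
  assumes f: "integrable sphere_measure f" and g: "continuous_on (sphere 0 1) g"
  shows "integrable sphere_measure (\<lambda>x. f x * g x)"
proof -
  obtain B where B: "\<And>x. x \<in> sphere 0 1 \<Longrightarrow> \<bar>g x\<bar> \<le> B"
    using continuous_on_sphere_bounded[OF g] by blast
  show ?thesis
  proof (rule Bochner_Integration.integrable_bound[of _ "\<lambda>x. B * f x"])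
    show "integrable sphere_measure (\<lambda>x. B * f x)" using f by simp
    show "(\<lambda>x. f x * g x) \<in> borel_measurable sphere_measure"
      using f borel_measurable_sphere_continuous[OF g] by auto
    show "AE x in sphere_measure. norm (f x * g x) \<le> norm (B * f x)"
    proof (rule AE_I2)
      fix x :: "real^'n" assume "x \<in> space sphere_measure"
      then have "\<bar>g x\<bar> \<le> \<bar>B\<bar>" using B[of x] by auto
      then show "norm (f x * g x) \<le> norm (B * f x)"
        by (simp add: abs_mult mult.commute[of "\<bar>f x\<bar>"] mult_right_mono)
    qed
  qed
qed

lemma harmonic_proj_eq:
  fixes f :: "real^'n \<Rightarrow> real"
  assumes E: "finite E" "E \<subseteq> harmonic_homogeneous_polynomials l" "orthonormal_functions E"
    and rep: "\<And>v x. v \<in> harmonic_homogeneous_polynomials l \<Longrightarrow> x \<in> sphere 0 1 \<Longrightarrow> v x = (\<Sum>e\<in>E. ip v e * e (x::real^'n))"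
    and x: "x \<in> sphere 0 1" and f: "integrable sphere_measure f"
  shows "harmonic_proj l f x = (\<Sum>e\<in>E. ip f e * e x)"
proof -
  have ec: "continuous_on (sphere 0 1) e" if "e \<in> E" for e
    using that E by (auto simp: orthonormal_functions_def)
  have zk: "zonal_kernel l x = restrict (\<lambda>y. \<Sum>e\<in>E. e x * e y) (sphere 0 1)"
    by (rule zonal_kernel_eq[OF E _ x]) (rule rep)
  have "harmonic_proj l f x = (\<integral>y. (\<Sum>e\<in>E. e x * (f y * e y)) \<partial>sphere_measure)"
    unfolding harmonic_proj_def zk
    by (rule Bochner_Integration.integral_cong) (auto simp: sum_distrib_left mult_ac)
  also have "\<dots> = (\<Sum>e\<in>E. e x * ip f e)"
    unfolding ip_def
    by (subst Bochner_Integration.integral_sum) (auto intro!: integrable_mult_sphere_continuous[OF f ec])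
  finally show ?thesis by (simp add: mult.commute)
qed

text \<open>A vanishing projection means that the combination of the orthonormal basis functions with
coefficients \<integral> u e vanishes, hence so do the coefficients.\<close>

lemma harmonic_proj_0_imp_orthogonal:
  fixes u :: "real^'n \<Rightarrow> real"
  assumes u: "integrable sphere_measure u" and 0: "\<And>x. x \<in> sphere 0 1 \<Longrightarrow> harmonic_proj l u x = 0"
    and h: "h \<in> harmonic_homogeneous_polynomials l"
  shows "ip u h = 0"
proof -
  obtain E where E: "finite E" "E \<subseteq> harmonic_homogeneous_polynomials l" "orthonormal_functions E"
    and rep: "\<And>v x. v \<in> harmonic_homogeneous_polynomials l \<Longrightarrow> x \<in> sphere 0 1 \<Longrightarrow> v x = (\<Sum>e\<in>E. ip v e * e (x::real^'n))"
    using harmonic_basis_exists[where 'n='n, of l] by blast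
  have ec: "continuous_on (sphere 0 1) e" if "e \<in> E" for e
    using that E by (auto simp: orthonormal_functions_def)
  have ue: "ip u e = 0" if "e \<in> E" for e
  proof -
    have "ip u e = ip (\<lambda>x. 0) e"
    proof (rule orthonormal_coefficient[OF E(1,3) _ that])
      fix x :: "real^'n" assume x: "x \<in> sphere 0 1"
      show "0 = (\<Sum>e\<in>E. ip u e * e x)"
        using 0[OF x] harmonic_proj_eq[OF E _ x u] rep by simp
    qed
    then show ?thesis by (simp add: ip_def)
  qed
  have "ip u h = (\<integral>x. (\<Sum>e\<in>E. ip h e * (u x * e x)) \<partial>sphere_measure)"
    unfolding ip_def[of u] by (rule Bochner_Integration.integral_cong) (auto simp: rep[OF h] sum_distrib_left mult_ac)
  also have "\<dots> = (\<Sum>e\<in>E. ip h e * ip u e)"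
    unfolding ip_def[of u]
    by (subst Bochner_Integration.integral_sum) (auto intro!: integrable_mult_sphere_continuous[OF u ec])
  also have "\<dots> = 0" using ue by simp
  finally show ?thesis .
qed

text \<open>By the form of the kernel, the condition on projections may be tested against single harmonics.\<close>

lemma is_bessel_derivativeI:
  fixes f g :: "real^'n \<Rightarrow> real"
  assumes f: "integrable sphere_measure f" and g: "integrable sphere_measure g"
    and *: "\<And>l h. h \<in> harmonic_homogeneous_polynomials l \<Longrightarrow>
       ip g h = (1 + laplace_beltrami_eigenvalue (CARD('n) - 1) l) powr (s / 2) * ip f h"
  shows "is_bessel_derivative s f g"
  unfolding is_bessel_derivative_def
proof (intro allI ballI)
  fix l and x :: "real^'n" assume x: "x \<in> sphere 0 1"
  obtain E where E: "finite E" "E \<subseteq> harmonic_homogeneous_polynomials l" "orthonormal_functions E"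
    and rep: "\<And>v x. v \<in> harmonic_homogeneous_polynomials l \<Longrightarrow> x \<in> sphere 0 1 \<Longrightarrow> v x = (\<Sum>e\<in>E. ip v e * e (x::real^'n))"
    using harmonic_basis_exists[where 'n='n, of l] by blast
  have "harmonic_proj l g x = (\<Sum>e\<in>E. ip g e * e x)" by (rule harmonic_proj_eq[OF E _ x g]) (rule rep)
  also have "\<dots> = (\<Sum>e\<in>E. (1 + laplace_beltrami_eigenvalue (CARD('n) - 1) l) powr (s / 2) * (ip f e * e x))"
    using E(2) * by (intro sum.cong refl) (simp add: subset_iff)
  also have "\<dots> = (1 + laplace_beltrami_eigenvalue (CARD('n) - 1) l) powr (s / 2) * harmonic_proj l f x"
  proof -
    have "harmonic_proj l f x = (\<Sum>e\<in>E. ip f e * e x)" by (rule harmonic_proj_eq[OF E _ x f]) (rule rep)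
    then show ?thesis by (simp add: sum_distrib_left)
  qed
  finally show "harmonic_proj l g x =
        (1 + laplace_beltrami_eigenvalue (DIM(real^'n) - 1) l) powr (s / 2) * harmonic_proj l f x"
    by simp
qed

section \<open>Integrable functions are determined by their harmonic projections\<close>

text \<open>For y on the sphere (x \<bullet> y)^k is a combination of zonal harmonics; other vectors are multiples of
such y.\<close>

lemma ip_inner_power_0:
  fixes u :: "real^'n \<Rightarrow> real"
  assumes u: "integrable sphere_measure u" and n: "CARD('n) \<ge> 2"
    and 0: "\<And>l h. h \<in> harmonic_homogeneous_polynomials l \<Longrightarrow> ip u h = 0"
  shows "(\<integral>x. u x * (x \<bullet> z) ^ k \<partial>sphere_measure) = 0"
proof -
  have sph: "(\<integral>x. u x * (x \<bullet> y) ^ k \<partial>sphere_measure) = 0" if y: "y \<in> sphere 0 1" for y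
  proof -
    obtain a where a: "monom 1 k = (\<Sum>l\<le>k. smult (a l) (gegenbauer_poly CARD('n) l))"
      using gegenbauer_expansion[of "monom 1 k" k "CARD('n)"] degree_monom_le by blast
    have e: "(x \<bullet> y) ^ k = (\<Sum>l\<le>k. a l * solid_zonal l y x)" if "x \<in> sphere 0 1" for x
    proof -
      have "(x \<bullet> y) ^ k = poly (monom 1 k) (x \<bullet> y)" by (simp add: poly_monom)
      also have "\<dots> = (\<Sum>l\<le>k. a l * solid_zonal l y x)"
        unfolding a by (simp add: poly_sum solid_zonal_on_sphere[OF that] zonal_def)
      finally show ?thesis .
    qed
    have "(\<integral>x. u x * (x \<bullet> y) ^ k \<partial>sphere_measure) = (\<integral>x. (\<Sum>l\<le>k. a l * (u x * solid_zonal l y x)) \<partial>sphere_measure)"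
      by (rule Bochner_Integration.integral_cong) (auto simp: e sum_distrib_left mult_ac)
    also have "\<dots> = (\<Sum>l\<le>k. a l * ip u (solid_zonal l y))"
      unfolding ip_def
      by (subst Bochner_Integration.integral_sum)
         (auto intro!: integrable_mult_sphere_continuous[OF u] continuous_on_real_polynomial real_polynomial_solid_zonal)
    also have "\<dots> = 0" using 0[OF solid_zonal_harmonic[OF y n]] by simp
    finally show ?thesis .
  qed
  fix i :: 'n
  have ax: "axis i 1 \<in> sphere (0::real^'n) 1" by (simp add: norm_axis_1)
  show ?thesis
  proof (cases "z = 0")
    case True
    then show ?thesis using sph[OF ax] by (cases k) auto
  next
    case False
    then have "z /\<^sub>R norm z \<in> sphere 0 1" by simp
    from sph[OF this] have "(\<integral>x. u x * (x \<bullet> (z /\<^sub>R norm z)) ^ k \<partial>sphere_measure) = 0" .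
    moreover have "u x * (x \<bullet> (z /\<^sub>R norm z)) ^ k = (1 / norm z) ^ k * (u x * (x \<bullet> z) ^ k)" for x
      unfolding inner_scaleR_right power_mult_distrib by (simp add: inverse_eq_divide)
    ultimately have "(1 / norm z) ^ k * (\<integral>x. u x * (x \<bullet> z) ^ k \<partial>sphere_measure) = 0"
      by (simp only: integral_mult_right_zero)
    then show ?thesis using False by simp
  qed
qed

lemma integral_exp_inner_0:
  fixes u :: "real^'n \<Rightarrow> real"
  assumes u: "integrable sphere_measure u"
    and 0: "\<And>k. (\<integral>x. u x * (x \<bullet> z) ^ k \<partial>sphere_measure) = 0"
  shows "(\<integral>x. u x * exp (x \<bullet> z) \<partial>sphere_measure) = 0"
proof -
  let ?s = "\<lambda>K x. u x * (\<Sum>k<K. (x \<bullet> z) ^ k /\<^sub>R fact k)"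
  have i: "integrable sphere_measure (\<lambda>x. u x * (x \<bullet> z) ^ k)" for k
    by (intro integrable_mult_sphere_continuous[OF u] continuous_intros)
  have "(\<lambda>K. \<integral>x. ?s K x \<partial>sphere_measure) \<longlonglongrightarrow> (\<integral>x. u x * exp (x \<bullet> z) \<partial>sphere_measure)"
  proof (rule integral_dominated_convergence)
    show "(\<lambda>x. u x * exp (x \<bullet> z)) \<in> borel_measurable sphere_measure"
      by (rule borel_measurable_integrable[OF integrable_mult_sphere_continuous[OF u]]) (intro continuous_intros)
    show "?s K \<in> borel_measurable sphere_measure" for K
      by (rule borel_measurable_integrable[OF integrable_mult_sphere_continuous[OF u]]) (intro continuous_intros)
    show "integrable sphere_measure (\<lambda>x. exp (norm z) * \<bar>u x\<bar>)" using u by simp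
    show "AE x in sphere_measure. (\<lambda>K. ?s K x) \<longlonglongrightarrow> u x * exp (x \<bullet> z)"
      by (intro AE_I2 tendsto_mult tendsto_const exp_converges[unfolded sums_def])
    show "AE x in sphere_measure. norm (?s K x) \<le> exp (norm z) * \<bar>u x\<bar>" for K
    proof (rule AE_I2)
      fix x :: "real^'n" assume x: "x \<in> space sphere_measure"
      have xz: "\<bar>x \<bullet> z\<bar> \<le> norm z" using Cauchy_Schwarz_ineq2[of x z] x by simp
      have "\<bar>\<Sum>k<K. (x \<bullet> z) ^ k /\<^sub>R fact k\<bar> \<le> (\<Sum>k<K. \<bar>(x \<bullet> z) ^ k /\<^sub>R fact k\<bar>)" by (rule sum_abs)
      also have "\<dots> \<le> (\<Sum>k<K. norm z ^ k /\<^sub>R fact k)"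
        using xz by (intro sum_mono) (auto simp: abs_mult power_abs intro!: mult_left_mono power_mono)
      also have "\<dots> \<le> exp (norm z)"
        using exp_converges[of "norm z"]
        by (subst sums_unique[OF exp_converges]) (intro sum_le_suminf, auto simp: sums_iff)
      finally show "norm (?s K x) \<le> exp (norm z) * \<bar>u x\<bar>"
        unfolding real_norm_def abs_mult mult.commute[of "exp (norm z)"]
        by (intro mult_left_mono) auto
    qed
  qed
  moreover have "(\<integral>x. ?s K x \<partial>sphere_measure) = 0" for K
  proof -
    have "(\<integral>x. ?s K x \<partial>sphere_measure) = (\<integral>x. (\<Sum>k<K. (1 / fact k) * (u x * (x \<bullet> z) ^ k)) \<partial>sphere_measure)"
      by (simp add: sum_distrib_left divide_inverse mult_ac)
    also have "\<dots> = (\<Sum>k<K. (1 / fact k) * (\<integral>x. u x * (x \<bullet> z) ^ k \<partial>sphere_measure))"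
      using i by (subst Bochner_Integration.integral_sum) auto
    finally show ?thesis using 0 by simp
  qed
  ultimately show ?thesis by (simp add: LIMSEQ_const_iff)
qed

text \<open>Exponentials exp(x \<bullet> z) are convenient for the Stone-Weierstrass theorem: their linear span is an
algebra, and it is reached from the powers (x \<bullet> z)^k by the exponential series.\<close>

inductive exp_sum :: "(real^'n \<Rightarrow> real) \<Rightarrow> bool" where
  exp_sum_single: "exp_sum (\<lambda>x. c * exp (x \<bullet> z))"
| exp_sum_add: "exp_sum f \<Longrightarrow> exp_sum g \<Longrightarrow> exp_sum (\<lambda>x. f x + g x)"

lemma exp_sum_mult:
  assumes "exp_sum f" "exp_sum g"
  shows "exp_sum (\<lambda>x. f x * g x)"
  using assms(1)
proof induction
  case (exp_sum_single c z)
  show ?case using assms(2)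
  proof induction
    case (exp_sum_single c' z')
    then show ?case using exp_sum.exp_sum_single[of "c * c'" "z + z'"]
      by (simp add: inner_add_right exp_add mult_ac)
  next
    case (exp_sum_add f g)
    then show ?case using exp_sum.exp_sum_add by (simp add: distrib_left)
  qed
next
  case (exp_sum_add f1 f2)
  then show ?case using exp_sum.exp_sum_add by (simp add: distrib_right)
qed

lemma exp_sum_continuous: "exp_sum f \<Longrightarrow> continuous_on S f"
  by (induction rule: exp_sum.induct) (auto intro!: continuous_intros)

lemma integral_continuous_0:
  fixes u \<phi> :: "real^'n \<Rightarrow> real"
  assumes u: "integrable sphere_measure u"
    and 0: "\<And>z. (\<integral>x. u x * exp (x \<bullet> z) \<partial>sphere_measure) = 0"
    and \<phi>: "continuous_on (sphere 0 1) \<phi>"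
  shows "(\<integral>x. u x * \<phi> x \<partial>sphere_measure) = 0"
proof -
  have e0: "(\<integral>x. u x * g x \<partial>sphere_measure) = 0" if "exp_sum g" for g
    using that
  proof induction
    case (exp_sum_single c z)
    have "(\<integral>x. u x * (c * exp (x \<bullet> z)) \<partial>sphere_measure) = (\<integral>x. c * (u x * exp (x \<bullet> z)) \<partial>sphere_measure)"
      by (simp add: mult_ac)
    then show ?case using 0 by simp
  next
    case (exp_sum_add f g)
    then show ?case
      by (simp add: distrib_left integrable_mult_sphere_continuous[OF u exp_sum_continuous])
  qed
  let ?A = "\<integral>x. \<bar>u x\<bar> \<partial>sphere_measure"
  have "\<bar>\<integral>x. u x * \<phi> x \<partial>sphere_measure\<bar> \<le> 0 + e" if e: "e > 0" for e
  proof -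
    have A: "?A \<ge> 0" by simp
    define r where "r = e / (?A + 1)"
    have A1: "?A + 1 > 0" using A by linarith
    have "r > 0" using e A1 by (simp add: r_def)
    moreover have "r * ?A \<le> e" using e A A1 by (simp add: r_def pos_divide_le_eq)
    ultimately have r: "r > 0" "r * ?A \<le> e" by auto
    have "\<exists>g. exp_sum g \<and> (\<forall>x \<in> sphere 0 1. \<bar>\<phi> x - g x\<bar> < r)"
    proof (rule Stone_Weierstrass_HOL[OF compact_sphere])
      show "exp_sum (\<lambda>x. c)" for c
        using exp_sum_single[of c 0] by simp
      show "\<exists>f. exp_sum f \<and> f x \<noteq> f y" if "x \<in> sphere 0 1 \<and> y \<in> sphere 0 1 \<and> x \<noteq> y" for x y :: "real^'n"
      proof (intro exI conjI)
        show "exp_sum (\<lambda>w. 1 * exp (w \<bullet> (x - y)))" by (rule exp_sum_single)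
        have "(x - y) \<bullet> (x - y) \<noteq> 0" using that by simp
        then show "1 * exp (x \<bullet> (x - y)) \<noteq> 1 * exp (y \<bullet> (x - y))" by (simp add: inner_diff_left)
      qed
    qed (use exp_sum_continuous exp_sum_add exp_sum_mult \<phi> r in auto)
    then obtain g where g: "exp_sum g" "\<And>x. x \<in> sphere 0 1 \<Longrightarrow> \<bar>\<phi> x - g x\<bar> < r" by blast
    have i: "integrable sphere_measure (\<lambda>x. u x * \<phi> x)" "integrable sphere_measure (\<lambda>x. u x * g x)"
      by (intro integrable_mult_sphere_continuous u \<phi> exp_sum_continuous g)+
    have "\<bar>\<integral>x. u x * \<phi> x \<partial>sphere_measure\<bar> = \<bar>\<integral>x. u x * \<phi> x - u x * g x \<partial>sphere_measure\<bar>"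
      using i e0[OF g(1)] by simp
    also have "\<dots> \<le> (\<integral>x. \<bar>u x * \<phi> x - u x * g x\<bar> \<partial>sphere_measure)" by (rule integral_abs_bound)
    also have "\<dots> \<le> (\<integral>x. r * \<bar>u x\<bar> \<partial>sphere_measure)"
    proof (rule integral_mono)
      fix x :: "real^'n" assume "x \<in> space sphere_measure"
      then have "\<bar>\<phi> x - g x\<bar> \<le> r" using g(2)[of x] by simp
      then show "\<bar>u x * \<phi> x - u x * g x\<bar> \<le> r * \<bar>u x\<bar>"
        unfolding right_diff_distrib[symmetric] abs_mult mult.commute[of r]
        by (intro mult_left_mono) auto
    qed (use i u in auto)
    also have "\<dots> \<le> e" using r by simp
    finally show ?thesis by simp
  qed
  then have "\<bar>\<integral>x. u x * \<phi> x \<partial>sphere_measure\<bar> \<le> 0" by (rule field_le_epsilon)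
  then show ?thesis by simp
qed

lemma borel_measurable_indicator_sphere:
  assumes "A \<in> sets borel"
  shows "(indicator A :: real^'n \<Rightarrow> real) \<in> borel_measurable sphere_measure"
  unfolding measurable_cong_sets[OF sets_sphere_measure refl]
  by (rule measurable_restrict_space1[OF borel_measurable_indicator[OF assms]])

lemma integral_closed_0:
  fixes u :: "real^'n \<Rightarrow> real"
  assumes u: "integrable sphere_measure u"
    and 0: "\<And>\<phi>. continuous_on (sphere 0 1) \<phi> \<Longrightarrow> (\<integral>x. u x * \<phi> x \<partial>sphere_measure) = 0"
    and C: "closed C"
  shows "(\<integral>x. u x * indicator C x \<partial>sphere_measure) = 0"
proof (cases "C = {}")
  case False
  let ?f = "\<lambda>n x. max 0 (1 - real n * infdist x C)"
  have c: "continuous_on (sphere 0 1) (?f n)" for n by (intro continuous_intros)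
  have Cb: "C \<in> sets borel" using C by (rule borel_closed)
  have mC: "(indicator C :: real^'n \<Rightarrow> real) \<in> borel_measurable (sphere_measure :: (real^'n) measure)"
    by (rule borel_measurable_indicator_sphere[OF Cb])
  have "(\<lambda>n. \<integral>x. u x * ?f n x \<partial>sphere_measure) \<longlonglongrightarrow> (\<integral>x. u x * indicator C x \<partial>sphere_measure)"
  proof (rule integral_dominated_convergence)
    show "(\<lambda>x. u x * indicator C x) \<in> borel_measurable sphere_measure"
      using u mC by auto
    show "(\<lambda>x. u x * ?f n x) \<in> borel_measurable sphere_measure" for n
      by (rule borel_measurable_integrable[OF integrable_mult_sphere_continuous[OF u c]])
    show "integrable sphere_measure (\<lambda>x. \<bar>u x\<bar>)" using u by simp
    show "AE x in sphere_measure. norm (u x * ?f n x) \<le> \<bar>u x\<bar>" for n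
    proof (rule AE_I2)
      fix x
      have "\<bar>?f n x\<bar> \<le> 1" using infdist_nonneg[of x C] by (auto simp: max_def)
      then show "norm (u x * ?f n x) \<le> \<bar>u x\<bar>"
        by (simp add: abs_mult mult_left_le)
    qed
    show "AE x in sphere_measure. (\<lambda>n. u x * ?f n x) \<longlonglongrightarrow> u x * indicator C x"
    proof (intro AE_I2 tendsto_mult tendsto_const)
      fix x
      show "(\<lambda>n. ?f n x) \<longlonglongrightarrow> indicator C x"
      proof (cases "x \<in> C")
        case True then show ?thesis by simp
      next
        case False
        then have pos: "infdist x C > 0"
          using C \<open>C \<noteq> {}\<close> by (metis infdist_nonneg in_closed_iff_infdist_zero less_eq_real_def)
        \<comment> \<open>from this index on the approximating functions vanish at x\<close>
    obtain m where m: "1 / infdist x C < real m" using reals_Archimedean2 by blast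
        have "?f n x = 0" if "n \<ge> m" for n
        proof -
          have "1 < real m * infdist x C" using m pos by (simp add: field_simps)
          also have "\<dots> \<le> real n * infdist x C" using that pos by (intro mult_right_mono) auto
          finally show ?thesis by simp
        qed
        then have "\<forall>\<^sub>F n in sequentially. ?f n x = 0" by (rule eventually_sequentiallyI)
        then show ?thesis using False by (auto intro: tendsto_eventually)
      qed
    qed
  qed
  moreover have "(\<integral>x. u x * ?f n x \<partial>sphere_measure) = 0" for n by (rule 0[OF c])
  ultimately show ?thesis by (simp add: LIMSEQ_const_iff)
qed simp

text \<open>The positive and the negative part of u are densities of finite measures that agree on closed sets,
an intersection-stable generator of the Borel sets.\<close>

lemma AE_zero_if_integral_closed_0:
  fixes u :: "real^'n \<Rightarrow> real"
  assumes u: "integrable sphere_measure u"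
    and 0: "\<And>C. closed C \<Longrightarrow> (\<integral>x. u x * indicator C x \<partial>sphere_measure) = 0"
  shows "AE x in sphere_measure. u x = 0"
proof -
  let ?M = "sphere_measure :: (real^'n) measure"
  let ?p = "\<lambda>x. ennreal (max 0 (u x))" and ?q = "\<lambda>x. ennreal (max 0 (- u x))"
  have um [measurable]: "u \<in> borel_measurable ?M" using u by auto
  let ?P = "distr (density ?M ?p) borel (\<lambda>x. x)" and ?Q = "distr (density ?M ?q) borel (\<lambda>x. x)"
  have idm: "(\<lambda>x. x) \<in> ?M \<rightarrow>\<^sub>M borel"
    by (simp add: measurable_cong_sets[OF sets_sphere_measure refl] measurable_restrict_space1)
  have inS: "A \<inter> sphere 0 1 \<in> sets ?M" if "A \<in> sets borel" for A
    using measurable_sets[OF idm that] by (simp add: vimage_def Int_def conj_commute)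
  have em: "emeasure (distr (density ?M (\<lambda>x. ennreal (max 0 (v x)))) borel (\<lambda>x. x)) A
      = ennreal (\<integral>x. max 0 (v x) * indicator A x \<partial>?M)"
    if A: "A \<in> sets borel" and v: "integrable ?M v" for A v
  proof -
    have [measurable]: "v \<in> borel_measurable ?M" using v by auto
    have mA: "(indicator A :: real^'n \<Rightarrow> real) \<in> borel_measurable ?M"
      by (rule borel_measurable_indicator_sphere[OF A])
    have "emeasure (distr (density ?M (\<lambda>x. ennreal (max 0 (v x)))) borel (\<lambda>x. x)) A
      = emeasure (density ?M (\<lambda>x. ennreal (max 0 (v x)))) (A \<inter> sphere 0 1)"
      using idm A by (subst emeasure_distr) (auto simp: measurable_cong_sets[OF sets_density refl])
    also have "\<dots> = (\<integral>\<^sup>+x. ennreal (max 0 (v x)) * indicator (A \<inter> sphere 0 1) x \<partial>?M)"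
      by (rule emeasure_density) (use inS[OF A] in auto)
    also have "\<dots> = (\<integral>\<^sup>+x. ennreal (max 0 (v x) * indicator A x) \<partial>?M)"
      by (intro nn_integral_cong) (auto simp: indicator_def)
    also have "\<dots> = ennreal (\<integral>x. max 0 (v x) * indicator A x \<partial>?M)"
    proof (rule nn_integral_eq_integral)
      show "integrable ?M (\<lambda>x. max 0 (v x) * indicator A x)"
      proof (rule Bochner_Integration.integrable_bound[OF v])
        show "(\<lambda>x. max 0 (v x) * indicator A x) \<in> borel_measurable ?M" using mA by measurable
      qed (auto simp: indicator_def)
    qed (auto simp: indicator_def)
    finally show ?thesis .
  qed
  have "?P = ?Q"
  proof (rule measure_eqI_generator_eq[where \<Omega> = UNIV and E = "Collect closed" and A = "\<lambda>_. UNIV"])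
    show "Int_stable (Collect closed :: (real^'n) set set)" by (auto simp: Int_stable_def)
    show "sets ?P = sigma_sets UNIV (Collect closed)" "sets ?Q = sigma_sets UNIV (Collect closed)"
      by (simp_all add: borel_eq_closed)
    show "emeasure ?P UNIV \<noteq> \<infinity>" for i :: nat
      using em[of UNIV u] u by simp
  next
    fix C :: "(real^'n) set" assume "C \<in> Collect closed"
    then have C: "closed C" by simp
    then have Cb: "C \<in> sets borel" by (rule borel_closed)
    have mC: "(indicator C :: real^'n \<Rightarrow> real) \<in> borel_measurable ?M"
      by (rule borel_measurable_indicator_sphere[OF Cb])
    have "(\<lambda>x. max 0 (u x) * indicator C x) \<in> borel_measurable ?M"
      "(\<lambda>x. max 0 (- u x) * indicator C x) \<in> borel_measurable ?M" using mC by measurable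
    note mm = this
    have i1: "integrable ?M (\<lambda>x. max 0 (u x) * indicator C x)"
      by (rule Bochner_Integration.integrable_bound[OF u mm(1)]) (auto simp: indicator_def)
    have i2: "integrable ?M (\<lambda>x. max 0 (- u x) * indicator C x)"
      by (rule Bochner_Integration.integrable_bound[OF u mm(2)]) (auto simp: indicator_def)
    have "(\<integral>x. max 0 (u x) * indicator C x \<partial>?M) - (\<integral>x. max 0 (- u x) * indicator C x \<partial>?M)
       = (\<integral>x. max 0 (u x) * indicator C x - max 0 (- u x) * indicator C x \<partial>?M)"
      by (rule Bochner_Integration.integral_diff[OF i1 i2, symmetric])
    also have "\<dots> = (\<integral>x. u x * indicator C x \<partial>?M)"
      by (rule Bochner_Integration.integral_cong) (auto simp: indicator_def max_def)
    also have "\<dots> = 0" by (rule 0[OF C])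
    finally show "emeasure ?P C = emeasure ?Q C"
      using em[OF Cb u] em[OF Cb, of "\<lambda>x. - u x"] u by simp
  qed auto
  then have "emeasure (density ?M ?p) A = emeasure (density ?M ?q) A" if "A \<in> sets ?M" for A
  proof -
    have A: "A \<in> sets borel" "A \<inter> sphere 0 1 = A"
      using that by (auto simp: sets_sphere_measure sets_restrict_space_iff)
    have e: "emeasure (distr (density ?M f) borel (\<lambda>x. x)) A = emeasure (density ?M f) A" for f
      using idm A by (subst emeasure_distr) (auto simp: measurable_cong_sets[OF sets_density refl])
    show ?thesis using \<open>?P = ?Q\<close> e[of ?p] e[of ?q] by simp
  qed
  then have "density ?M ?p = density ?M ?q"
    by (intro measure_eqI) auto
  then have "AE x in ?M. ?p x = ?q x"
    using sphere.density_unique[of ?p ?q] by auto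
  then show ?thesis
    by eventually_elim (auto simp: max_def split: if_splits)
qed

text \<open>From harmonics to powers (x \<bullet> z)^k, from these to exponentials, by Stone-Weierstrass to continuous
functions, and by approximation of indicators to closed sets.\<close>

theorem AE_zero_if_harmonic_proj_0:
  fixes u :: "real^'n \<Rightarrow> real"
  assumes u: "integrable sphere_measure u" and n: "CARD('n) \<ge> 2"
    and 0: "\<And>l x. x \<in> sphere 0 1 \<Longrightarrow> harmonic_proj l u x = 0"
  shows "AE x in sphere_measure. u x = 0"
proof (rule AE_zero_if_integral_closed_0[OF u integral_closed_0[OF u integral_continuous_0[OF u integral_exp_inner_0[OF u]]]])
  show "(\<integral>x. u x * (x \<bullet> z) ^ k \<partial>sphere_measure) = 0" for z k
    by (rule ip_inner_power_0[OF u n harmonic_proj_0_imp_orthogonal[OF u 0]])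
qed

lemma harmonic_proj_diff:
  fixes f g :: "real^'n \<Rightarrow> real"
  assumes "integrable sphere_measure f" "integrable sphere_measure g" "x \<in> sphere 0 1"
  shows "harmonic_proj l (\<lambda>x. f x - g x) x = harmonic_proj l f x - harmonic_proj l g x"
proof -
  obtain E where E: "finite E" "E \<subseteq> harmonic_homogeneous_polynomials l" "orthonormal_functions E"
    and rep: "\<And>v x. v \<in> harmonic_homogeneous_polynomials l \<Longrightarrow> x \<in> sphere 0 1 \<Longrightarrow> v x = (\<Sum>e\<in>E. ip v e * e (x::real^'n))"
    using harmonic_basis_exists[where 'n='n, of l] by blast
  have ec: "continuous_on (sphere 0 1) e" if "e \<in> E" for e
    using that E by (auto simp: orthonormal_functions_def)
  have "ip (\<lambda>x. f x - g x) e = ip f e - ip g e" if "e \<in> E" for e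
    unfolding ip_def left_diff_distrib
    by (intro Bochner_Integration.integral_diff integrable_mult_sphere_continuous assms ec that)
  note d = this
  have hp: "harmonic_proj l h x = (\<Sum>e\<in>E. ip h e * e x)" if "integrable sphere_measure h" for h
    by (rule harmonic_proj_eq[OF E _ assms(3) that]) (rule rep)
  show ?thesis
    unfolding hp[OF Bochner_Integration.integrable_diff[OF assms(1,2)]] hp[OF assms(1)] hp[OF assms(2)]
      sum_subtractf[symmetric]
    by (intro sum.cong refl) (simp add: d left_diff_distrib)
qed

lemma bessel_derivative_unique:
  fixes f g g' :: "real^'n \<Rightarrow> real"
  assumes g: "integrable sphere_measure g" "integrable sphere_measure g'" and n: "CARD('n) \<ge> 2"
    and b: "is_bessel_derivative s f g" "is_bessel_derivative s f g'"
  shows "AE x in sphere_measure. g x = g' x"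
proof -
  have "AE x in sphere_measure. g x - g' x = 0"
    using b by (intro AE_zero_if_harmonic_proj_0 n Bochner_Integration.integrable_diff g)
       (simp add: harmonic_proj_diff[OF g] is_bessel_derivative_def)
  then show ?thesis by eventually_elim simp
qed

section \<open>Polynomial bumps and the zonal Laplacian\<close>

lemma truncated_power_has_derivative:
  "((\<lambda>t. max 0 (t - c) ^ Suc (Suc k)) has_real_derivative (real k + 2) * max 0 (t - c) ^ Suc k) (at t)"
proof -
  consider "t < c" | "t > c" | "t = c" by linarith
  then show ?thesis
  proof cases
    case 1
    have "((\<lambda>t. 0::real) has_real_derivative 0) (at t)" by simp
    then have "((\<lambda>t. max 0 (t - c) ^ Suc (Suc k)) has_real_derivative 0) (at t)"
      by (rule has_field_derivative_transform_within_open[of _ _ _ "{..<c}"]) (use 1 in auto)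
    then show ?thesis using 1 by simp
  next
    case 2
    have "((\<lambda>t. t - c) has_real_derivative 1) (at t)"
      by (auto intro!: derivative_eq_intros)
    from DERIV_power[OF this, of "Suc (Suc k)"]
    have "((\<lambda>t. (t - c) ^ Suc (Suc k)) has_real_derivative (real k + 2) * (t - c) ^ Suc k) (at t)"
      by (simp add: add.commute)
    then have "((\<lambda>t. max 0 (t - c) ^ Suc (Suc k)) has_real_derivative (real k + 2) * (t - c) ^ Suc k) (at t)"
      by (rule has_field_derivative_transform_within_open[of _ _ _ "{c<..}"]) (use 2 in auto)
    then show ?thesis using 2 by simp
  next
    case 3
    have "((\<lambda>h. max 0 h ^ Suc k) \<longlongrightarrow> max 0 0 ^ Suc k) (at (0::real))"
      by (intro tendsto_intros)
    then have l: "((\<lambda>h. max 0 h ^ Suc k) \<longlongrightarrow> 0) (at (0::real))" by simp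
    have "\<forall>\<^sub>F h in at 0. max 0 h ^ Suc k = (max 0 (c + h - c) ^ Suc (Suc k) - max 0 (c - c) ^ Suc (Suc k)) / h"
      unfolding eventually_at_filter by (rule always_eventually) (auto simp: max_def)
    from Lim_transform_eventually[OF l this]
    have "((\<lambda>h. (max 0 (c + h - c) ^ Suc (Suc k) - max 0 (c - c) ^ Suc (Suc k)) / h) \<longlongrightarrow> 0) (at 0)" .
    then show ?thesis using 3 by (simp add: DERIV_def)
  qed
qed

lemma poly_antiderivative_exists: "\<exists>G. pderiv G = (F :: real poly) \<and> poly G a = 0"
proof -
  define G where "G = (\<Sum>i\<le>degree F. monom (coeff F i / real (Suc i)) (Suc i))"
  have "pderiv G = (\<Sum>i\<le>degree F. monom (coeff F i) i)"
    unfolding G_def higher_pderiv_sum[of 1, simplified] by (intro sum.cong refl) (simp add: pderiv_monom)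
  then have "pderiv G = F" using poly_as_sum_of_monoms[of F] by metis
  then show ?thesis by (intro exI[of _ "G - [:poly G a:]"]) (simp add: pderiv_diff pderiv_pCons)
qed

text \<open>The i-th derivative of (t - c)_+^(j + 1), for i \<le> j.\<close>

definition truncated_power_deriv :: "real \<Rightarrow> nat \<Rightarrow> nat \<Rightarrow> real \<Rightarrow> real" where
  "truncated_power_deriv c j i t = fact (Suc j) / fact (Suc j - i) * max 0 (t - c) ^ (Suc j - i)"

text \<open>The Weierstrass theorem gives j = 0. The step integrates j + 2 times the previous polynomial from
-1, and the mean value theorem controls the error of the antiderivative on [-1, 1].\<close>

lemma truncated_power_approx:
  assumes c: "-1 \<le> c" and e: "e > 0"
  shows "\<exists>F::real poly. \<forall>i\<le>j. \<forall>t\<in>{-1..1}. \<bar>poly ((pderiv ^^ i) F) t - truncated_power_deriv c j i t\<bar> \<le> e"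
  using e
proof (induction j arbitrary: e)
  case 0
  have "continuous_on {-1..1} (\<lambda>t. max 0 (t - c))" by (intro continuous_intros)
  from Stone_Weierstrass_real_polynomial_function[OF compact_Icc this 0]
  obtain g where g: "real_polynomial_function g" "\<And>t. t \<in> {-1..1} \<Longrightarrow> \<bar>max 0 (t - c) - g t\<bar> < e" by blast
  obtain a n where a: "g = (\<lambda>x. \<Sum>i\<le>n. a i * x ^ i)"
    using g(1) real_polynomial_function_iff_sum by blast
  have "poly (\<Sum>i\<le>n. monom (a i) i) t = g t" for t
    by (simp add: a poly_sum poly_monom)
  then show ?case using g(2)
    by (intro exI[of _ "\<Sum>i\<le>n. monom (a i) i"])
       (auto simp: truncated_power_deriv_def abs_minus_commute intro!: less_imp_le)
next
  case (Suc j)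
  let ?k = "real j + 2"
  have k: "?k > 0" by simp
  \<comment> \<open>the interval has length 2 and the derivative of the error is at most (j + 2) r\<close>
  define r where "r = e / 2 / ?k"
  have "x * (e / 2 / x) = e / 2" if "x > 0" for x using that by simp
  from this[OF k] have "?k * r = e / 2" unfolding r_def .
  moreover have "r > 0" using Suc.prems k by (simp add: r_def)
  ultimately have r: "r > 0" "?k * r * 2 = e" by linarith+
  obtain F where F: "\<And>i t. i \<le> j \<Longrightarrow> t \<in> {-1..1} \<Longrightarrow> \<bar>poly ((pderiv ^^ i) F) t - truncated_power_deriv c j i t\<bar> \<le> r"
    using Suc.IH[OF r(1)] by blast
  obtain G where G: "pderiv G = smult ?k F" "poly G (-1) = 0"
    using poly_antiderivative_exists[of "smult ?k F" "-1"] by blast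
  have "\<bar>poly ((pderiv ^^ i) G) t - truncated_power_deriv c (Suc j) i t\<bar> \<le> e" if i: "i \<le> Suc j" and t: "t \<in> {-1..1}" for i t
  proof (cases i)
    case (Suc i')
    have "poly ((pderiv ^^ i) G) t = ?k * poly ((pderiv ^^ i') F) t"
      by (simp add: Suc funpow_swap1 G(1) higher_pderiv_smult)
    moreover have "truncated_power_deriv c (Suc j) i t = ?k * truncated_power_deriv c j i' t"
      using i by (simp add: truncated_power_deriv_def Suc fact_Suc[of "Suc j"])
    ultimately have "\<bar>poly ((pderiv ^^ i) G) t - truncated_power_deriv c (Suc j) i t\<bar> = ?k * \<bar>poly ((pderiv ^^ i') F) t - truncated_power_deriv c j i' t\<bar>"
      by (simp add: right_diff_distrib[symmetric] abs_mult)
    also have "\<dots> \<le> ?k * r" using F[of i' t] i t Suc by (intro mult_left_mono) auto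
    also have "\<dots> \<le> e" using r k mult_pos_pos[OF k r(1)] by linarith
    finally show ?thesis .
  next
    case 0
    let ?h = "\<lambda>t. poly G t - max 0 (t - c) ^ Suc (Suc j)"
    let ?h' = "\<lambda>t. ?k * (poly F t - max 0 (t - c) ^ Suc j)"
    have d: "(?h has_real_derivative ?h' t) (at t)" for t
      using DERIV_diff[OF poly_DERIV[of G t] truncated_power_has_derivative[of c j t]]
      by (simp add: G(1) right_diff_distrib)
    have h'b: "\<bar>?h' t\<bar> \<le> ?k * r" if "t \<in> {-1..1}" for t
      unfolding abs_mult using F[of 0 t] that by (intro mult_mono) (auto simp: truncated_power_deriv_def)
    have h0: "?h (-1) = 0" using G(2) c by simp
    have "\<bar>?h t\<bar> \<le> e"
    proof (cases "t = -1")
      case True then show ?thesis using h0 Suc.prems by simp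
    next
      case False
      then have "-1 < t" using t by auto
      from MVT2[OF this d] obtain z where z: "-1 < z" "z < t" "?h t - ?h (-1) = (t - -1) * ?h' z" by blast
      have "\<bar>?h t\<bar> = (t - -1) * \<bar>?h' z\<bar>" using z(3) t unfolding h0 by (simp add: abs_mult)
      also have "\<dots> \<le> 2 * (?k * r)" using h'b[of z] z t by (intro mult_mono) auto
      finally show ?thesis using r by simp
    qed
    then show ?thesis by (simp add: 0 truncated_power_deriv_def)
  qed
  then show ?case by blast
qed

text \<open>The operator 1 - \<Delta> on functions of x \<bullet> y.\<close>

definition zonal_bessel :: "nat \<Rightarrow> real poly \<Rightarrow> real poly" where
  "zonal_bessel d F = F - zonal_laplacian d F"

lemma higher_pderiv_zonal_laplacian:
  "(pderiv ^^ i) (zonal_laplacian d F) = [:1, 0, -1:] * (pderiv ^^ (i + 2)) F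
    - smult (2 * real i + real d) ([:0, 1:] * (pderiv ^^ (i + 1)) F)
    - smult (real i * (real i - 1 + real d)) ((pderiv ^^ i) F)"
proof (induction i)
  case 0 show ?case by (simp add: zonal_laplacian_def numeral_2_eq_2)
next
  case (Suc i)
  let ?D = "\<lambda>i. (pderiv ^^ i) F"
  have p1: "pderiv [:1, 0, -1:] = smult (-2) [:0, 1::real:]" by (simp add: pderiv_pCons)
  have p2: "pderiv [:0, 1:] = (1::real poly)" by (simp add: pderiv_pCons)
  have "(pderiv ^^ Suc i) (zonal_laplacian d F) = pderiv ((pderiv ^^ i) (zonal_laplacian d F))" by simp
  also have "\<dots> = ([:1, 0, -1:] * ?D (i + 3) + ?D (i + 2) * smult (-2) [:0, 1:])
      - smult (2 * real i + real d) ([:0, 1:] * ?D (i + 2) + ?D (i + 1) * 1)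
      - smult (real i * (real i - 1 + real d)) (?D (i + 1))"
    unfolding Suc.IH pderiv_diff pderiv_mult pderiv_smult p1 p2 by (simp add: eval_nat_numeral)
  also have "\<dots> = [:1, 0, -1:] * ?D (i + 3)
      - smult (2 * real (Suc i) + real d) ([:0, 1:] * ?D (i + 2))
      - smult (real (Suc i) * (real (Suc i) - 1 + real d)) (?D (i + 1))"
    by (subst poly_eq_poly_eq_iff[symmetric], rule ext) (simp add: algebra_simps)
  finally show ?case by (simp add: eval_nat_numeral)
qed

lemma higher_pderiv_diff: "(pderiv ^^ i) (F - G) = (pderiv ^^ i) F - (pderiv ^^ i) (G :: real poly)"
  by (induction i) (simp_all add: pderiv_diff)

text \<open>Think of w = 1 / \<delta>, where \<delta> is the height of a cap: if the i-th derivative of F costs a factor w^i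
there, then 1 - \<Delta> costs only one factor w, although it is of second order, because the leading
coefficient 1 - t^2 is at most 2 / w. With w = 1 the same statement covers the whole interval.\<close>

lemma zonal_bessel_bound:
  assumes t: "\<bar>t\<bar> \<le> 1" "1 - t\<^sup>2 \<le> 2 / w" and w: "w \<ge> 1" and M: "M \<ge> 0"
    and F: "\<And>i. i \<le> R \<Longrightarrow> \<bar>poly ((pderiv ^^ i) F) t\<bar> \<le> M * w ^ i"
    and k: "i + 2 * k \<le> R"
  shows "\<bar>poly ((pderiv ^^ i) ((zonal_bessel d ^^ k) F)) t\<bar>
    \<le> (3 + 2 * real R + real d + real R * (real R + real d)) ^ k * M * w ^ (i + k)"
  using k
proof (induction k arbitrary: i)
  case 0 then show ?case using F by simp
next
  case (Suc k)
  let ?C = "3 + 2 * real R + real d + real R * (real R + real d)"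
  let ?G = "(zonal_bessel d ^^ k) F"
  let ?B = "?C ^ k * M * w ^ (i + Suc k)"
  define g0 g1 g2 where "g0 = poly ((pderiv ^^ i) ?G) t" "g1 = poly ((pderiv ^^ (i + 1)) ?G) t"
    "g2 = poly ((pderiv ^^ (i + 2)) ?G) t"
  have CM: "?C ^ k * M \<ge> 0" using M by simp
  have iR: "real i \<le> real R" using Suc.prems by simp
  have g0: "\<bar>g0\<bar> \<le> ?B"
  proof -
    have "\<bar>g0\<bar> \<le> ?C ^ k * M * w ^ (i + k)" using Suc by (simp add: g0_g1_g2_def)
    also have "\<dots> \<le> ?B" using CM w by (intro mult_left_mono power_increasing) auto
    finally show ?thesis .
  qed
  have g1: "\<bar>g1\<bar> \<le> ?B" using Suc.IH[of "i + 1"] Suc.prems by (simp add: g0_g1_g2_def)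
  have g2: "(1 - t\<^sup>2) * \<bar>g2\<bar> \<le> 2 * ?B"
  proof -
    have "\<bar>g2\<bar> \<le> ?C ^ k * M * w ^ (i + 2 + k)" using Suc.IH[of "i + 2"] Suc.prems by (simp add: g0_g1_g2_def)
    then have "(1 - t\<^sup>2) * \<bar>g2\<bar> \<le> 2 / w * (?C ^ k * M * w ^ (i + 2 + k))"
      using t w by (intro mult_mono) (auto simp: abs_square_le_1)
    also have "\<dots> = 2 * ?B" using w by (simp add: field_simps)
    finally show ?thesis .
  qed
  have B: "?B \<ge> 0" using CM w by simp
  have "poly ((pderiv ^^ i) ((zonal_bessel d ^^ Suc k) F)) t
      = g0 - ((1 - t\<^sup>2) * g2 - (2 * real i + real d) * (t * g1) - real i * (real i - 1 + real d) * g0)"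
    unfolding g0_g1_g2_def
    by (simp add: zonal_bessel_def[of d ?G] higher_pderiv_diff higher_pderiv_zonal_laplacian power2_eq_square algebra_simps)
  also have "\<bar>\<dots>\<bar> \<le> \<bar>g0\<bar> + (1 - t\<^sup>2) * \<bar>g2\<bar> + (2 * real i + real d) * \<bar>g1\<bar> + real i * (real i + real d) * \<bar>g0\<bar>"
  proof -
    have a: "\<bar>(1 - t\<^sup>2) * g2\<bar> = (1 - t\<^sup>2) * \<bar>g2\<bar>" using t by (simp add: abs_mult abs_square_le_1)
    have b: "\<bar>(2 * real i + real d) * (t * g1)\<bar> \<le> (2 * real i + real d) * \<bar>g1\<bar>"
      unfolding abs_mult using t by (intro mult_mono) (auto intro!: mult_left_le_one_le)
    have c: "\<bar>real i * (real i - 1 + real d) * g0\<bar> \<le> real i * (real i + real d) * \<bar>g0\<bar>"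
      unfolding abs_mult by (cases "i = 0") (auto intro!: mult_mono)
    show ?thesis using a b c by linarith
  qed
  also have "\<dots> \<le> ?B + 2 * ?B + (2 * real R + real d) * ?B + real R * (real R + real d) * ?B"
  proof -
    have "(2 * real i + real d) * \<bar>g1\<bar> \<le> (2 * real R + real d) * ?B"
      by (rule mult_mono[OF _ g1]) (use iR in auto)
    moreover have "real i * (real i + real d) * \<bar>g0\<bar> \<le> real R * (real R + real d) * ?B"
      by (rule mult_mono[OF _ g0]) (use iR in \<open>auto intro!: mult_mono\<close>)
    ultimately show ?thesis using g0 g2 by linarith
  qed
  also have "\<dots> = ?C ^ Suc k * M * w ^ (i + Suc k)" by (simp add: algebra_simps)
  finally show ?case .
qed

lemma has_sphere_laplacian_unique:
  assumes "has_sphere_laplacian f g" "has_sphere_laplacian f g'" "x \<in> sphere 0 1"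
  shows "g x = g' x"
  using assms unfolding has_sphere_laplacian_def
  by (intro tendsto_unique[OF _ tendsto_uniform_limitI tendsto_uniform_limitI]) auto

definition zonal_harmonic :: "nat \<Rightarrow> real^'n \<Rightarrow> real^'n \<Rightarrow> real" where
  "zonal_harmonic l y = zonal (gegenbauer_poly CARD('n) l) y"

lemma zonal_harmonic_eigen:
  fixes y :: "real^'n"
  assumes y: "y \<in> sphere 0 1" and n: "CARD('n) \<ge> 2"
  shows "has_sphere_laplacian (zonal_harmonic l y)
     (\<lambda>x. - laplace_beltrami_eigenvalue (CARD('n) - 1) l * zonal_harmonic l y x)"
  by (rule has_sphere_laplacian_cong[OF harmonic_has_sphere_laplacian[OF solid_zonal_harmonic[OF y n]]])
     (simp_all add: solid_zonal_on_sphere zonal_harmonic_def)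

text \<open>Both sides are limits of the same difference quotients, so the one-dimensional operator agrees on
the sphere with the multiplier 1 + \<lambda>_l.\<close>

lemma zonal_bessel_power_spectral:
  fixes y :: "real^'n"
  assumes y: "y \<in> sphere 0 1" and n: "CARD('n) \<ge> 2"
    and F: "F = (\<Sum>l\<le>L. smult (a l) (gegenbauer_poly CARD('n) l))" and x: "x \<in> sphere 0 1"
  shows "zonal ((zonal_bessel (CARD('n) - 1) ^^ k) F) y x
    = (\<Sum>l\<le>L. (1 + laplace_beltrami_eigenvalue (CARD('n) - 1) l) ^ k * a l * zonal_harmonic l y x)"
  using x
proof (induction k arbitrary: x)
  case 0 show ?case by (simp add: F zonal_def zonal_harmonic_def poly_sum)
next
  case (Suc k)
  let ?d = "CARD('n) - 1"
  let ?lam = "laplace_beltrami_eigenvalue ?d"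
  let ?G = "(zonal_bessel ?d ^^ k) F"
  let ?b = "\<lambda>l. (1 + ?lam l) ^ k * a l"
  have "has_sphere_laplacian (\<lambda>x. \<Sum>l\<le>L. ?b l * zonal_harmonic l y x) (\<lambda>x. \<Sum>l\<le>L. ?b l * (- ?lam l * zonal_harmonic l y x))"
    by (intro has_sphere_laplacian_sum has_sphere_laplacian_cmult zonal_harmonic_eigen y n)
  then have "has_sphere_laplacian (zonal ?G y) (\<lambda>x. \<Sum>l\<le>L. ?b l * (- ?lam l * zonal_harmonic l y x))"
    by (rule has_sphere_laplacian_cong[OF _ Suc.IH[symmetric] refl])
  from has_sphere_laplacian_unique[OF zonal_has_sphere_laplacian[OF y] this Suc.prems]
  have L: "zonal (zonal_laplacian ?d ?G) y x = (\<Sum>l\<le>L. ?b l * (- ?lam l * zonal_harmonic l y x))" .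
  have "zonal ((zonal_bessel ?d ^^ Suc k) F) y x = zonal ?G y x - zonal (zonal_laplacian ?d ?G) y x"
  proof -
    have "(zonal_bessel ?d ^^ Suc k) F = ?G - zonal_laplacian ?d ?G"
      by (simp only: funpow.simps comp_def zonal_bessel_def[of ?d ?G])
    then show ?thesis unfolding zonal_def by (simp only: poly_diff)
  qed
  also have "\<dots> = (\<Sum>l\<le>L. ?b l * zonal_harmonic l y x - ?b l * (- ?lam l * zonal_harmonic l y x))"
    unfolding L Suc.IH[OF Suc.prems] sum_subtractf ..
  also have "\<dots> = (\<Sum>l\<le>L. (1 + ?lam l) ^ Suc k * a l * zonal_harmonic l y x)"
    by (intro sum.cong refl) (simp add: algebra_simps)
  finally show ?case .
qed

lemma laplace_beltrami_eigenvalue_strict_mono: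
  assumes "d \<ge> 1" "k < l"
  shows "laplace_beltrami_eigenvalue d k < laplace_beltrami_eigenvalue d l"
proof -
  have "real k * (real k + real d - 1) \<le> real k * (real l + real d - 1)"
    using assms by (intro mult_left_mono) auto
  also have "\<dots> < real l * (real l + real d - 1)"
    using assms by (intro mult_strict_right_mono) auto
  finally show ?thesis by (simp add: laplace_beltrami_eigenvalue_def)
qed

text \<open>The spherical Laplacian is symmetric, and its eigenvalues for distinct degrees are distinct.\<close>

lemma zonal_harmonic_orthogonal:
  fixes y :: "real^'n"
  assumes y: "y \<in> sphere 0 1" and n: "CARD('n) \<ge> 2" and kl: "k \<noteq> l"
    and h: "h \<in> harmonic_homogeneous_polynomials l"
  shows "ip (zonal_harmonic k y) h = 0"
proof -
  let ?lam = "laplace_beltrami_eigenvalue (CARD('n) - 1)"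
  have c: "continuous_on (sphere 0 1) (zonal_harmonic k y)"
    unfolding zonal_harmonic_def by (intro continuous_on_real_polynomial real_polynomial_zonal)
  have hc: "continuous_on (sphere 0 1) h" by (rule harmonic_continuous[OF h])
  have "(\<integral>x. - ?lam k * zonal_harmonic k y x * h x \<partial>sphere_measure) =
        (\<integral>x. zonal_harmonic k y x * (- ?lam l * h x) \<partial>sphere_measure)"
    by (rule sphere_laplacian_symmetric[OF zonal_harmonic_eigen[OF y n] c _ harmonic_has_sphere_laplacian[OF h] hc])
       (intro continuous_intros c hc)+
  then have "?lam k * ip (zonal_harmonic k y) h = ?lam l * ip (zonal_harmonic k y) h"
  proof -
    have "(\<lambda>x. - ?lam k * zonal_harmonic k y x * h x) = (\<lambda>x. - ?lam k * (zonal_harmonic k y x * h x))"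
      "(\<lambda>x. zonal_harmonic k y x * (- ?lam l * h x)) = (\<lambda>x. - ?lam l * (zonal_harmonic k y x * h x))"
      by (simp_all only: mult.assoc mult.left_commute)
    moreover assume "(\<integral>x. - ?lam k * zonal_harmonic k y x * h x \<partial>sphere_measure) =
        (\<integral>x. zonal_harmonic k y x * (- ?lam l * h x) \<partial>sphere_measure)"
    ultimately have "- ?lam k * ip (zonal_harmonic k y) h = - ?lam l * ip (zonal_harmonic k y) h"
      unfolding ip_def by (simp only: integral_mult_right_zero)
    then show ?thesis by linarith
  qed
  moreover have "?lam k \<noteq> ?lam l"
  proof -
    have d: "CARD('n) - 1 \<ge> 1" using n by simp
    show ?thesis
      using laplace_beltrami_eigenvalue_strict_mono[OF d, of k l] laplace_beltrami_eigenvalue_strict_mono[OF d, of l k] kl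
      by (cases "k < l") auto
  qed
  ultimately show ?thesis by simp
qed

section \<open>The Lp norms on continuous functions\<close>

lemma enn2real_ge_1: "1 \<le> p \<Longrightarrow> p \<noteq> \<infinity> \<Longrightarrow> 1 \<le> enn2real p"
  by (cases p) auto

lemma Lp_norm_finite_eq:
  fixes f :: "real^'n \<Rightarrow> real"
  assumes p: "1 \<le> p" "p \<noteq> \<infinity>" and f: "continuous_on (sphere 0 1) f"
  shows "Lp_norm sphere_measure p f
    = ennreal ((\<integral>x. \<bar>f x\<bar> powr enn2real p \<partial>sphere_measure) powr (1 / enn2real p))"
proof -
  have P: "enn2real p \<ge> 1" by (rule enn2real_ge_1[OF p])
  have c: "continuous_on (sphere 0 1) (\<lambda>x. \<bar>f x\<bar> powr enn2real p)"
    using P by (intro continuous_on_powr' continuous_intros f) auto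
  have "(\<integral>\<^sup>+ x. ennreal (\<bar>f x\<bar> powr enn2real p) \<partial>sphere_measure)
      = ennreal (\<integral>x. \<bar>f x\<bar> powr enn2real p \<partial>sphere_measure)"
    by (rule nn_integral_eq_integral[OF integrable_sphere_continuous[OF c]]) simp
  then show ?thesis using p by (simp add: Lp_norm_def ennpowr_def)
qed

text \<open>The surface measure has full support.\<close>

lemma AE_le_imp_le_on_sphere:
  fixes f :: "real^'n \<Rightarrow> real"
  assumes f: "continuous_on (sphere 0 1) f" and ae: "AE x in sphere_measure. f x \<le> c" and x: "x \<in> sphere 0 1"
  shows "f x \<le> c"
proof -
  have "max 0 (f x - c) = 0"
  proof (rule integral_sphere_eq_0_imp[of "\<lambda>x. max 0 (f x - c)", OF _ _ _ x])
    show "continuous_on (sphere 0 1) (\<lambda>x. max 0 (f x - c))" by (intro continuous_intros f)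
    have "(\<integral>x. max 0 (f x - c) \<partial>sphere_measure) = (\<integral>x. 0 \<partial>(sphere_measure :: (real^'n) measure))"
    proof (rule integral_cong_AE)
      show "(\<lambda>x. max 0 (f x - c)) \<in> borel_measurable sphere_measure"
        by (intro borel_measurable_sphere_continuous continuous_intros f)
      show "AE x in sphere_measure. max 0 (f x - c) = 0" using ae by eventually_elim simp
    qed simp
    then show "(\<integral>x. max 0 (f x - c) \<partial>sphere_measure) = 0" by simp
  qed auto
  then show ?thesis by simp
qed

lemma Lp_norm_top_le_iff:
  fixes f :: "real^'n \<Rightarrow> real"
  assumes f: "continuous_on (sphere 0 1) f" and b: "b \<ge> 0"
  shows "Lp_norm sphere_measure \<infinity> f \<le> ennreal b \<longleftrightarrow> (\<forall>x\<in>sphere 0 1. \<bar>f x\<bar> \<le> b)"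
proof
  have m: "(\<lambda>x. ennreal \<bar>f x\<bar>) \<in> borel_measurable sphere_measure"
    using borel_measurable_sphere_continuous[OF f] by measurable
  show "Lp_norm sphere_measure \<infinity> f \<le> ennreal b" if "\<forall>x\<in>sphere 0 1. \<bar>f x\<bar> \<le> b"
    unfolding Lp_norm_def using that m by (auto intro!: esssup_I AE_I2 ennreal_leI)
  assume le: "Lp_norm sphere_measure \<infinity> f \<le> ennreal b"
  have ae: "AE x in sphere_measure. \<bar>f x\<bar> \<le> b"
    using esssup_AE[of "\<lambda>x. ennreal \<bar>f x\<bar>" sphere_measure]
  proof eventually_elim
    case (elim x)
    then have "ennreal \<bar>f x\<bar> \<le> ennreal b" using le by (simp add: Lp_norm_def)
    then show ?case using b by simp
  qed
  have c: "continuous_on (sphere 0 1) (\<lambda>x. \<bar>f x\<bar>)" by (intro continuous_intros f)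
  show "\<forall>x\<in>sphere 0 1. \<bar>f x\<bar> \<le> b"
    using AE_le_imp_le_on_sphere[OF c ae] by blast
qed

lemma Lp_norm_top_finite:
  fixes f :: "real^'n \<Rightarrow> real"
  assumes f: "continuous_on (sphere 0 1) f"
  shows "Lp_norm sphere_measure \<infinity> f < \<infinity>"
proof -
  obtain B where B: "B > 0" "\<And>x. x \<in> sphere 0 1 \<Longrightarrow> \<bar>f x\<bar> \<le> B"
    using continuous_on_sphere_bounded[OF f] by blast
  then have "Lp_norm sphere_measure \<infinity> f \<le> ennreal B"
    using Lp_norm_top_le_iff[OF f, of B] by auto
  then show ?thesis using le_less_trans by fastforce
qed

definition Lp :: "ennreal \<Rightarrow> (real^'n \<Rightarrow> real) \<Rightarrow> real" where
  "Lp p f = enn2real (Lp_norm sphere_measure p f)"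

lemma Lp_norm_eq_Lp:
  fixes f :: "real^'n \<Rightarrow> real"
  assumes "1 \<le> p" and f: "continuous_on (sphere 0 1) f"
  shows "Lp_norm sphere_measure p f = ennreal (Lp p f)"
proof (cases "p = \<infinity>")
  case True
  then show ?thesis using Lp_norm_top_finite[OF f] by (simp add: Lp_def less_top)
next
  case False
  then show ?thesis using Lp_norm_finite_eq[OF assms(1) _ f] by (simp add: Lp_def)
qed

lemma Lp_finite_eq:
  fixes f :: "real^'n \<Rightarrow> real"
  assumes p: "1 \<le> p" "p \<noteq> \<infinity>" and f: "continuous_on (sphere 0 1) f"
  shows "Lp p f = (\<integral>x. \<bar>f x\<bar> powr enn2real p \<partial>sphere_measure) powr (1 / enn2real p)"
  by (simp add: Lp_def Lp_norm_finite_eq[OF assms])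

lemma Lp_top_le_iff:
  fixes f :: "real^'n \<Rightarrow> real"
  assumes f: "continuous_on (sphere 0 1) f" and b: "b \<ge> 0"
  shows "Lp \<infinity> f \<le> b \<longleftrightarrow> (\<forall>x\<in>sphere 0 1. \<bar>f x\<bar> \<le> b)"
  using Lp_norm_top_le_iff[OF f b] Lp_norm_eq_Lp[of \<infinity> f] f b by simp

lemma Lp_nonneg: "Lp p f \<ge> 0"
  by (simp add: Lp_def)

lemma Lp_top_bound:
  fixes f :: "real^'n \<Rightarrow> real"
  assumes f: "continuous_on (sphere 0 1) f" and x: "x \<in> sphere 0 1"
  shows "\<bar>f x\<bar> \<le> Lp \<infinity> f"
  using Lp_top_le_iff[OF f Lp_nonneg, of \<infinity> f] x by blast

lemma powr_convex_nonneg: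
  assumes P: "P \<ge> 1" and t: "0 \<le> t" "t \<le> 1" and x: "0 \<le> x" and y: "0 \<le> (y::real)"
  shows "(t * x + (1 - t) * y) powr P \<le> t * x powr P + (1 - t) * y powr P"
proof -
  have scale: "(t * x) powr P \<le> t * x powr P" if "0 \<le> t" "t \<le> 1" "0 \<le> x" for t x :: real
  proof -
    have "t powr P \<le> t powr 1" using that P by (intro powr_mono') auto
    then have "t powr P \<le> t" using that by simp
    then show ?thesis using that by (simp add: powr_mult mult_right_mono)
  qed
  consider "x = 0" | "y = 0" | "x > 0" "y > 0" using x y by linarith
  then show ?thesis
  proof cases
    case 1 then show ?thesis using scale[of "1 - t" y] t y P by simp
  next
    case 2 then show ?thesis using scale[of t x] t x P by simp
  next
    case 3
    then show ?thesis using convex_onD[OF powr_convex[OF P], of "1 - t" x y] t by simp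
  qed
qed

text \<open>Minkowski's inequality: with a and b the two norms, |f + g| / (a + b) is at most the convex
combination of |f| / a and |g| / b with weights a / (a + b) and b / (a + b); integrate its P-th power.\<close>

lemma Lp_triangle_finite:
  fixes f g :: "real^'n \<Rightarrow> real"
  assumes p: "1 \<le> p" "p \<noteq> \<infinity>" and f: "continuous_on (sphere 0 1) f" and g: "continuous_on (sphere 0 1) g"
  shows "Lp p (\<lambda>x. f x + g x) \<le> Lp p f + Lp p g"
proof -
  define P where "P = enn2real p"
  have P: "P \<ge> 1" unfolding P_def by (rule enn2real_ge_1[OF p])
  have c: "continuous_on (sphere 0 1) (\<lambda>x. \<bar>h x\<bar> powr P)" if "continuous_on (sphere 0 1) h" for h :: "real^'n \<Rightarrow> real"
    using P that by (intro continuous_on_powr' continuous_intros) auto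
  have fg: "continuous_on (sphere 0 1) (\<lambda>x. f x + g x)" by (intro continuous_intros f g)
  note eq = Lp_finite_eq[OF p, folded P_def]
  have z: "h x = 0" if h: "continuous_on (sphere 0 1) h" "Lp p h = 0" "x \<in> sphere 0 1" for h :: "real^'n \<Rightarrow> real" and x
  proof -
    have "(\<integral>x. \<bar>h x\<bar> powr P \<partial>sphere_measure) = 0" using h(2) unfolding eq[OF h(1)] by simp
    from integral_sphere_eq_0_imp[OF c[OF h(1)] _ this h(3)] show ?thesis by simp
  qed
  have int_cong: "(\<integral>x. \<bar>h x\<bar> powr P \<partial>sphere_measure) = (\<integral>x. \<bar>k x\<bar> powr P \<partial>sphere_measure)"
    if "\<And>x. x \<in> sphere 0 1 \<Longrightarrow> h x = k x" for h k :: "real^'n \<Rightarrow> real"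
    by (rule Bochner_Integration.integral_cong) (auto simp: that)
  show ?thesis
  proof (cases "Lp p f = 0 \<or> Lp p g = 0")
    case True
    then show ?thesis
    proof
      assume a: "Lp p f = 0"
      have "Lp p (\<lambda>x. f x + g x) = Lp p g"
        unfolding eq[OF fg] eq[OF g] by (subst int_cong[of _ g]) (simp_all add: z[OF f a])
      then show ?thesis using a by simp
    next
      assume a: "Lp p g = 0"
      have "Lp p (\<lambda>x. f x + g x) = Lp p f"
        unfolding eq[OF fg] eq[OF f] by (subst int_cong[of _ f]) (simp_all add: z[OF g a])
      then show ?thesis using a by simp
    qed
  next
    case False
    define a b where "a = Lp p f" "b = Lp p g"
    have ab: "a > 0" "b > 0" using False Lp_nonneg[of p f] Lp_nonneg[of p g] by (auto simp: a_b_def)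
    have norm: "(\<integral>x. \<bar>h x\<bar> powr P \<partial>sphere_measure) = Lp p h powr P" if "continuous_on (sphere 0 1) h" for h :: "real^'n \<Rightarrow> real"
      unfolding eq[OF that] using P by (simp add: powr_powr)
    let ?t = "a / (a + b)"
    have t: "0 \<le> ?t" "?t \<le> 1" "1 - ?t = b / (a + b)" using ab by (auto simp: field_simps)
    have i: "integrable sphere_measure (\<lambda>x. (a + b) powr P * (?t * (\<bar>f x\<bar> powr P / a powr P)))"
      "integrable sphere_measure (\<lambda>x. (a + b) powr P * ((1 - ?t) * (\<bar>g x\<bar> powr P / b powr P)))"
      using integrable_sphere_continuous[OF c[OF f]] integrable_sphere_continuous[OF c[OF g]] by auto
    have "(\<integral>x. \<bar>f x + g x\<bar> powr P \<partial>sphere_measure) \<le>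
      (\<integral>x. (a + b) powr P * (?t * (\<bar>f x\<bar> powr P / a powr P)) + (a + b) powr P * ((1 - ?t) * (\<bar>g x\<bar> powr P / b powr P)) \<partial>sphere_measure)"
    proof (rule integral_mono)
      fix x :: "real^'n"
      have s: "(a + b) * (?t * (\<bar>f x\<bar> / a) + (1 - ?t) * (\<bar>g x\<bar> / b)) = \<bar>f x\<bar> + \<bar>g x\<bar>"
      proof -
        have c: "(a + b) * (a / (a + b)) = a" "(a + b) * (b / (a + b)) = b" using ab by simp_all
        have "(a + b) * (?t * (\<bar>f x\<bar> / a) + (1 - ?t) * (\<bar>g x\<bar> / b)) = a * (\<bar>f x\<bar> / a) + b * (\<bar>g x\<bar> / b)"
          unfolding t(3) distrib_left mult.assoc[symmetric] c ..
        then show ?thesis using ab by simp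
      qed
      have "\<bar>f x + g x\<bar> powr P \<le> (\<bar>f x\<bar> + \<bar>g x\<bar>) powr P" using P by (intro powr_mono2) auto
      also have "\<dots> = (a + b) powr P * (?t * (\<bar>f x\<bar> / a) + (1 - ?t) * (\<bar>g x\<bar> / b)) powr P"
        unfolding s[symmetric] by (rule powr_mult)
      also have "\<dots> \<le> (a + b) powr P * (?t * (\<bar>f x\<bar> / a) powr P + (1 - ?t) * (\<bar>g x\<bar> / b) powr P)"
        using ab t P by (intro mult_left_mono powr_convex_nonneg) auto
      also have "\<dots> = (a + b) powr P * (?t * (\<bar>f x\<bar> powr P / a powr P)) + (a + b) powr P * ((1 - ?t) * (\<bar>g x\<bar> powr P / b powr P))"
        using ab by (simp add: powr_divide distrib_left)
      finally show "\<bar>f x + g x\<bar> powr P \<le> \<dots>" .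
    qed (use i integrable_sphere_continuous[OF c[OF fg]] in auto)
    also have "\<dots> = (a + b) powr P * (?t * (a powr P / a powr P)) + (a + b) powr P * ((1 - ?t) * (b powr P / b powr P))"
      by (simp only: Bochner_Integration.integral_add[OF i] integral_mult_right_zero integral_divide_zero
          norm[OF f, folded a_b_def] norm[OF g, folded a_b_def])
    also have "\<dots> = (a + b) powr P"
      using ab by (simp add: right_diff_distrib)
    finally have "(\<integral>x. \<bar>f x + g x\<bar> powr P \<partial>sphere_measure) powr (1 / P) \<le> ((a + b) powr P) powr (1 / P)"
      using P by (intro powr_mono2) auto
    also have "\<dots> = a + b" using P ab by (simp add: powr_powr)
    finally show ?thesis unfolding eq[OF fg] a_b_def .
  qed
qed

lemma Lp_sphere_seminorm:
  assumes p: "1 \<le> p"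
  shows "sphere_seminorm (Lp p :: (real^'n \<Rightarrow> real) \<Rightarrow> real)"
proof (cases "p = \<infinity>")
  case True
  show ?thesis
    unfolding True
  proof
    fix f g :: "real^'n \<Rightarrow> real" assume f: "continuous_on (sphere 0 1) f" and g: "continuous_on (sphere 0 1) g"
    have fg: "continuous_on (sphere 0 1) (\<lambda>x. f x + g x)" by (intro continuous_intros f g)
    show "Lp \<infinity> (\<lambda>x. f x + g x) \<le> Lp \<infinity> f + Lp \<infinity> g"
      using Lp_top_bound[OF f] Lp_top_bound[OF g]
      by (subst Lp_top_le_iff[OF fg]) (auto simp: Lp_nonneg intro: order_trans[OF abs_triangle_ineq add_mono])
  next
    fix f :: "real^'n \<Rightarrow> real" and c assume f: "continuous_on (sphere 0 1) f"
    have cf: "continuous_on (sphere 0 1) (\<lambda>x. c * f x)" by (intro continuous_intros f)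
    show "Lp \<infinity> (\<lambda>x. c * f x) \<le> \<bar>c\<bar> * Lp \<infinity> f"
      using Lp_top_bound[OF f]
      by (subst Lp_top_le_iff[OF cf]) (auto simp: Lp_nonneg abs_mult intro!: mult_left_mono)
  next
    fix f :: "real^'n \<Rightarrow> real" and b assume f: "continuous_on (sphere 0 1) f" and b: "\<And>x. x \<in> sphere 0 1 \<Longrightarrow> \<bar>f x\<bar> \<le> b"
    obtain x :: "real^'n" where x: "x \<in> sphere 0 1" using norm_axis_1[of undefined] by (auto intro: that[of "axis undefined 1"])
    have "b \<ge> 0" using b[OF x] by linarith
    then show "Lp \<infinity> f \<le> b" using Lp_top_le_iff[OF f] b by blast
  next
    fix f :: "real^'n \<Rightarrow> real" and T :: "real^'n \<Rightarrow> real^'n"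
    assume f: "continuous_on (sphere 0 1) f" and T: "orthogonal_transformation T"
    have "T x \<in> sphere 0 1" if "x \<in> sphere 0 1" for x
      using that orthogonal_transformation_norm[OF T] by simp
    then show "Lp \<infinity> (\<lambda>x. f (T x)) \<le> Lp \<infinity> f"
      using Lp_top_bound[OF f] Lp_top_le_iff[OF continuous_on_rot[OF f T] Lp_nonneg] by blast
  qed
next
  case False
  define P where "P = enn2real p"
  have P: "P \<ge> 1" unfolding P_def by (rule enn2real_ge_1[OF p False])
  note eq = Lp_finite_eq[OF p False, folded P_def]
  have c: "continuous_on (sphere 0 1) (\<lambda>x. \<bar>h x\<bar> powr P)" if "continuous_on (sphere 0 1) h" for h :: "real^'n \<Rightarrow> real"
    using P that by (intro continuous_on_powr' continuous_intros) auto
  show ?thesis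
  proof
    fix f g :: "real^'n \<Rightarrow> real" assume f: "continuous_on (sphere 0 1) f" and g: "continuous_on (sphere 0 1) g"
    show "Lp p (\<lambda>x. f x + g x) \<le> Lp p f + Lp p g" by (rule Lp_triangle_finite[OF p False f g])
  next
    fix f :: "real^'n \<Rightarrow> real" and a assume f: "continuous_on (sphere 0 1) f"
    have cf: "continuous_on (sphere 0 1) (\<lambda>x. a * f x)" by (intro continuous_intros f)
    have "(\<integral>x. \<bar>a * f x\<bar> powr P \<partial>sphere_measure) = \<bar>a\<bar> powr P * (\<integral>x. \<bar>f x\<bar> powr P \<partial>sphere_measure)"
      by (simp add: abs_mult powr_mult)
    then show "Lp p (\<lambda>x. a * f x) \<le> \<bar>a\<bar> * Lp p f"
      unfolding eq[OF f] eq[OF cf] using P by (simp add: powr_mult powr_powr)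
  next
    fix f :: "real^'n \<Rightarrow> real" and b assume f: "continuous_on (sphere 0 1) f" and b: "\<And>x. x \<in> sphere 0 1 \<Longrightarrow> \<bar>f x\<bar> \<le> b"
    obtain x :: "real^'n" where x: "x \<in> sphere 0 1" using norm_axis_1[of undefined] by (auto intro: that[of "axis undefined 1"])
    have b0: "b \<ge> 0" using b[OF x] by linarith
    have "\<bar>\<integral>x. \<bar>f x\<bar> powr P \<partial>sphere_measure\<bar> \<le> b powr P"
      by (rule integral_sphere_abs_le[OF integrable_sphere_continuous[OF c[OF f]]]) (use b P in \<open>auto intro!: powr_mono2\<close>)
    then have "(\<integral>x. \<bar>f x\<bar> powr P \<partial>sphere_measure) powr (1 / P) \<le> (b powr P) powr (1 / P)"
      using P by (intro powr_mono2) auto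
    then show "Lp p f \<le> b" unfolding eq[OF f] using P b0 by (simp add: powr_powr)
  next
    fix f :: "real^'n \<Rightarrow> real" and T :: "real^'n \<Rightarrow> real^'n"
    assume f: "continuous_on (sphere 0 1) f" and T: "orthogonal_transformation T"
    show "Lp p (\<lambda>x. f (T x)) \<le> Lp p f"
      unfolding eq[OF f] eq[OF continuous_on_rot[OF f T]]
      using integral_sphere_orthogonal[OF T borel_measurable_sphere_continuous[OF c[OF f]]] by simp
  qed
qed

text \<open>A function of size a on a cap and of size a \<surd>t^d outside has Lp norm of order a times the p-th root
of the measure of the cap, t^(d/2). The outer part may even be as large as this measure, since
r^p \<le> r for r \<le> 1. The constant C + 1 \<ge> 1 dominates all its roots, which makes it independent of p.\<close>

lemma Lp_cap_bound:
  "\<exists>C\<ge>1. \<forall>p f y t a. 1 \<le> p \<longrightarrow> continuous_on (sphere 0 1) f \<longrightarrow> y \<in> sphere 0 1 \<longrightarrow> 0 < t \<longrightarrow> t \<le> 1 \<longrightarrow> 0 \<le> a \<longrightarrow>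
     (\<forall>x\<in>cap (y::real^'n) t. \<bar>f x\<bar> \<le> a) \<longrightarrow> (\<forall>x\<in>sphere 0 1 - cap y t. \<bar>f x\<bar> \<le> a * sqrt t ^ (CARD('n) - 1)) \<longrightarrow>
     Lp p f \<le> a * C * t powr (enn2real (of_nat (CARD('n) - 1) / p) / 2)"
proof -
  let ?d = "CARD('n) - 1"
  obtain C where C: "C > 0" "\<And>y t. y \<in> sphere 0 1 \<Longrightarrow> 0 < t \<Longrightarrow> t \<le> 1 \<Longrightarrow>
     measure sphere_measure (cap (y::real^'n) t) \<le> C * sqrt t ^ ?d"
    using measure_cap_upper[where 'n='n] by metis
  have "Lp p f \<le> a * (C + 1) * t powr (enn2real (of_nat ?d / p) / 2)"
    if p: "1 \<le> p" and f: "continuous_on (sphere 0 1) f" and y: "y \<in> sphere 0 1" and t: "0 < t" "t \<le> 1" and a: "0 \<le> a"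
      and in_cap: "\<And>x. x \<in> cap y t \<Longrightarrow> \<bar>f x\<bar> \<le> a"
      and out: "\<And>x. x \<in> sphere 0 1 - cap y t \<Longrightarrow> \<bar>f x\<bar> \<le> a * sqrt t ^ ?d" for p and f :: "real^'n \<Rightarrow> real" and y t a
  proof -
    define r where "r = sqrt t ^ ?d"
    have r: "0 < r" "r \<le> 1" using t by (auto simp: r_def power_le_one)
    have rp: "r = t powr (real ?d / 2)"
      using t by (simp add: r_def powr_half_sqrt[symmetric] powr_realpow[symmetric] powr_powr)
    show ?thesis
    proof (cases "p = \<infinity>")
      case True
      have "\<bar>f x\<bar> \<le> a * (C + 1)" if "x \<in> sphere 0 1" for x
      proof -
        have "\<bar>f x\<bar> \<le> a * 1"
        proof (cases "x \<in> cap y t")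
          case True then show ?thesis using in_cap by simp
        next
          case False
          then have "\<bar>f x\<bar> \<le> a * r" using out[of x] that unfolding r_def by blast
          also have "\<dots> \<le> a * 1" using a r by (intro mult_left_mono) auto
          finally show ?thesis .
        qed
        also have "\<dots> \<le> a * (C + 1)" using a C(1) by (intro mult_left_mono) auto
        finally show ?thesis .
      qed
      then show ?thesis using Lp_top_le_iff[OF f, of "a * (C + 1)"] a C(1) t True by simp
    next
      case False
      define P where "P = enn2real p"
      have P: "P \<ge> 1" unfolding P_def by (rule enn2real_ge_1[OF p False])
      have pP: "p = ennreal P" using False by (simp add: P_def less_top)
      have dp: "enn2real (of_nat ?d / p) = real ?d / P"
        using P by (simp add: pP ennreal_of_nat_eq_real_of_nat divide_ennreal)
      have c: "continuous_on (sphere 0 1) (\<lambda>x. \<bar>f x\<bar> powr P)"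
        using P f by (intro continuous_on_powr' continuous_intros) auto
      have i: "integrable sphere_measure (\<lambda>x. a powr P * indicator (cap y t) x)"
        by (intro integrable_mult_right integrable_real_indicator cap_sets) (simp add: less_top[symmetric])
      have ii: "integrable sphere_measure (\<lambda>x. a powr P * indicator (cap y t) x + a powr P * r)"
        using i by simp
      have "(\<integral>x. \<bar>f x\<bar> powr P \<partial>sphere_measure) \<le> (\<integral>x. a powr P * indicator (cap y t) x + a powr P * r \<partial>sphere_measure)"
      proof (rule integral_mono[OF integrable_sphere_continuous[OF c] ii])
        fix x :: "real^'n" assume "x \<in> space sphere_measure"
        then have x: "x \<in> sphere 0 1" by simp
        show "\<bar>f x\<bar> powr P \<le> a powr P * indicator (cap y t) x + a powr P * r"
        proof (cases "x \<in> cap y t")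
          case True
          then have "\<bar>f x\<bar> powr P \<le> a powr P" using in_cap P by (intro powr_mono2) auto
          then show ?thesis using True r by (simp add: add_increasing2)
        next
          case False
          then have "\<bar>f x\<bar> powr P \<le> (a * r) powr P" using out[of x] x P by (intro powr_mono2) (auto simp: r_def)
          also have "\<dots> = a powr P * r powr P" using a r by (simp add: powr_mult)
          also have "\<dots> \<le> a powr P * r"
          proof (rule mult_left_mono)
            have "r powr P \<le> r powr 1" using r P by (intro powr_mono') auto
            then show "r powr P \<le> r" using r by simp
          qed simp
          finally show ?thesis using False by simp
        qed
      qed
      also have "\<dots> = a powr P * measure sphere_measure (cap y t) + a powr P * r"
      proof -
        have "cap y t \<inter> sphere 0 1 = cap y t" by (auto simp: cap_def)
        then show ?thesis
          using Bochner_Integration.integral_add[OF i, of "\<lambda>_. a powr P * r"] sphere.prob_space[where 'a="real^'n"] by simp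
      qed
      also have "\<dots> \<le> a powr P * (C * r) + a powr P * r"
        using C(2)[OF y t] by (intro add_mono mult_left_mono) (auto simp: r_def)
      also have "\<dots> = a powr P * ((C + 1) * r)" by (simp add: algebra_simps)
      finally have "(\<integral>x. \<bar>f x\<bar> powr P \<partial>sphere_measure) powr (1 / P) \<le> (a powr P * ((C + 1) * r)) powr (1 / P)"
        using P by (intro powr_mono2) auto
      also have "\<dots> = a * ((C + 1) powr (1 / P) * r powr (1 / P))"
        using P a C(1) r by (simp add: powr_mult powr_powr)
      also have "\<dots> \<le> a * ((C + 1) powr 1 * r powr (1 / P))"
        using P a C(1) by (intro mult_left_mono mult_right_mono powr_mono) auto
      also have "\<dots> = a * (C + 1) * t powr (real ?d / P / 2)"
        unfolding rp powr_powr using C(1) by (simp add: mult.commute)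
      finally show ?thesis unfolding dp Lp_finite_eq[OF p False f] P_def[symmetric] .
    qed
  qed
  then show ?thesis using C(1) by (intro exI[of _ "C + 1"]) auto
qed

section \<open>From the Lp norm to the Sobolev norm\<close>

lemma Lp_space_integrable:
  fixes g :: "real^'n \<Rightarrow> real"
  assumes p: "1 \<le> p" and g: "g \<in> Lp_space sphere_measure p"
  shows "integrable sphere_measure g"
proof (cases "p = \<infinity>")
  case True
  have m: "g \<in> borel_measurable sphere_measure" and fin: "esssup sphere_measure (\<lambda>x. ennreal \<bar>g x\<bar>) < \<infinity>"
    using g True by (auto simp: Lp_space_def Lp_norm_def)
  have "AE x in sphere_measure. norm (g x) \<le> enn2real (esssup sphere_measure (\<lambda>x. ennreal \<bar>g x\<bar>))"
    using esssup_AE[of "\<lambda>x. ennreal \<bar>g x\<bar>" sphere_measure]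
  proof eventually_elim
    case (elim x)
    have "enn2real (ennreal \<bar>g x\<bar>) \<le> enn2real (esssup sphere_measure (\<lambda>x. ennreal \<bar>g x\<bar>))"
      using elim fin by (intro enn2real_mono) auto
    then show ?case by simp
  qed
  then show ?thesis by (rule sphere.integrable_const_bound) (rule m)
next
  case False
  define P where "P = enn2real p"
  have P: "P \<ge> 1" unfolding P_def by (rule enn2real_ge_1[OF p False])
  have m [measurable]: "g \<in> borel_measurable sphere_measure" and "(\<integral>\<^sup>+ x. ennreal (\<bar>g x\<bar> powr P) \<partial>sphere_measure) < \<infinity>"
    using g False by (auto simp: Lp_space_def Lp_norm_def ennpowr_def P_def less_top split: if_splits)
  then have i: "integrable sphere_measure (\<lambda>x. \<bar>g x\<bar> powr P)"
    by (intro integrableI_bounded) auto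
  show ?thesis
  proof (rule Bochner_Integration.integrable_bound)
    show "integrable sphere_measure (\<lambda>x. 1 + \<bar>g x\<bar> powr P)" using i by simp
    show "AE x in sphere_measure. norm (g x) \<le> norm (1 + \<bar>g x\<bar> powr P)"
    proof (rule AE_I2)
      fix x
      show "norm (g x) \<le> norm (1 + \<bar>g x\<bar> powr P)"
      proof (cases "\<bar>g x\<bar> \<le> 1")
        case False
        then have "\<bar>g x\<bar> powr 1 \<le> \<bar>g x\<bar> powr P" using P by (intro powr_mono) auto
        then show ?thesis using False by simp
      qed (simp add: add_increasing2)
    qed
  qed (rule m)
qed

lemma Lp_norm_cong_AE:
  assumes f: "f \<in> borel_measurable M" and g: "g \<in> borel_measurable M" and ae: "AE x in M. f x = g x"
  shows "Lp_norm M p f = Lp_norm M p g"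
proof -
  have "esssup M (\<lambda>x. ennreal \<bar>f x\<bar>) = esssup M (\<lambda>x. ennreal \<bar>g x\<bar>)"
    using f g by (intro esssup_AE_cong) (use ae in \<open>auto elim!: eventually_mono\<close>)
  moreover have "(\<integral>\<^sup>+ x. ennreal (\<bar>f x\<bar> powr r) \<partial>M) = (\<integral>\<^sup>+ x. ennreal (\<bar>g x\<bar> powr r) \<partial>M)" for r
    using ae by (intro nn_integral_cong_AE) (auto elim!: eventually_mono)
  ultimately show ?thesis by (simp add: Lp_norm_def)
qed

lemma continuous_Lp_space:
  fixes f :: "real^'n \<Rightarrow> real"
  assumes "1 \<le> p" "continuous_on (sphere 0 1) f"
  shows "f \<in> Lp_space sphere_measure p"
  using borel_measurable_sphere_continuous[OF assms(2)] Lp_norm_eq_Lp[OF assms] by (simp add: Lp_space_def)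

text \<open>The Sobolev norm is defined through a chosen Bessel derivative; by uniqueness almost everywhere any
other one has the same norm.\<close>

lemma sobolev_continuous:
  fixes f g :: "real^'n \<Rightarrow> real"
  assumes p: "1 \<le> p" and n: "CARD('n) \<ge> 2"
    and f: "continuous_on (sphere 0 1) f" and g: "continuous_on (sphere 0 1) g" and b: "is_bessel_derivative s f g"
  shows "f \<in> sobolev_space p s" "sobolev_norm p s f = ennreal (Lp p g)"
proof -
  have gL: "g \<in> Lp_space sphere_measure p" by (rule continuous_Lp_space[OF p g])
  show "f \<in> sobolev_space p s"
    using continuous_Lp_space[OF p f] gL b by (auto simp: sobolev_space_def)
  let ?h = "bessel_derivative p s f"
  have h: "?h \<in> Lp_space sphere_measure p \<and> is_bessel_derivative s f ?h"
    unfolding bessel_derivative_def by (rule someI[of _ g]) (use gL b in simp)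
  have "AE x in sphere_measure. ?h x = g x"
    using h b by (intro bessel_derivative_unique[OF _ _ n] Lp_space_integrable[OF p] gL) auto
  then have "Lp_norm sphere_measure p ?h = Lp_norm sphere_measure p g"
    using h gL by (intro Lp_norm_cong_AE) (auto simp: Lp_space_def)
  then show "sobolev_norm p s f = ennreal (Lp p g)"
    using Lp_norm_eq_Lp[OF p g] by (simp add: sobolev_norm_def)
qed

text \<open>The function f / B belongs to the unit ball of the Sobolev space.\<close>

lemma wce_ge_quotient:
  fixes f g :: "real^'n \<Rightarrow> real"
  assumes p: "1 \<le> p" and n: "CARD('n) \<ge> 2"
    and f: "continuous_on (sphere 0 1) f" and g: "continuous_on (sphere 0 1) g" and b: "is_bessel_derivative s f g"
    and B: "B > 0" "Lp p g \<le> B"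
  shows "ennreal (\<bar>equal_weight_rule X f - (\<integral>x. f x \<partial>sphere_measure)\<bar> / B) \<le> wce X p s"
proof -
  let ?f = "\<lambda>x. (1 / B) * f x" and ?g = "\<lambda>x. (1 / B) * g x"
  have fc: "continuous_on (sphere 0 1) ?f" and gc: "continuous_on (sphere 0 1) ?g"
    by (intro continuous_intros f g)+
  have hp: "harmonic_proj l (\<lambda>x. c * u x) x = c * harmonic_proj l u x" for l c x and u :: "real^'n \<Rightarrow> real"
    by (simp add: harmonic_proj_def mult.assoc)
  have b': "is_bessel_derivative s ?f ?g"
    using b unfolding is_bessel_derivative_def hp by (simp add: mult.left_commute)
  have "Lp p ?g \<le> \<bar>1 / B\<bar> * Lp p g"
    by (rule sphere_seminorm.scale[OF Lp_sphere_seminorm[OF p] g])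
  also have "\<dots> \<le> 1" using B by (simp add: divide_le_eq)
  finally have "sobolev_norm p s ?f \<le> 1"
    using sobolev_continuous(2)[OF p n fc gc b'] by simp
  then have "?f \<in> {f \<in> sobolev_space p s. continuous_on (sphere 0 1) f \<and> sobolev_norm p s f \<le> 1}"
    using sobolev_continuous(1)[OF p n fc gc b'] fc by simp
  then have "ennreal \<bar>equal_weight_rule X ?f - (\<integral>x. ?f x \<partial>sphere_measure)\<bar> \<le> wce X p s"
    unfolding wce_def by (rule SUP_upper)
  moreover have "equal_weight_rule X ?f - (\<integral>x. ?f x \<partial>sphere_measure)
      = (equal_weight_rule X f - (\<integral>x. f x \<partial>sphere_measure)) / B"
    by (simp add: equal_weight_rule_def sum_distrib_left[symmetric] sum_divide_distrib[symmetric] diff_divide_distrib)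
  ultimately show ?thesis using B by (simp add: abs_divide)
qed

section \<open>Bessel derivatives of zonal polynomials\<close>

text \<open>Write s / 2 = m + b with 0 \<le> b < 1 and apply the moment inequality to A^m F, where A = 1 - \<Delta>. The
fractional power is a finite sum over zonal harmonics; it is a Bessel derivative because harmonics
of different degrees are orthogonal.\<close>

lemma zonal_bessel_derivative:
  fixes y :: "real^'n" and F :: "real poly"
  assumes y: "y \<in> sphere 0 1" and n: "CARD('n) \<ge> 2" and p: "1 \<le> p" and s: "s > 0" and t: "t > 0"
    and m: "m = nat \<lfloor>s / 2\<rfloor>"
  shows "\<exists>g. continuous_on (sphere 0 1) g \<and> is_bessel_derivative s (zonal F y) g \<and>
    Lp p g \<le> 2 * t powr (real m - s / 2) *
      (Lp p (zonal ((zonal_bessel (CARD('n) - 1) ^^ m) F) y)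
        + t * Lp p (zonal ((zonal_bessel (CARD('n) - 1) ^^ Suc m) F) y))"
proof -
  let ?d = "CARD('n) - 1"
  let ?lam = "laplace_beltrami_eigenvalue ?d"
  define L where "L = degree F"
  obtain a where a: "F = (\<Sum>l\<le>L. smult (a l) (gegenbauer_poly CARD('n) l))"
    using gegenbauer_expansion[of F L "CARD('n)"] by (auto simp: L_def)
  have lam: "?lam l \<ge> 0" for l
    using n by (cases l) (auto simp: laplace_beltrami_eigenvalue_def)
  have zc: "continuous_on (sphere 0 1) (zonal G y)" for G
    by (intro continuous_on_real_polynomial real_polynomial_zonal)
  have ec: "continuous_on (sphere 0 1) (zonal_harmonic l y)" for l
    unfolding zonal_harmonic_def by (rule zc)
  interpret sphere_seminorm "Lp p :: (real^'n \<Rightarrow> real) \<Rightarrow> real" by (rule Lp_sphere_seminorm[OF p])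
  interpret S: sphere_spectral "Lp p :: (real^'n \<Rightarrow> real) \<Rightarrow> real" "\<lambda>l. zonal_harmonic l y" ?lam L
    by unfold_locales (use ec zonal_harmonic_eigen[OF y n] lam in auto)
  let ?b = "\<lambda>l. (1 + ?lam l) ^ m * a l"
  have m1: "real m \<le> s / 2" "s / 2 < real m + 1"
  proof -
    have "real m = of_int \<lfloor>s / 2\<rfloor>" using s m by simp
    then show "real m \<le> s / 2" "s / 2 < real m + 1"
      using of_int_floor_le[of "s / 2"] real_of_int_floor_add_one_gt[of "s / 2"] by simp_all
  qed
  have pw: "(1 + ?lam l) powr (s / 2 - real m) * ?b l = (1 + ?lam l) powr (s / 2) * a l" for l
    using lam[of l] by (simp add: powr_diff powr_realpow add_pos_nonneg)
  define g where "g = S.synth (\<lambda>l. (1 + ?lam l) powr (s / 2) * a l)"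
  have gc: "continuous_on (sphere 0 1) g" unfolding g_def by (rule S.continuous_on_synth)
  have sp: "Lp p (zonal ((zonal_bessel ?d ^^ k) F) y) = Lp p (S.synth (\<lambda>l. (1 + ?lam l) ^ k * a l))" for k
    by (rule cong[OF zc S.continuous_on_synth]) (simp only: zonal_bessel_power_spectral[OF y n a] S.synth_def)
  have "Lp p g \<le> 2 * t powr (- (s / 2 - real m)) * (Lp p (S.synth ?b) + t * Lp p (S.synth (\<lambda>l. (1 + ?lam l) * ?b l)))"
    using S.moment_inequality[of "s / 2 - real m" t ?b] m1 t unfolding g_def pw by simp
  then have "Lp p g \<le> 2 * t powr (real m - s / 2) *
      (Lp p (zonal ((zonal_bessel ?d ^^ m) F) y) + t * Lp p (zonal ((zonal_bessel ?d ^^ Suc m) F) y))"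
    unfolding sp by (simp only: power_Suc mult.assoc minus_diff_eq)
  moreover have "is_bessel_derivative s (zonal F y) g"
  proof (rule is_bessel_derivativeI)
    show "integrable sphere_measure (zonal F y)" "integrable sphere_measure g"
      by (intro integrable_sphere_continuous zc gc)+
    fix l and h :: "real^'n \<Rightarrow> real" assume h: "h \<in> harmonic_homogeneous_polynomials l"
    have syn: "ip (S.synth c) h = (if l \<le> L then c l * ip (zonal_harmonic l y) h else 0)" for c
    proof -
      have "ip (S.synth c) h = (\<Sum>k\<le>L. c k * ip (zonal_harmonic k y) h)"
        unfolding S.synth_def[abs_def] by (rule ip_sum_left) (auto intro: ec harmonic_continuous[OF h])
      also have "\<dots> = (\<Sum>k\<le>L. if k = l then c l * ip (zonal_harmonic l y) h else 0)"
        using zonal_harmonic_orthogonal[OF y n _ h] by (intro sum.cong) auto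
      also have "\<dots> = (if l \<le> L then c l * ip (zonal_harmonic l y) h else 0)" by simp
      finally show ?thesis .
    qed
    have "ip (zonal F y) h = ip (S.synth a) h"
    proof (rule ip_cong)
      fix x :: "real^'n" assume "x \<in> sphere 0 1"
      from zonal_bessel_power_spectral[OF y n a this, of 0]
      show "zonal F y x * h x = S.synth a x * h x" by (simp add: S.synth_def)
    qed
    then show "ip g h = (1 + ?lam l) powr (s / 2) * ip (zonal F y) h"
      unfolding g_def syn by simp
  qed
  ultimately show ?thesis using gc by blast
qed

section \<open>The lower bound for the worst-case error\<close>

lemma polynomial_bump:
  assumes t: "0 < t" "t \<le> (1::real)" and e: "e > 0"
  shows "\<exists>F::real poly.
    (\<forall>i\<le>R. \<forall>u\<in>{1 - t..1}. \<bar>poly ((pderiv ^^ i) F) u\<bar> \<le> fact (Suc R) * t ^ (Suc R - i) + e) \<and>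
    (\<forall>i\<le>R. \<forall>u\<in>{-1..1 - t}. \<bar>poly ((pderiv ^^ i) F) u\<bar> \<le> e) \<and>
    (\<forall>u\<in>{-1..1}. max 0 (u - (1 - t)) ^ Suc R - e \<le> poly F u)"
proof -
  let ?c = "1 - t"
  have "-1 \<le> ?c" using t by simp
  from truncated_power_approx[OF this e, of R] obtain F where
    F: "\<And>i u. i \<le> R \<Longrightarrow> u \<in> {-1..1} \<Longrightarrow> \<bar>poly ((pderiv ^^ i) F) u - truncated_power_deriv ?c R i u\<bar> \<le> e"
    by blast
  have "\<bar>poly ((pderiv ^^ i) F) u\<bar> \<le> fact (Suc R) * t ^ (Suc R - i) + e" if i: "i \<le> R" and u: "u \<in> {1 - t..1}" for i u
  proof -
    have "\<bar>truncated_power_deriv ?c R i u\<bar> \<le> fact (Suc R) * t ^ (Suc R - i)"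
    proof -
      have "max 0 (u - ?c) ^ (Suc R - i) \<le> t ^ (Suc R - i)" using u t by (intro power_mono) auto
      moreover have "fact (Suc R) / fact (Suc R - i) \<le> (fact (Suc R) :: real)"
        using fact_ge_1[of "Suc R - i", where 'a=real] by (simp add: divide_le_eq mult_le_cancel_left1 del: fact_Suc)
      ultimately have "fact (Suc R) / fact (Suc R - i) * max 0 (u - ?c) ^ (Suc R - i) \<le> fact (Suc R) * t ^ (Suc R - i)"
        by (intro mult_mono) auto
      then show ?thesis unfolding truncated_power_deriv_def by (simp add: abs_mult del: fact_Suc)
    qed
    then show ?thesis using F[OF i, of u] u t by (auto simp: abs_le_iff)
  qed
  moreover have "\<bar>poly ((pderiv ^^ i) F) u\<bar> \<le> e" if i: "i \<le> R" and u: "u \<in> {-1..1 - t}" for i u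
  proof -
    have "truncated_power_deriv ?c R i u = 0" using u i by (simp add: truncated_power_deriv_def)
    then show ?thesis using F[OF i, of u] u t by auto
  qed
  moreover have "max 0 (u - (1 - t)) ^ Suc R - e \<le> poly F u" if u: "u \<in> {-1..1}" for u
  proof -
    have "truncated_power_deriv ?c R 0 u = max 0 (u - ?c) ^ Suc R"
      by (simp add: truncated_power_deriv_def del: fact_Suc)
    then show ?thesis using F[of 0 u] u by (simp add: abs_le_iff)
  qed
  ultimately show ?thesis by blast
qed

text \<open>Let F be the polynomial bump of exponent K for the cap of height t, and d the dimension of the
sphere. The integral of F(x \<bullet> y) is of order t^(K + d/2), and |F| is smaller than any prescribed
fraction of this at the nodes. Each application of 1 - \<Delta> costs a factor 1/t, so the Sobolev norm is of order
t^(K - s/2 + d/(2p)) by the moment inequality with parameter t. The quotient is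
t^((s + d - d/p)/2).\<close>

lemma wce_lower_bound_empty_cap:
  assumes n: "CARD('n) \<ge> 2" and s: "s > 0"
  shows "\<exists>E>0. \<forall>p y t. \<forall>X :: (real^'n) set. 1 \<le> p \<longrightarrow> y \<in> sphere 0 1 \<longrightarrow> 0 < t \<longrightarrow> t \<le> 1 \<longrightarrow>
      X \<subseteq> sphere 0 1 \<longrightarrow> finite X \<longrightarrow> X \<noteq> {} \<longrightarrow> (\<forall>x\<in>X. x \<bullet> y \<le> 1 - t) \<longrightarrow>
      ennreal (E * t powr ((s + (real (CARD('n) - 1) - enn2real (of_nat (CARD('n) - 1) / p))) / 2)) \<le> wce X p s"
proof -
  let ?d = "CARD('n) - 1"
  define m where "m = nat \<lfloor>s / 2\<rfloor>"
  \<comment> \<open>m + 1 applications of an operator of second order\<close>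
  define R where "R = 2 * Suc m"
  define K where "K = Suc R"
  define Cs where "Cs = 3 + 2 * real R + real ?d + real R * (real R + real ?d)"
  have Cs: "Cs \<ge> 1"
  proof -
    have "0 \<le> real R * (real R + real ?d)" by simp
    then show ?thesis unfolding Cs_def by linarith
  qed
  obtain C1 where C1: "C1 > 0" "\<And>y t. y \<in> sphere 0 1 \<Longrightarrow> 0 < t \<Longrightarrow> t \<le> 1 \<Longrightarrow>
     measure sphere_measure (cap (y::real^'n) t) \<ge> C1 * sqrt t ^ ?d"
    using measure_cap_lower[where 'n='n] by metis
  obtain C2 where C2: "C2 \<ge> 1" "\<And>p (f :: real^'n \<Rightarrow> real) y t a. 1 \<le> p \<Longrightarrow> continuous_on (sphere 0 1) f \<Longrightarrow> y \<in> sphere 0 1 \<Longrightarrow> 0 < t \<Longrightarrow> t \<le> 1 \<Longrightarrow> 0 \<le> a \<Longrightarrow>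
     (\<And>x. x \<in> cap y t \<Longrightarrow> \<bar>f x\<bar> \<le> a) \<Longrightarrow> (\<And>x. x \<in> sphere 0 1 - cap y t \<Longrightarrow> \<bar>f x\<bar> \<le> a * sqrt t ^ ?d) \<Longrightarrow>
     Lp p f \<le> a * C2 * t powr (enn2real (of_nat ?d / p) / 2)"
    using Lp_cap_bound[where 'n='n] by blast
  define c0 where "c0 = C1 * (1 / 2) ^ K * sqrt (1 / 2) ^ ?d"
  have c0: "c0 > 0" using C1 by (simp add: c0_def)
  define D where "D = 8 * Cs ^ Suc m * fact K * C2"
  have D: "D > 0" using Cs C2(1) by (simp add: D_def)
  have main: "ennreal (c0 / (2 * D) * t powr ((s + (real ?d - enn2real (of_nat ?d / p))) / 2)) \<le> wce X p s"
    if p: "1 \<le> p" and y: "y \<in> sphere 0 1" and t: "0 < t" "t \<le> 1" and X: "X \<subseteq> sphere 0 1" "finite X" "X \<noteq> {}"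
      and Xy: "\<And>x. x \<in> X \<Longrightarrow> x \<bullet> y \<le> 1 - t" for p y t and X :: "(real^'n) set"
  proof -
    define \<tau> where "\<tau> = enn2real (of_nat ?d / p)"
    define r where "r = sqrt t ^ ?d"
    have r: "0 < r" "r \<le> 1" using t by (auto simp: r_def power_le_one)
    have rp: "r = t powr (real ?d / 2)"
      using t by (simp add: r_def powr_half_sqrt[symmetric] powr_realpow[symmetric] powr_powr)
    \<comment> \<open>at most a quarter of the lower bound for the integral, so that the errors in the integral and at the nodes leave half of it\<close>
    define e where "e = min 1 (c0 / 4) * (t ^ K * r)"
    have tr: "t ^ K * r > 0" using t r by simp
    have e: "e > 0" unfolding e_def using c0 tr by (intro mult_pos_pos[OF _ tr]) simp
    have e1: "e \<le> t ^ K * r"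
    proof -
      have "e \<le> 1 * (t ^ K * r)" unfolding e_def using tr by (intro mult_right_mono) auto
      then show ?thesis by simp
    qed
    have e2: "e \<le> c0 / 4 * (t ^ K * r)" unfolding e_def using tr by (intro mult_right_mono) auto
    have e3: "e \<le> t ^ K"
    proof -
      have "t ^ K * r \<le> t ^ K * 1" using t r by (intro mult_left_mono) auto
      then show ?thesis using e1 by simp
    qed
    obtain F :: "real poly" where F1: "\<And>i u. i \<le> R \<Longrightarrow> u \<in> {1 - t..1} \<Longrightarrow> \<bar>poly ((pderiv ^^ i) F) u\<bar> \<le> fact K * t ^ (K - i) + e"
      and F2: "\<And>i u. i \<le> R \<Longrightarrow> u \<in> {-1..1 - t} \<Longrightarrow> \<bar>poly ((pderiv ^^ i) F) u\<bar> \<le> e"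
      and F3: "\<And>u. u \<in> {-1..1} \<Longrightarrow> max 0 (u - (1 - t)) ^ K - e \<le> poly F u"
      using polynomial_bump[OF t e, of R] unfolding K_def by blast
    let ?w = "1 / t"
    define M where "M = 2 * fact K * t ^ K"
    have M: "M \<ge> 0" using t by (simp add: M_def)
    have F1': "\<bar>poly ((pderiv ^^ i) F) u\<bar> \<le> M * ?w ^ i" if i: "i \<le> R" and u: "u \<in> {1 - t..1}" for i u
    proof -
      have iK: "i \<le> K" using i by (simp add: K_def)
      have "t ^ K * ?w ^ i = t ^ (K - i)" using t iK by (simp add: power_diff power_one_over)
      moreover have "t ^ K \<le> t ^ (K - i)" using t by (intro power_decreasing) auto
      moreover have "1 * t ^ (K - i) \<le> fact K * t ^ (K - i)" using t fact_ge_1 by (intro mult_right_mono) auto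
      ultimately have "fact K * t ^ (K - i) + e \<le> 2 * (fact K * (t ^ K * ?w ^ i))" using e3 by simp
      then show ?thesis using F1[OF i u] unfolding M_def by (simp only: mult.assoc)
    qed
    have xy1: "\<bar>x \<bullet> y\<bar> \<le> 1" if "x \<in> sphere 0 1" for x
      using Cauchy_Schwarz_ineq2[of x y] that y by simp
    have zc: "continuous_on (sphere 0 1) (zonal G y)" for G
      by (intro continuous_on_real_polynomial real_polynomial_zonal)
    have Lpk: "Lp p (zonal ((zonal_bessel ?d ^^ k) F) y) \<le> (Cs ^ k * M * ?w ^ k) * C2 * t powr (\<tau> / 2)" if k: "2 * k \<le> R" for k
      unfolding \<tau>_def
    proof (rule C2(2)[OF p zc y t])
      show "0 \<le> Cs ^ k * M * ?w ^ k" using Cs M t by simp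
    next
      fix x assume "x \<in> cap y t"
      then have x: "x \<in> sphere 0 1" and u: "1 - t \<le> x \<bullet> y" by (auto simp: cap_def)
      have u1: "x \<bullet> y \<le> 1" using xy1[OF x] by simp
      have "1 - (x \<bullet> y)\<^sup>2 = (1 - x \<bullet> y) * (1 + x \<bullet> y)" by (simp add: power2_eq_square algebra_simps)
      also have "\<dots> \<le> t * 2" using u u1 t by (intro mult_mono) auto
      finally have "1 - (x \<bullet> y)\<^sup>2 \<le> 2 / ?w" by simp
      moreover have "\<bar>poly ((pderiv ^^ i) F) (x \<bullet> y)\<bar> \<le> M * ?w ^ i" if "i \<le> R" for i
        using F1'[OF that] u u1 by simp
      moreover have "?w \<ge> 1" "0 + 2 * k \<le> R" using t k by simp_all
      ultimately have "\<bar>poly ((pderiv ^^ 0) ((zonal_bessel ?d ^^ k) F)) (x \<bullet> y)\<bar> \<le> Cs ^ k * M * ?w ^ (0 + k)"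
        unfolding Cs_def by (intro zonal_bessel_bound xy1[OF x] M)
      then show "\<bar>zonal ((zonal_bessel ?d ^^ k) F) y x\<bar> \<le> Cs ^ k * M * ?w ^ k"
        by (simp only: zonal_def funpow.simps(1) id_apply add_0)
    next
      fix x assume "x \<in> sphere 0 1 - cap y t"
      then have x: "x \<in> sphere 0 1" and u: "x \<bullet> y \<le> 1 - t" by (auto simp: cap_def)
      have u1: "-1 \<le> x \<bullet> y" using xy1[OF x] by simp
      have F2': "\<bar>poly ((pderiv ^^ i) F) (x \<bullet> y)\<bar> \<le> e * 1 ^ i" if "i \<le> R" for i
        using F2[OF that, of "x \<bullet> y"] u u1 by simp
      have "0 \<le> (x \<bullet> y)\<^sup>2" by simp
      then have "1 - (x \<bullet> y)\<^sup>2 \<le> 2 / 1" by linarith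
      moreover have "(1::real) \<ge> 1" "0 + 2 * k \<le> R" "0 \<le> e" using e k by simp_all
      ultimately have "\<bar>poly ((pderiv ^^ 0) ((zonal_bessel ?d ^^ k) F)) (x \<bullet> y)\<bar> \<le> Cs ^ k * e * 1 ^ (0 + k)"
        unfolding Cs_def by (intro zonal_bessel_bound xy1[OF x] F2')
      then have "\<bar>zonal ((zonal_bessel ?d ^^ k) F) y x\<bar> \<le> Cs ^ k * e"
        by (simp only: zonal_def funpow.simps(1) id_apply add_0 power_one mult_1_right)
      also have "\<dots> \<le> Cs ^ k * ((M * ?w ^ k) * r)"
      proof (intro mult_left_mono)
        have "t ^ K * r \<le> (M * ?w ^ k) * r"
        proof (intro mult_right_mono)
          have "1 \<le> 2 * (fact K :: real)" using fact_ge_1[of K, where 'a=real] by linarith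
          then have "1 * t ^ K \<le> (2 * fact K) * t ^ K" by (rule mult_right_mono) (use t in simp)
          then have "t ^ K \<le> M * 1" unfolding M_def mult_1_left mult_1_right .
          also have "M * 1 \<le> M * ?w ^ k" by (rule mult_left_mono[OF one_le_power M]) (use t in simp)
          finally show "t ^ K \<le> M * ?w ^ k" .
        qed (use r in simp)
        then show "e \<le> (M * ?w ^ k) * r" using e1 by simp
      qed (use Cs in simp)
      finally show "\<bar>zonal ((zonal_bessel ?d ^^ k) F) y x\<bar> \<le> Cs ^ k * M * ?w ^ k * sqrt t ^ ?d"
        by (simp only: r_def mult.assoc)
    qed
    obtain g where g: "continuous_on (sphere 0 1) g" "is_bessel_derivative s (zonal F y) g"
      "Lp p g \<le> 2 * t powr (real m - s / 2) * (Lp p (zonal ((zonal_bessel ?d ^^ m) F) y)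
        + t * Lp p (zonal ((zonal_bessel ?d ^^ Suc m) F) y))"
      using zonal_bessel_derivative[OF y n p s t(1) m_def] by blast
    \<comment> \<open>the bound for the Sobolev norm\<close>
    let ?B = "D * t powr (real K - s / 2 + \<tau> / 2)"
    have B: "?B > 0" using D t by simp
    have gB: "Lp p g \<le> ?B"
    proof -
      let ?T = "t powr (\<tau> / 2)"
      let ?Q = "Cs ^ Suc m * M * ?w ^ m * C2 * ?T"
      have Q: "?Q \<ge> 0" using Cs M t C2(1) by simp
      have "Lp p (zonal ((zonal_bessel ?d ^^ m) F) y) \<le> (Cs ^ m * M * ?w ^ m) * C2 * ?T"
        by (rule Lpk) (simp add: R_def)
      also have "\<dots> \<le> ?Q"
        using Cs M t C2(1) by (intro mult_right_mono power_increasing) auto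
      finally have 1: "Lp p (zonal ((zonal_bessel ?d ^^ m) F) y) \<le> ?Q" .
      have "t * Lp p (zonal ((zonal_bessel ?d ^^ Suc m) F) y) \<le> t * ((Cs ^ Suc m * M * ?w ^ Suc m) * C2 * ?T)"
        by (rule mult_left_mono[OF Lpk]) (use t in \<open>auto simp: R_def\<close>)
      also have "\<dots> = ?Q" using t by simp
      finally have 2: "t * Lp p (zonal ((zonal_bessel ?d ^^ Suc m) F) y) \<le> ?Q" .
      have "Lp p g \<le> 2 * t powr (real m - s / 2) * (?Q + ?Q)"
        by (rule order_trans[OF g(3)]) (use 1 2 in \<open>intro mult_left_mono add_mono, auto\<close>)
      also have "\<dots> = D * (t powr (real m - s / 2) * (t ^ K * ?w ^ m) * ?T)"
        by (simp add: D_def M_def)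
      also have "t powr (real m - s / 2) * (t ^ K * ?w ^ m) * ?T = t powr (real K - s / 2 + \<tau> / 2)"
      proof -
        have "t ^ K * ?w ^ m = t powr (real K - real m)"
          using t by (simp add: powr_diff powr_realpow power_one_over divide_inverse power_inverse)
        then show ?thesis using t by (simp add: powr_add[symmetric])
      qed
      finally show ?thesis .
    qed
    have diff: "c0 / 2 * (t ^ K * r) \<le> \<bar>equal_weight_rule X (zonal F y) - (\<integral>x. zonal F y x \<partial>sphere_measure)\<bar>"
    proof -
      have X0: "real (card X) > 0" using X by (simp add: card_gt_0_iff)
      have "equal_weight_rule X (zonal F y) \<le> e"
      proof -
        have "(\<Sum>x\<in>X. zonal F y x) \<le> (\<Sum>x\<in>X. e)"
        proof (rule sum_mono)
          fix x assume x: "x \<in> X"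
          then have "x \<bullet> y \<in> {-1..1 - t}" using Xy[OF x] xy1[of x] X by auto
          from F2[OF _ this, of 0] show "zonal F y x \<le> e" by (simp add: zonal_def)
        qed
        then show ?thesis using X0 by (simp add: equal_weight_rule_def pos_divide_le_eq mult.commute)
      qed
      moreover have "c0 * (t ^ K * r) - e \<le> (\<integral>x. zonal F y x \<partial>sphere_measure)"
      proof -
        let ?h = "\<lambda>x. (t / 2) ^ K * indicator (cap y (t / 2)) x - e"
        have ih: "integrable sphere_measure (\<lambda>x::real^'n. (t / 2) ^ K * indicator (cap y (t / 2)) x)"
          by (intro integrable_mult_right integrable_real_indicator cap_sets) (simp add: less_top[symmetric])
        have cs: "cap y (t / 2) \<inter> sphere 0 1 = cap y (t / 2)" by (auto simp: cap_def)
        have "c0 * (t ^ K * r) = (t / 2) ^ K * (C1 * sqrt (t / 2) ^ ?d)"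
          by (simp add: c0_def r_def power_divide real_sqrt_divide)
        also have "\<dots> \<le> (t / 2) ^ K * measure sphere_measure (cap y (t / 2))"
          using C1(2)[OF y, of "t / 2"] t by (intro mult_left_mono) auto
        finally have "c0 * (t ^ K * r) - e \<le> (t / 2) ^ K * measure sphere_measure (cap y (t / 2)) - e" by simp
        also have "\<dots> = (\<integral>x. ?h x \<partial>sphere_measure)"
          using Bochner_Integration.integral_diff[OF ih, of "\<lambda>_. e"] sphere.prob_space[where 'a="real^'n"] cs by simp
        also have "\<dots> \<le> (\<integral>x. zonal F y x \<partial>sphere_measure)"
        proof (rule integral_mono[OF _ integrable_sphere_continuous[OF zc]])
          show "integrable sphere_measure ?h" using ih by simp
          fix x :: "real^'n" assume "x \<in> space sphere_measure"
          then have x: "x \<in> sphere 0 1" by simp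
          have "(t / 2) ^ K * indicator (cap y (t / 2)) x \<le> max 0 (x \<bullet> y - (1 - t)) ^ K"
          proof (cases "x \<in> cap y (t / 2)")
            case True
            then have "1 - t / 2 \<le> x \<bullet> y" unfolding cap_def by blast
            then have "t / 2 \<le> max 0 (x \<bullet> y - (1 - t))" by (intro max.coboundedI2) linarith
            then have "(t / 2) ^ K \<le> max 0 (x \<bullet> y - (1 - t)) ^ K" by (rule power_mono) (use t in simp)
            then show ?thesis using True by (simp only: indicator_simps mult_1_right)
          qed simp
          moreover have "max 0 (x \<bullet> y - (1 - t)) ^ K - e \<le> zonal F y x"
            using F3[of "x \<bullet> y"] xy1[OF x] by (simp add: zonal_def abs_le_iff)
          ultimately show "?h x \<le> zonal F y x" by linarith
        qed
        finally show ?thesis .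
      qed
      ultimately show ?thesis using e2 by linarith
    qed
    have "c0 / (2 * D) * t powr ((s + (real ?d - \<tau>)) / 2) = c0 / 2 * (t ^ K * r) / ?B"
    proof -
      have 1: "t ^ K * r = t powr (real K + real ?d / 2)" unfolding rp using t by (simp add: powr_add powr_realpow)
      have 2: "t powr (real K + real ?d / 2) / t powr (real K - s / 2 + \<tau> / 2) = t powr ((s + (real ?d - \<tau>)) / 2)"
        unfolding powr_diff[symmetric] by (rule arg_cong[of _ _ "(powr) t"]) (simp add: field_simps)
      have "c0 / (2 * D) * (a / b) = c0 / 2 * a / (D * b)" for a b by simp
      then show ?thesis by (simp only: 1 2[symmetric])
    qed
    also have "\<dots> \<le> \<bar>equal_weight_rule X (zonal F y) - (\<integral>x. zonal F y x \<partial>sphere_measure)\<bar> / ?B"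
      using diff B by (intro divide_right_mono) auto
    finally have "ennreal (c0 / (2 * D) * t powr ((s + (real ?d - \<tau>)) / 2))
        \<le> ennreal (\<bar>equal_weight_rule X (zonal F y) - (\<integral>x. zonal F y x \<partial>sphere_measure)\<bar> / ?B)"
      by (rule ennreal_leI)
    also have "\<dots> \<le> wce X p s" by (rule wce_ge_quotient[OF p n zc g(1,2) B gB])
    finally show ?thesis unfolding \<tau>_def .
  qed
  show ?thesis
  proof (intro exI[of _ "c0 / (2 * D)"] conjI allI impI)
    show "c0 / (2 * D) > 0" using c0 D by simp
    fix p :: ennreal and y :: "real^'n" and t :: real and X :: "(real^'n) set"
    assume "1 \<le> p" "y \<in> sphere 0 1" "0 < t" "t \<le> 1" "X \<subseteq> sphere 0 1" "finite X" "X \<noteq> {}" "\<forall>x\<in>X. x \<bullet> y \<le> 1 - t"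
    then show "ennreal (c0 / (2 * D) * t powr ((s + (real ?d - enn2real (of_nat ?d / p))) / 2)) \<le> wce X p s"
      by (intro main) blast+
  qed
qed

section \<open>The covering radius\<close>

lemma sin_ge_half: assumes "0 \<le> u" "u \<le> pi / 4" shows "u / 2 \<le> sin u"
proof -
  have "sin 0 - 0 / 2 \<le> sin u - u / 2"
  proof (rule DERIV_nonneg_imp_nondecreasing[OF assms(1)])
    fix x assume x: "0 \<le> x" "x \<le> u"
    have "cos (pi / 3) \<le> cos x" using x assms pi_gt_zero by (intro cos_monotone_0_pi_le) auto
    then have "cos x - 1 / 2 \<ge> 0" by (simp add: cos_60)
    moreover have "((\<lambda>x. sin x - x / 2) has_real_derivative cos x - 1 / 2) (at x)"
      by (auto intro!: derivative_eq_intros)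
    ultimately show "\<exists>y. ((\<lambda>x. sin x - x / 2) has_real_derivative y) (at x) \<and> 0 \<le> y" by blast
  qed
  then show ?thesis by simp
qed

lemma square_le_one_minus_cos:
  assumes "0 \<le> \<theta>" "\<theta> \<le> pi / 2" shows "\<theta>\<^sup>2 \<le> 8 * (1 - cos \<theta>)"
proof -
  have "\<theta> / 2 / 2 \<le> sin (\<theta> / 2)" using assms by (intro sin_ge_half) auto
  then have "(\<theta> / 4)\<^sup>2 \<le> (sin (\<theta> / 2))\<^sup>2" using assms by (intro power_mono) auto
  moreover have "cos \<theta> = 1 - 2 * (sin (\<theta> / 2))\<^sup>2" using cos_double_sin[of "\<theta> / 2"] by simp
  ultimately show ?thesis by (simp add: power_divide)
qed

text \<open>Some point y has distance more than half of the covering radius from all nodes. Halving keeps the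
angle below \<pi>/2, so the height of the cap is at most 1, and spares an argument that the supremum is
attained.\<close>

lemma covering_radius_empty_cap:
  fixes X :: "'a::euclidean_space set"
  assumes X: "finite X" "X \<noteq> {}" "X \<subseteq> sphere 0 1" and pos: "covering_radius X > 0"
  obtains y t where "y \<in> sphere 0 1" "0 < t" "t \<le> 1" "\<And>x. x \<in> X \<Longrightarrow> x \<bullet> y \<le> 1 - t"
    "covering_radius X \<le> 6 * sqrt t"
proof -
  let ?m = "\<lambda>x. MIN y\<in>X. arccos (x \<bullet> y)"
  let ?S = "sphere 0 1 :: 'a set"
  have S: "?S \<noteq> {}" using X by auto
  have in1: "-1 \<le> x \<bullet> y" "x \<bullet> y \<le> 1" if "x \<in> ?S" "y \<in> X" for x y
    using Cauchy_Schwarz_ineq2[of x y] that X(3) by (auto simp: subset_iff abs_le_iff)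
  have mpi: "?m x \<le> pi" if "x \<in> ?S" for x
  proof -
    obtain z where z: "z \<in> X" using X(2) by blast
    have "?m x \<le> arccos (x \<bullet> z)" using X(1) z by (intro Min_le) auto
    also have "\<dots> \<le> pi" using in1[OF that z] by (rule arccos_ubound)
    finally show ?thesis .
  qed
  have bdd: "bdd_above (?m ` ?S)" using mpi by (intro bdd_aboveI2) blast
  have le_pi: "covering_radius X \<le> pi"
    unfolding covering_radius_def using S mpi by (intro cSUP_least) auto
  define \<theta> where "\<theta> = covering_radius X / 2"
  have \<theta>: "0 < \<theta>" "\<theta> \<le> pi / 2" using pos le_pi by (auto simp: \<theta>_def)
  have "\<theta> < covering_radius X" using pos by (simp add: \<theta>_def)
  then obtain y where y: "y \<in> ?S" "\<theta> < ?m y"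
    unfolding covering_radius_def using less_cSUP_iff[OF S bdd] by blast
  have "x \<bullet> y \<le> cos \<theta>" if "x \<in> X" for x
  proof -
    have "?m y \<le> arccos (y \<bullet> x)" using X(1) that by (intro Min_le) auto
    then have "\<theta> \<le> arccos (y \<bullet> x)" using y(2) by simp
    then have "cos (arccos (y \<bullet> x)) \<le> cos \<theta>"
      using \<theta> arccos_ubound[OF in1[OF y(1) that]] by (intro cos_monotone_0_pi_le) auto
    then show ?thesis using in1[OF y(1) that] by (simp add: inner_commute)
  qed
  moreover have sq: "\<theta>\<^sup>2 \<le> 8 * (1 - cos \<theta>)" using \<theta> by (intro square_le_one_minus_cos) auto
  moreover have "0 < 1 - cos \<theta>"
    using less_le_trans[OF zero_less_power[OF \<theta>(1), of 2] sq] by simp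
  moreover have "1 - cos \<theta> \<le> 1" using \<theta> by (simp add: cos_ge_zero)
  moreover have "covering_radius X \<le> 6 * sqrt (1 - cos \<theta>)"
  proof -
    have "\<theta> \<le> sqrt (9 * (1 - cos \<theta>))"
      by (intro real_le_rsqrt order_trans[OF sq]) (use \<open>0 < 1 - cos \<theta>\<close> in simp)
    also have "\<dots> = 3 * sqrt (1 - cos \<theta>)" unfolding real_sqrt_mult by simp
    finally show ?thesis by (simp add: \<theta>_def)
  qed
  ultimately show ?thesis using that[OF y(1), of "1 - cos \<theta>"] by simp
qed

lemma ennpowr_lower:
  assumes "ennreal b \<le> w" "0 \<le> b" "0 \<le> r"
  shows "ennreal (b powr r) \<le> ennpowr w r"
proof (cases w)
  case (real u)
  then show ?thesis using assms by (auto simp: ennpowr_def intro!: ennreal_leI powr_mono2)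
qed (simp add: ennpowr_def)

text \<open>The exponent found above contains d - d/p, the statement to be proved d/q.\<close>

lemma conjugate_exponent_dimension:
  fixes p q :: ennreal
  assumes pq: "1 \<le> p" "1 \<le> q" "1 / p + 1 / q = 1"
  shows "enn2real (of_nat d / q) = real d - enn2real (of_nat d / p)"
proof -
  have fin: "of_nat d / r < (\<infinity>::ennreal)" if "1 \<le> r" for r :: ennreal
  proof -
    have "r \<noteq> 0" using that by auto
    then show ?thesis
      unfolding infinity_ennreal_def less_top[symmetric] ennreal_divide_eq_top_iff by simp
  qed
  have "(of_nat d :: ennreal) / p + of_nat d / q = of_nat d * (1 / p + 1 / q)"
    by (simp add: distrib_left ennreal_times_divide)
  also have "\<dots> = ennreal (real d)" using pq by (simp add: ennreal_of_nat_eq_real_of_nat)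
  finally have "enn2real (of_nat d / p + of_nat d / q) = real d" by simp
  then show ?thesis using enn2real_plus[OF fin[OF pq(1), unfolded infinity_ennreal_def] fin[OF pq(2), unfolded infinity_ennreal_def]] by simp
qed

theorem theorem1p2:
  fixes d :: nat and s :: real
  assumes "d \<ge> 1" and "CARD('n::finite) = d + 1"
  shows "\<exists>c::real. c > 0 \<and>
    (\<forall>(p::ennreal) (q::ennreal) (N::nat) (X :: (real ^ 'n) set).
       1 \<le> p \<longrightarrow> 1 \<le> q \<longrightarrow> 1 / p + 1 / q = 1 \<longrightarrow> s > enn2real (of_nat d / p) \<longrightarrow>
       N > 0 \<longrightarrow> X \<subseteq> sphere 0 1 \<longrightarrow> card X = N \<longrightarrow>
       ennreal (covering_radius X)
         \<le> ennreal c * ennpowr (wce X p s) (1 / (s + enn2real (of_nat d / q))))"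
proof (cases "s > 0")
  case False
  have "\<not> s > enn2real (of_nat d / p)" for p
    using False enn2real_nonneg[of "of_nat d / p"] by linarith
  then show ?thesis by (intro exI[of _ 1]) auto
next
  case s: True
  have n: "CARD('n) \<ge> 2" and d: "CARD('n) - 1 = d" using assms by auto
  from wce_lower_bound_empty_cap[OF n s, unfolded d] obtain E where
    E0: "E > 0 \<and> (\<forall>p y t. \<forall>X :: (real^'n) set. 1 \<le> p \<longrightarrow> y \<in> sphere 0 1 \<longrightarrow> 0 < t \<longrightarrow> t \<le> 1 \<longrightarrow>
      X \<subseteq> sphere 0 1 \<longrightarrow> finite X \<longrightarrow> X \<noteq> {} \<longrightarrow> (\<forall>x\<in>X. x \<bullet> y \<le> 1 - t) \<longrightarrow>
      ennreal (E * t powr ((s + (real d - enn2real (of_nat d / p))) / 2)) \<le> wce X p s)"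
    by (rule exE)
  have E: "E > 0" by (rule conjunct1[OF E0])
  note wce = conjunct2[OF E0, rule_format]
  \<comment> \<open>a lower bound for E powr (1 / (s + d / q)) that does not depend on q, as the exponent is at most 1 / s\<close>
  define E' where "E' = min 1 E powr (1 / s)"
  have E': "E' > 0" using E by (simp add: E'_def)
  have "ennreal (covering_radius X) \<le> ennreal (6 / E') * ennpowr (wce X p s) (1 / (s + enn2real (of_nat d / q)))"
    if pq: "1 \<le> p" "1 \<le> q" "1 / p + 1 / q = 1" and X: "finite X" "X \<noteq> {}" "X \<subseteq> sphere 0 1" for p q and X :: "(real^'n) set"
  proof (cases "covering_radius X > 0")
    case False
    then show ?thesis by (simp add: ennreal_neg)
  next
    case True
    obtain y t where y: "y \<in> sphere 0 1" and t: "0 < t" "t \<le> 1" and Xy: "\<And>x. x \<in> X \<Longrightarrow> x \<bullet> y \<le> 1 - t"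
      and \<rho>: "covering_radius X \<le> 6 * sqrt t"
      using covering_radius_empty_cap[OF X True] by blast
    define \<beta> where "\<beta> = s + enn2real (of_nat d / q)"
    have \<beta>: "\<beta> \<ge> s" by (simp add: \<beta>_def)
    have w: "ennreal (E * t powr (\<beta> / 2)) \<le> wce X p s"
      using wce[OF pq(1) y t X(3,1,2)] Xy unfolding \<beta>_def conjugate_exponent_dimension[OF pq] .
    have "E' * sqrt t \<le> (E * t powr (\<beta> / 2)) powr (1 / \<beta>)"
    proof -
      have "E' \<le> min 1 E powr (1 / \<beta>)"
        unfolding E'_def using E s \<beta> by (intro powr_mono') (auto simp: frac_le)
      also have "\<dots> \<le> E powr (1 / \<beta>)"
        using E s \<beta> by (intro powr_mono2) auto
      finally have "E' * sqrt t \<le> E powr (1 / \<beta>) * sqrt t" using t by (intro mult_right_mono) auto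
      also have "\<dots> = (E * t powr (\<beta> / 2)) powr (1 / \<beta>)"
        using E s \<beta> t by (simp add: powr_mult powr_powr powr_half_sqrt)
      finally show ?thesis .
    qed
    then have "sqrt t \<le> (E * t powr (\<beta> / 2)) powr (1 / \<beta>) / E'"
      using E' by (simp add: pos_le_divide_eq mult.commute)
    then have "covering_radius X \<le> 6 / E' * (E * t powr (\<beta> / 2)) powr (1 / \<beta>)"
      using \<rho> by simp
    then have "ennreal (covering_radius X) \<le> ennreal (6 / E') * ennreal ((E * t powr (\<beta> / 2)) powr (1 / \<beta>))"
      using E' by (simp add: ennreal_mult[symmetric] ennreal_leI)
    also have "\<dots> \<le> ennreal (6 / E') * ennpowr (wce X p s) (1 / \<beta>)"
      using E s \<beta> by (intro mult_left_mono ennpowr_lower w) auto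
    finally show ?thesis unfolding \<beta>_def .
  qed
  note main = this
  show ?thesis
  proof (intro exI[of _ "6 / E'"] conjI allI impI)
    show "6 / E' > 0" using E' by simp
    fix p q :: ennreal and N :: nat and X :: "(real^'n) set"
    assume "1 \<le> p" "1 \<le> q" "1 / p + 1 / q = 1" "N > 0" "X \<subseteq> sphere 0 1" "card X = N"
    moreover from this have "finite X" "X \<noteq> {}" using card_gt_0_iff[of X] by auto
    ultimately show "ennreal (covering_radius X)
        \<le> ennreal (6 / E') * ennpowr (wce X p s) (1 / (s + enn2real (of_nat d / q)))"
      by (intro main)
  qed
qed

end
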